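(* A shift space $X$ is a minimal dendric shift over $\mathcal{A}_3=\{1,2,3\}$ if and only if there exist a permutation $\pi_0\in\Sigma_3$, a sequence $(\sigma_n)_{n\ge1}$ of morphisms in $\Sigma_3\mathcal{S}_3\Sigma_3$ and a sequence $(v_n)_{n\ge1}$ of vertices of the graph $\mathcal{G}'$ described below such that for every $n$, $\sigma_n$ labels an edge of $\mathcal{G}'$ from $v_n$ to $v_{n+1}$, and the directive sequence $(\pi_0,\sigma_1,\sigma_2,\dots)$ is primitive and is an $\mathcal{S}$-adic representation of $X$.
   Context: A shift space over a finite alphabet $\mathcal{A}$ is a closed shift-invariant $X\subseteq\mathcal{A}^{\mathbb{Z}}$ in which every letter occurs; $\mathcal{L}(X)$ is its set of finite factors (including the empty word). $X$ is minimal if its only closed shift-invariant subsets are $\emptyset$ and $X$. For $w\in\mathcal{L}(X)$, the extension graph $\mathcal{E}_X(w)$ is the bipartite graph with left vertices $\{a: aw\in\mathcal{L}(X)\}$, right vertices $\{b: wb\in\mathcal{L}(X)\}$ and an edge $\{a,b\}$ whenever $awb\in\mathcal{L}(X)$; $X$ is dendric if all $\mathcal{E}_X(w)$, $w\in\mathcal{L}(X)$, are trees. Morphisms are non-erasing monoid morphisms. A directive sequence $\boldsymbol\sigma=(\sigma_n:\mathcal{A}_{n+1}^*\to\mathcal{A}_n^* )_{n\ge1}$ is primitive if for every $n$ there is $N>n$ such that every letter of $\mathcal{A}_n$ occurs in $\sigma_n\cdots\sigma_{N-1}(b)$ for all $b\in\mathcal{A}_N$; then it generates the shift $X_{\boldsymbol\sigma}$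 of all $x\in\mathcal{A}_1^{\mathbb{Z}}$ all of whose factors occur in some $\sigma_1\cdots\sigma_{N-1}(a)$, and is called a representation of $X_{\boldsymbol\sigma}$. $\pi_{abc}$ ($\{a,b,c\}=\{1,2,3\}$) is the morphism $1\mapsto a,2\mapsto b,3\mapsto c$; $\Sigma_3$ is the set of these; juxtaposition is composition; by convention $\pi(0)=0$ for $\pi\in\Sigma_3$. $\mathcal{S}_3=\{\alpha,\beta,\gamma,\eta\}\cup\{\delta^{(k)},\zeta^{(k)}:k\ge1\}$ with $\alpha:1\mapsto1,2\mapsto12,3\mapsto13$; $\beta:1\mapsto1,2\mapsto12,3\mapsto132$; $\gamma:1\mapsto1,2\mapsto12,3\mapsto123$; $\delta^{(k)}:1\mapsto1,2\mapsto123^k,3\mapsto123^{k+1}$; $\zeta^{(k)}:1\mapsto13^k,2\mapsto12,3\mapsto13^{k+1}$; $\eta:1\mapsto13,2\mapsto12,3\mapsto123$. $\Sigma_3\mathcal{S}_3\Sigma_3=\{\pi\sigma\pi'\}$. For $l,r\in\{0,1,2,3\}$, define a partial "image" map for each $\sigma'\in\mathcal{S}_3$ on pairs $[l,r]$: $\alpha$: $[l,r]\mapsto[l,r]$ (always defined); $\beta$: $[l,r]\mapsto[1,r]$ if $l\ne1$; $\gamma$: $[l,r]\mapsto[l,1]$ if $r\ne1$; $\delta^{(k)}$: $[l,r]\mapsto[3,1]$ if $l\ne1$ and $r\ne1$; $\zeta^{(k)}$: $[l,r]\mapsto[3,3]$ if $l\ne2$ and $r\ne2$; $\eta$: $[l,r]\mapsto[2,3]$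 if $l\ne2$ and $r\ne1$ (undefined otherwise). The graph $\mathcal{G}'$ has vertex set $\{[0,0],[0,3],[3,0],[3,2],[3,3]\}$ (and for each vertex an entering edge labeled by each permutation, corresponding to $\pi_0$); for $\pi,\pi'\in\Sigma_3$ and $\sigma'\in\mathcal{S}_3$ there is an edge from $[l,r]$ to $[l',r']$ labeled $\pi\sigma'\pi'$ if the image of $[\pi'(l'),\pi'(r')]$ under $\sigma'$ is defined and equals $[\pi^{-1}(l),\pi^{-1}(r)]$. *)

theory Defs
  imports "HOL-Analysis.Analysis" "HOL-Library.Sublist"
begin

definition A3 :: "nat set" where "A3 = {1,2,3}"

definition shift :: "(int \<Rightarrow> nat) \<Rightarrow> (int \<Rightarrow> nat)" where
  "shift x = (\<lambda>i. x (i + 1))"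

definition factor_of :: "nat list \<Rightarrow> (int \<Rightarrow> nat) \<Rightarrow> bool" where
  "factor_of w x \<longleftrightarrow> (\<exists>i. w = map (\<lambda>k. x (i + int k)) [0..<length w])"

definition lang :: "(int \<Rightarrow> nat) set \<Rightarrow> nat list set" where
  "lang X = {w. \<exists>x\<in>X. factor_of w x}"

definition shift_invariant :: "(int \<Rightarrow> nat) set \<Rightarrow> bool" where
  "shift_invariant X \<longleftrightarrow> shift ` X = X"

text \<open>Shift space over the alphabet A (product topology on nat^Z, nat discrete).\<close>
definition shift_space :: "nat set \<Rightarrow> (int \<Rightarrow> nat) set \<Rightarrow> bool" where
  "shift_space A X \<longleftrightarrow> X \<subseteq> {x. \<forall>i. x i \<in> A} \<and> closed X \<and> shift_invariant X
     \<and> (\<forall>a\<in>A. \<exists>x\<in>X. \<exists>i. x i = a)"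

definition minimal_shift :: "(int \<Rightarrow> nat) set \<Rightarrow> bool" where
  "minimal_shift X \<longleftrightarrow> (\<forall>Y. Y \<subseteq> X \<and> closed Y \<and> shift_invariant Y \<longrightarrow> Y = {} \<or> Y = X)"

definition ext_vertices :: "(int \<Rightarrow> nat) set \<Rightarrow> nat list \<Rightarrow> (nat + nat) set" where
  "ext_vertices X w = Inl ` {a. a # w \<in> lang X} \<union> Inr ` {b. w @ [b] \<in> lang X}"

definition ext_adj :: "(int \<Rightarrow> nat) set \<Rightarrow> nat list \<Rightarrow> (nat + nat) \<Rightarrow> (nat + nat) \<Rightarrow> bool" where
  "ext_adj X w u v \<longleftrightarrow>
     (\<exists>a b. ((u = Inl a \<and> v = Inr b) \<or> (u = Inr b \<and> v = Inl a)) \<and> a # w @ [b] \<in> lang X)"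

definition graph_connected :: "'v set \<Rightarrow> ('v \<Rightarrow> 'v \<Rightarrow> bool) \<Rightarrow> bool" where
  "graph_connected V E \<longleftrightarrow>
     (\<forall>u\<in>V. \<forall>v\<in>V. (\<lambda>x y. x \<in> V \<and> y \<in> V \<and> E x y)\<^sup>*\<^sup>* u v)"

definition graph_has_cycle :: "'v set \<Rightarrow> ('v \<Rightarrow> 'v \<Rightarrow> bool) \<Rightarrow> bool" where
  "graph_has_cycle V E \<longleftrightarrow>
     (\<exists>vs. length vs \<ge> 3 \<and> distinct vs \<and> set vs \<subseteq> V \<and>
        (\<forall>i<length vs. E (vs ! i) (vs ! ((i + 1) mod length vs))))"

definition graph_tree :: "'v set \<Rightarrow> ('v \<Rightarrow> 'v \<Rightarrow> bool) \<Rightarrow> bool" where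
  "graph_tree V E \<longleftrightarrow> V \<noteq> {} \<and> graph_connected V E \<and> \<not> graph_has_cycle V E"

definition dendric :: "(int \<Rightarrow> nat) set \<Rightarrow> bool" where
  "dendric X \<longleftrightarrow> (\<forall>w\<in>lang X. graph_tree (ext_vertices X w) (ext_adj X w))"

type_synonym morph = "nat \<Rightarrow> nat list"

definition morph_word :: "morph \<Rightarrow> nat list \<Rightarrow> nat list" where
  "morph_word f w = concat (map f w)"

definition morph_comp :: "morph \<Rightarrow> morph \<Rightarrow> morph" where
  "morph_comp f g = (\<lambda>a. morph_word f (g a))"

fun comp_seq :: "(nat \<Rightarrow> morph) \<Rightarrow> nat \<Rightarrow> nat \<Rightarrow> morph" where
  "comp_seq t n 0 = (\<lambda>a. [a])"
| "comp_seq t n (Suc k) = morph_comp (comp_seq t n k) (t (n + k))"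

definition primitive_seq :: "nat set \<Rightarrow> (nat \<Rightarrow> morph) \<Rightarrow> bool" where
  "primitive_seq A t \<longleftrightarrow>
     (\<forall>n. \<exists>N>n. \<forall>b\<in>A. \<forall>a\<in>A. a \<in> set (comp_seq t n (N - n) b))"

definition generated_shift :: "nat set \<Rightarrow> (nat \<Rightarrow> morph) \<Rightarrow> (int \<Rightarrow> nat) set" where
  "generated_shift A t = {x. (\<forall>i. x i \<in> A) \<and>
     (\<forall>w. factor_of w x \<longrightarrow> (\<exists>N. \<exists>a\<in>A. sublist w (comp_seq t 0 N a)))}"

definition perm_morph :: "(nat \<Rightarrow> nat) \<Rightarrow> morph" where
  "perm_morph p = (\<lambda>a. [p a])"

text \<open>Sigma_3: permutations of {1,2,3} (fixing everything else, in particular 0).\<close>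
definition Sigma3 :: "(nat \<Rightarrow> nat) set" where
  "Sigma3 = {p. p permutes {1,2,3}}"

datatype S3 = Alpha | Beta | Gamma | Delta nat | Zeta nat | Eta

definition S3_valid :: "S3 \<Rightarrow> bool" where
  "S3_valid s = (case s of Delta k \<Rightarrow> k \<ge> 1 | Zeta k \<Rightarrow> k \<ge> 1 | _ \<Rightarrow> True)"

fun S3_morph :: "S3 \<Rightarrow> morph" where
  "S3_morph Alpha = (\<lambda>a. if a = 1 then [1] else if a = 2 then [1,2] else if a = 3 then [1,3] else [])"
| "S3_morph Beta = (\<lambda>a. if a = 1 then [1] else if a = 2 then [1,2] else if a = 3 then [1,3,2] else [])"
| "S3_morph Gamma = (\<lambda>a. if a = 1 then [1] else if a = 2 then [1,2] else if a = 3 then [1,2,3] else [])"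
| "S3_morph (Delta k) = (\<lambda>a. if a = 1 then [1] else if a = 2 then [1,2] @ replicate k 3
     else if a = 3 then [1,2] @ replicate (k+1) 3 else [])"
| "S3_morph (Zeta k) = (\<lambda>a. if a = 1 then [1] @ replicate k 3 else if a = 2 then [1,2]
     else if a = 3 then [1] @ replicate (k+1) 3 else [])"
| "S3_morph Eta = (\<lambda>a. if a = 1 then [1,3] else if a = 2 then [1,2] else if a = 3 then [1,2,3] else [])"

fun S3_image :: "S3 \<Rightarrow> nat \<times> nat \<Rightarrow> (nat \<times> nat) option" where
  "S3_image Alpha (l, r) = Some (l, r)"
| "S3_image Beta (l, r) = (if l \<noteq> 1 then Some (1, r) else None)"
| "S3_image Gamma (l, r) = (if r \<noteq> 1 then Some (l, 1) else None)"
| "S3_image (Delta k) (l, r) = (if l \<noteq> 1 \<and> r \<noteq> 1 then Some (3, 1) else None)"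
| "S3_image (Zeta k) (l, r) = (if l \<noteq> 2 \<and> r \<noteq> 2 then Some (3, 3) else None)"
| "S3_image Eta (l, r) = (if l \<noteq> 2 \<and> r \<noteq> 1 then Some (2, 3) else None)"

definition Gvertices :: "(nat \<times> nat) set" where
  "Gvertices = {(0,0), (0,3), (3,0), (3,2), (3,3)}"

definition G_edge :: "nat \<times> nat \<Rightarrow> morph \<Rightarrow> nat \<times> nat \<Rightarrow> bool" where
  "G_edge v f v' \<longleftrightarrow> v \<in> Gvertices \<and> v' \<in> Gvertices \<and>
     (\<exists>p s p'. p \<in> Sigma3 \<and> p' \<in> Sigma3 \<and> S3_valid s \<and>
        f = morph_comp (perm_morph p) (morph_comp (S3_morph s) (perm_morph p')) \<and>
        S3_image s (p' (fst v'), p' (snd v')) = Some (inv p (fst v), inv p (snd v)))"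

end

theory Submission
  imports Defs
begin

text \<open>Everything is read off the language of the shift. Each morphism s of S3 writes every letter
as a block starting with 1 and containing no other 1, so a word w containing 1 factors uniquely as
x s(u) z with x free of 1 and z consisting of a 1 followed by a word without 1. The extension graph of w is then the
image of the extension graph of u under two partial maps depending on x and z only. On either side such a
map is the identity, is constant, or, for one pair of letters depending on s, either merges that pair
or restricts to it. The image of a tree is a tree exactly when the merged pair has a common
neighbour, and this is what the labels of a path in the graph record: a label l different from 0 says that
the two letters other than l need not have a common neighbour. Along a path, induction on the length of a word therefore gives
dendricity; words without 1 are checked directly.

Conversely, there are 33 strongly connected spanning trees of the complete bipartite graph on 3 + 3 letters, and
up to renaming they are the six graphs of two-letter words produced by S3. The return words to 1 are thus
known up to the exponents of runs of 3, and dendricity forces these exponents to be k and k + 1. Hence a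
minimal dendric language is the image of another one, the labels being read off
the pairs of letters that extend arbitrarily long words.
Iterating gives a path, whose directive sequence is primitive because otherwise arbitrarily high
powers of one letter would occur.\<close>

text \<open>A label belongs to a whole language, not to a word, and it arises differently in the two
  directions. From a shift it comes as a limit: the pairs of letters that precede common words of
  every length form a graph on the three letters. Connected extension graphs leave no letter of it
  isolated, so it is complete (label 0) or a star (labelled by its centre). Along a path the label
  is instead an invariant to be propagated: in every extension graph, each pair containing the
  label, and each pair at all if it is 0, has a common neighbour. A merging morphism preserves trees
  if the pair it merges is not the exempt one; this is the meaning of the inequalities in the image
  rules. Desubstituted shifts are never constructed. Above the first level only languages occur, and
  topology serves only to compare a shift with its language. The induction for dendricity has to
  treat all levels at once, because desubstitution shortens a word but moves it one level
  up.\<close>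

subsection \<open>Bipartite trees on three letters\<close>

text \<open>A relation stands for the edges of an extension graph, from left letters to right letters. With
three letters on each side, connected left vertices are joined by at most two common neighbours, and
cycles have length four or six.\<close>
definition share :: "(nat \<times> nat) set \<Rightarrow> nat \<Rightarrow> nat \<Rightarrow> bool" where
  "share E a b \<longleftrightarrow> (\<exists>d. (a,d) \<in> E \<and> (b,d) \<in> E)"

definition linked :: "(nat \<times> nat) set \<Rightarrow> bool" where
  "linked E \<longleftrightarrow> (\<forall>a\<in>Domain E. \<forall>b\<in>Domain E. share E a b \<or> (\<exists>c. share E a c \<and> share E c b))"

definition no_C4 :: "(nat \<times> nat) set \<Rightarrow> bool" where
  "no_C4 E \<longleftrightarrow> (\<forall>a b c d. (a,c) \<in> E \<longrightarrow> (a,d) \<in> E \<longrightarrow> (b,c) \<in> E \<longrightarrow> (b,d) \<in> E \<longrightarrow> a = b \<or> c = d)"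

definition no_C6 :: "(nat \<times> nat) set \<Rightarrow> bool" where
  "no_C6 E \<longleftrightarrow> (\<forall>a1 a2 a3 b1 b2 b3. (a1,b1) \<in> E \<longrightarrow> (a2,b1) \<in> E \<longrightarrow> (a2,b2) \<in> E \<longrightarrow> (a3,b2) \<in> E
     \<longrightarrow> (a3,b3) \<in> E \<longrightarrow> (a1,b3) \<in> E \<longrightarrow> \<not> (distinct [a1,a2,a3] \<and> distinct [b1,b2,b3]))"

definition tree_rel :: "(nat \<times> nat) set \<Rightarrow> bool" where
  "tree_rel E \<longleftrightarrow> E \<noteq> {} \<and> linked E \<and> linked (E\<inverse>) \<and> no_C4 E \<and> no_C6 E"

lemma A3_iff: "a \<in> A3 \<longleftrightarrow> a = 1 \<or> a = 2 \<or> a = 3"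
  by (auto simp: A3_def)

text \<open>The nine arguments are the entries of the incidence matrix, row by row.\<close>
definition linked9 where
 "linked9 x1 y1 z1 x2 y2 z2 x3 y3 z3 \<longleftrightarrow>
   (let s12 = (x1 \<and> x2 \<or> y1 \<and> y2 \<or> z1 \<and> z2); s13 = (x1 \<and> x3 \<or> y1 \<and> y3 \<or> z1 \<and> z3);
        s23 = (x2 \<and> x3 \<or> y2 \<and> y3 \<or> z2 \<and> z3); d1 = (x1 \<or> y1 \<or> z1); d2 = (x2 \<or> y2 \<or> z2); d3 = (x3 \<or> y3 \<or> z3)
    in (d1 \<and> d2 \<longrightarrow> s12 \<or> s13 \<and> s23) \<and> (d1 \<and> d3 \<longrightarrow> s13 \<or> s12 \<and> s23) \<and> (d2 \<and> d3 \<longrightarrow> s23 \<or> s12 \<and> s13))"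

definition tree9 where
 "tree9 x1 y1 z1 x2 y2 z2 x3 y3 z3 \<longleftrightarrow>
   (x1 \<or> y1 \<or> z1 \<or> x2 \<or> y2 \<or> z2 \<or> x3 \<or> y3 \<or> z3) \<and>
   linked9 x1 y1 z1 x2 y2 z2 x3 y3 z3 \<and> linked9 x1 x2 x3 y1 y2 y3 z1 z2 z3 \<and>
   \<not>(x1 \<and> y1 \<and> x2 \<and> y2) \<and> \<not>(x1 \<and> y1 \<and> x3 \<and> y3) \<and> \<not>(x3 \<and> y3 \<and> x2 \<and> y2) \<and>
   \<not>(x1 \<and> z1 \<and> x2 \<and> z2) \<and> \<not>(x1 \<and> z1 \<and> x3 \<and> z3) \<and> \<not>(x3 \<and> z3 \<and> x2 \<and> z2) \<and>
   \<not>(z1 \<and> y1 \<and> z2 \<and> y2) \<and> \<not>(z1 \<and> y1 \<and> z3 \<and> y3) \<and> \<not>(z3 \<and> y3 \<and> z2 \<and> y2) \<and>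
   \<not>(x1 \<and> x2 \<and> y2 \<and> y3 \<and> z3 \<and> z1) \<and> \<not>(x1 \<and> x2 \<and> z2 \<and> z3 \<and> y3 \<and> y1) \<and>
   \<not>(y1 \<and> y2 \<and> x2 \<and> x3 \<and> z3 \<and> z1) \<and> \<not>(y1 \<and> y2 \<and> z2 \<and> z3 \<and> x3 \<and> x1) \<and>
   \<not>(z1 \<and> z2 \<and> x2 \<and> x3 \<and> y3 \<and> y1) \<and> \<not>(z1 \<and> z2 \<and> y2 \<and> y3 \<and> x3 \<and> x1)"

context
  fixes E :: "(nat \<times> nat) set" and a b c x y z :: nat
  assumes A: "A3 = {a,b,c}" "distinct [a,b,c]" and B: "A3 = {x,y,z}" "distinct [x,y,z]"
    and E: "E \<subseteq> A3 \<times> A3"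
begin

lemma share_iff: "share E u v \<longleftrightarrow> (u,x) \<in> E \<and> (v,x) \<in> E \<or> (u,y) \<in> E \<and> (v,y) \<in> E \<or> (u,z) \<in> E \<and> (v,z) \<in> E"
  using E unfolding share_def B by blast

lemma Domain_iff_three: "u \<in> Domain E \<longleftrightarrow> (u,x) \<in> E \<or> (u,y) \<in> E \<or> (u,z) \<in> E"
  using E unfolding B by blast

lemma linked_three:
  "linked E \<longleftrightarrow> (a \<in> Domain E \<and> b \<in> Domain E \<longrightarrow> share E a b \<or> share E a c \<and> share E b c) \<and>
     (a \<in> Domain E \<and> c \<in> Domain E \<longrightarrow> share E a c \<or> share E a b \<and> share E b c) \<and>
     (b \<in> Domain E \<and> c \<in> Domain E \<longrightarrow> share E b c \<or> share E a b \<and> share E a c)" (is "_ \<longleftrightarrow> ?P \<and> ?Q \<and> ?R")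
proof -
  have sy: "share E u v \<longleftrightarrow> share E v u" for u v unfolding share_def by blast
  have rf: "share E u u" if "u \<in> Domain E" for u using that unfolding share_def by blast
  have m: "u = a \<or> u = b \<or> u = c" if "share E u v" for u v using that E A(1) unfolding share_def by blast
  have D: "u = a \<or> u = b \<or> u = c" if "u \<in> Domain E" for u using that E A(1) by blast
  show ?thesis
  proof
    assume l: "linked E"
    have l2: "share E u v \<or> (\<exists>w\<in>{a,b,c}. share E u w \<and> share E w v)" if "u \<in> Domain E" "v \<in> Domain E" for u v
      using l that m sy unfolding linked_def by blast
    have ?P using l2[of a b] sy by auto
    moreover have ?Q using l2[of a c] sy by auto
    moreover have ?R using l2[of b c] sy by auto
    ultimately show "?P \<and> ?Q \<and> ?R" by blast
  next
    assume p: "?P \<and> ?Q \<and> ?R"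
    show "linked E" unfolding linked_def
    proof (intro ballI)
      fix u v assume uv: "u \<in> Domain E" "v \<in> Domain E"
      show "share E u v \<or> (\<exists>w. share E u w \<and> share E w v)"
        using D[OF uv(1)] D[OF uv(2)] uv p rf sy by (elim disjE; hypsubst; metis)
    qed
  qed
qed

lemma linked_iff9:
  "linked E \<longleftrightarrow> linked9 ((a,x)\<in>E) ((a,y)\<in>E) ((a,z)\<in>E) ((b,x)\<in>E) ((b,y)\<in>E) ((b,z)\<in>E)
      ((c,x)\<in>E) ((c,y)\<in>E) ((c,z)\<in>E)"
  unfolding linked_three linked9_def Let_def share_iff Domain_iff_three ..

end

lemma no_C4_iff: assumes E: "E \<subseteq> {a,b,c} \<times> {x,y,z}" and d: "distinct [a,b,c]" "distinct [x,y,z]"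
  shows "no_C4 E \<longleftrightarrow> 
   \<not>((a,x)\<in>E \<and> (a,y)\<in>E \<and> (b,x)\<in>E \<and> (b,y)\<in>E) \<and> \<not>((a,x)\<in>E \<and> (a,y)\<in>E \<and> (c,x)\<in>E \<and> (c,y)\<in>E) \<and> \<not>((c,x)\<in>E \<and> (c,y)\<in>E \<and> (b,x)\<in>E \<and> (b,y)\<in>E) \<and>
   \<not>((a,x)\<in>E \<and> (a,z)\<in>E \<and> (b,x)\<in>E \<and> (b,z)\<in>E) \<and> \<not>((a,x)\<in>E \<and> (a,z)\<in>E \<and> (c,x)\<in>E \<and> (c,z)\<in>E) \<and> \<not>((c,x)\<in>E \<and> (c,z)\<in>E \<and> (b,x)\<in>E \<and> (b,z)\<in>E) \<and>
   \<not>((a,z)\<in>E \<and> (a,y)\<in>E \<and> (b,z)\<in>E \<and> (b,y)\<in>E) \<and> \<not>((a,z)\<in>E \<and> (a,y)\<in>E \<and> (c,z)\<in>E \<and> (c,y)\<in>E) \<and> \<not>((c,z)\<in>E \<and> (c,y)\<in>E \<and> (b,z)\<in>E \<and> (b,y)\<in>E)"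
   (is "_ \<longleftrightarrow> ?R")
proof
  assume "no_C4 E" 
  with d show ?R unfolding no_C4_def by auto
next
  assume R: ?R
  show "no_C4 E" unfolding no_C4_def
  proof (intro allI impI, rule ccontr)
    fix u v p q
    assume e: "(u,p) \<in> E" "(u,q) \<in> E" "(v,p) \<in> E" "(v,q) \<in> E" and dd: "\<not> (u = v \<or> p = q)"
    have m: "u \<in> {a,b,c}" "v \<in> {a,b,c}" "p \<in> {x,y,z}" "q \<in> {x,y,z}"
      using E e by blast+
    have 1: "(u,v) \<in> {(a,b),(a,c),(b,a),(b,c),(c,a),(c,b)}" using m dd by auto
    have 2: "(p,q) \<in> {(x,y),(x,z),(y,x),(y,z),(z,x),(z,y)}" using m dd by auto
    show False using 1 2 e R by (elim insertE emptyE) simp_all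
  qed
qed

text \<open>A hexagon uses all six vertices. Rotating and reflecting it puts its left letters in the
  order a, b, c, so only the six orders of the right letters remain.\<close>

lemma no_C6_iff: assumes E: "E \<subseteq> {a,b,c} \<times> {x,y,z}" and d: "distinct [a,b,c]" "distinct [x,y,z]"
  shows "no_C6 E \<longleftrightarrow> 
   \<not>((a,x)\<in>E \<and> (b,x)\<in>E \<and> (b,y)\<in>E \<and> (c,y)\<in>E \<and> (c,z)\<in>E \<and> (a,z)\<in>E) \<and>
   \<not>((a,x)\<in>E \<and> (b,x)\<in>E \<and> (b,z)\<in>E \<and> (c,z)\<in>E \<and> (c,y)\<in>E \<and> (a,y)\<in>E) \<and>
   \<not>((a,y)\<in>E \<and> (b,y)\<in>E \<and> (b,x)\<in>E \<and> (c,x)\<in>E \<and> (c,z)\<in>E \<and> (a,z)\<in>E) \<and>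
   \<not>((a,y)\<in>E \<and> (b,y)\<in>E \<and> (b,z)\<in>E \<and> (c,z)\<in>E \<and> (c,x)\<in>E \<and> (a,x)\<in>E) \<and>
   \<not>((a,z)\<in>E \<and> (b,z)\<in>E \<and> (b,x)\<in>E \<and> (c,x)\<in>E \<and> (c,y)\<in>E \<and> (a,y)\<in>E) \<and>
   \<not>((a,z)\<in>E \<and> (b,z)\<in>E \<and> (b,y)\<in>E \<and> (c,y)\<in>E \<and> (c,x)\<in>E \<and> (a,x)\<in>E)"
   (is "_ \<longleftrightarrow> ?R")
proof
  assume "no_C6 E" 
  then have n: "\<not> ((a1,b1) \<in> E \<and> (a2,b1) \<in> E \<and> (a2,b2) \<in> E \<and> (a3,b2) \<in> E \<and> (a3,b3) \<in> E \<and> (a1,b3) \<in> E)"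
    if "distinct [a1,a2,a3]" "distinct [b1,b2,b3]" for a1 a2 a3 b1 b2 b3
    using that unfolding no_C6_def by blast
  show ?R using n[OF d] n[of a b c x z y] n[of a b c y x z] n[of a b c y z x] n[of a b c z x y] n[of a b c z y x] d
    by auto
next
  assume R: ?R
  show "no_C6 E" unfolding no_C6_def
  proof (intro allI impI notI)
    fix a1 a2 a3 b1 b2 b3
    assume e: "(a1,b1) \<in> E" "(a2,b1) \<in> E" "(a2,b2) \<in> E" "(a3,b2) \<in> E" "(a3,b3) \<in> E" "(a1,b3) \<in> E"
      and dd: "distinct [a1,a2,a3] \<and> distinct [b1,b2,b3]"
    have m: "a1 \<in> {a,b,c}" "a2 \<in> {a,b,c}" "a3 \<in> {a,b,c}" "b1 \<in> {x,y,z}" "b2 \<in> {x,y,z}" "b3 \<in> {x,y,z}"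
      using E e by blast+
    have 1: "(a1,a2,a3) \<in> {(a,b,c),(a,c,b),(b,a,c),(b,c,a),(c,a,b),(c,b,a)}" using m dd by auto
    have 2: "(b1,b2,b3) \<in> {(x,y,z),(x,z,y),(y,x,z),(y,z,x),(z,x,y),(z,y,x)}" using m dd by auto
    show False using 1 2 e R by (elim insertE emptyE) simp_all
  qed
qed

text \<open>Nine incidence bits turn being a tree into a propositional formula, so that concrete
  graphs, and also all graphs at once, can be settled by case distinction.\<close>

lemma tree_rel_iff:
  assumes A: "A3 = {a,b,c}" "distinct [a,b,c]" and B: "A3 = {x,y,z}" "distinct [x,y,z]"
    and E: "E \<subseteq> A3 \<times> A3"
  shows "tree_rel E \<longleftrightarrow> tree9 ((a,x)\<in>E) ((a,y)\<in>E) ((a,z)\<in>E) ((b,x)\<in>E) ((b,y)\<in>E) ((b,z)\<in>E)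
      ((c,x)\<in>E) ((c,y)\<in>E) ((c,z)\<in>E)"
proof -
  have E': "E\<inverse> \<subseteq> A3 \<times> A3" using E by blast
  have E2: "E \<subseteq> {a,b,c} \<times> {x,y,z}" using E unfolding A(1)[symmetric] B(1)[symmetric] .
  have ne: "E \<noteq> {} \<longleftrightarrow> (a,x)\<in>E \<or> (a,y)\<in>E \<or> (a,z)\<in>E \<or> (b,x)\<in>E \<or> (b,y)\<in>E \<or> (b,z)\<in>E \<or> (c,x)\<in>E \<or> (c,y)\<in>E \<or> (c,z)\<in>E"
    using E2 by blast
  show ?thesis unfolding tree_rel_def tree9_def ne linked_iff9[OF A B E] linked_iff9[OF B A E'] no_C4_iff[OF E2 A(2) B(2)] no_C6_iff[OF E2 A(2) B(2)] converse_iff conj_assoc ..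
qed

text \<open>With l = 0 all left vertices have common neighbours; a letter l exempts the two other letters.\<close>
definition label_ok :: "nat \<Rightarrow> (nat \<times> nat) set \<Rightarrow> bool" where
  "label_ok l E \<longleftrightarrow> (\<forall>a\<in>Domain E. \<forall>b\<in>Domain E. l = 0 \<or> l = a \<or> l = b \<longrightarrow> share E a b)"

definition good_tree :: "nat \<Rightarrow> nat \<Rightarrow> (nat \<times> nat) set \<Rightarrow> bool" where
  "good_tree l r E \<longleftrightarrow> tree_rel E \<and> label_ok l E \<and> label_ok r (E\<inverse>)"

lemma share_sym: "share E a b \<longleftrightarrow> share E b a"
  by (auto simp: share_def)

lemma share_refl: "a \<in> Domain E \<Longrightarrow> share E a a"
  by (auto simp: share_def)

lemma no_C4_converse: "no_C4 (E\<inverse>) \<longleftrightarrow> no_C4 E"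
  unfolding no_C4_def by (metis converse_iff)

lemma no_C6_converse: "no_C6 (E\<inverse>) \<longleftrightarrow> no_C6 E"
proof -
  have 1: "no_C6 E \<Longrightarrow> no_C6 (E\<inverse>)" for E
    unfolding no_C6_def
  proof (intro allI impI notI)
    fix a1 a2 a3 b1 b2 b3
    assume n: "\<forall>a1 a2 a3 b1 b2 b3. (a1,b1) \<in> E \<longrightarrow> (a2,b1) \<in> E \<longrightarrow> (a2,b2) \<in> E \<longrightarrow> (a3,b2) \<in> E
     \<longrightarrow> (a3,b3) \<in> E \<longrightarrow> (a1,b3) \<in> E \<longrightarrow> \<not> (distinct [a1,a2,a3] \<and> distinct [b1,b2,b3])"
      and "(a1,b1) \<in> E\<inverse>" "(a2,b1) \<in> E\<inverse>" "(a2,b2) \<in> E\<inverse>" "(a3,b2) \<in> E\<inverse>" "(a3,b3) \<in> E\<inverse>" "(a1,b3) \<in> E\<inverse>"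
      and "distinct [a1,a2,a3] \<and> distinct [b1,b2,b3]"
    then show False
      using n[rule_format, of b1 a2 b2 a3 b3 a1] by auto
  qed
  show ?thesis using 1[of E] 1[of "E\<inverse>"] by auto
qed

lemma tree_rel_converse: "tree_rel (E\<inverse>) \<longleftrightarrow> tree_rel E"
  unfolding tree_rel_def no_C4_converse no_C6_converse by auto

lemma good_tree_converse: "good_tree l r (E\<inverse>) \<longleftrightarrow> good_tree r l E"
  unfolding good_tree_def tree_rel_converse by auto

lemma A3_four: "d \<in> A3 \<Longrightarrow> e \<in> A3 \<Longrightarrow> f \<in> A3 \<Longrightarrow> g \<in> A3 \<Longrightarrow> d = e \<or> d = f \<or> d = g \<or> e = f \<or> e = g \<or> f = g"
  by (auto simp: A3_iff)

text \<open>A chain d, a, e, c, f, b, g passes through four right letters. Two of them coincide, and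
  the chain can be shortened there.\<close>

lemma linked_converse:
  assumes E: "E \<subseteq> A3 \<times> A3" and l: "linked E"
  shows "linked (E\<inverse>)"
  unfolding linked_def
proof (intro ballI)
  fix d g assume "d \<in> Domain (E\<inverse>)" "g \<in> Domain (E\<inverse>)"
  then obtain a b where a: "(a,d) \<in> E" and b: "(b,g) \<in> E" by blast
  have "share E a b \<or> (\<exists>c. share E a c \<and> share E c b)"
    using l a b unfolding linked_def by blast
  then show "share (E\<inverse>) d g \<or> (\<exists>c. share (E\<inverse>) d c \<and> share (E\<inverse>) c g)"
  proof
    assume "share E a b"
    with a b show ?thesis unfolding share_def converse_iff by blast
  next
    assume "\<exists>c. share E a c \<and> share E c b"
    then obtain c e f where c: "(a,e) \<in> E" "(c,e) \<in> E" "(c,f) \<in> E" "(b,f) \<in> E"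
      unfolding share_def by blast
    have "d \<in> A3" "e \<in> A3" "f \<in> A3" "g \<in> A3" using E a b c by blast+
    from A3_four[OF this] show ?thesis
      using a b c unfolding share_def converse_iff by metis
  qed
qed

lemma linked_by_two:
  assumes E: "E \<subseteq> A3 \<times> A3" and D: "Domain E \<subseteq> {p,q}"
    and c: "p \<in> Domain E \<Longrightarrow> q \<in> Domain E \<Longrightarrow> share E p q"
  shows "linked E"
  unfolding linked_def using D c share_sym share_refl by blast

text \<open>With at most two left letters everything is decided by the common neighbours of p and q:
  one makes the graph connected, a second one would make a square, and a hexagon lacks a third left
  letter. The only pair to which a left label could refer is {p,q}, so every left label is
  admissible.\<close>

lemma tree_two:
  assumes E: "E \<subseteq> A3 \<times> A3" and D: "Domain E \<subseteq> {p,q}" and ne: "E \<noteq> {}"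
    and ex: "p \<in> Domain E \<Longrightarrow> q \<in> Domain E \<Longrightarrow> share E p q"
    and un: "\<And>d d'. (p,d) \<in> E \<Longrightarrow> (q,d) \<in> E \<Longrightarrow> (p,d') \<in> E \<Longrightarrow> (q,d') \<in> E \<Longrightarrow> d = d'"
  shows "tree_rel E" and "label_ok l E"
proof -
  have l: "linked E" by (rule linked_by_two[OF E D ex])
  have 4: "no_C4 E" unfolding no_C4_def using D un by blast
  have 6: "no_C6 E" unfolding no_C6_def
  proof (intro allI impI notI)
    fix a1 a2 a3 b1 b2 b3
    assume "(a1,b1) \<in> E" "(a2,b1) \<in> E" "(a3,b2) \<in> E" "distinct [a1,a2,a3] \<and> distinct [b1,b2,b3]"
    then have "a1 \<in> {p,q}" "a2 \<in> {p,q}" "a3 \<in> {p,q}" "distinct [a1,a2,a3]" using D by blast+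
    then show False by auto
  qed
  show "tree_rel E" unfolding tree_rel_def using ne l linked_converse[OF E l] 4 6 by blast
  show "label_ok l E" unfolding label_ok_def using D ex share_sym share_refl by blast
qed

lemma tree_one:
  assumes E: "E \<subseteq> A3 \<times> A3" and D: "Domain E \<subseteq> {p}" and ne: "E \<noteq> {}"
  shows "good_tree l r E"
proof -
  have 1: "tree_rel E" "label_ok l E"
    \<comment> \<open>\<open>Suc p\<close> is a dummy second letter that does not occur in the
      domain.\<close>
    by (rule tree_two[of E p "Suc p", OF E _ ne]; use D in auto)+
  have "label_ok r (E\<inverse>)" unfolding label_ok_def share_def using D by blast
  with 1 show ?thesis unfolding good_tree_def by blast
qed

section \<open>Images of trees under merging and restriction\<close>

definition merge_rel :: "nat \<Rightarrow> nat \<Rightarrow> nat \<Rightarrow> nat \<Rightarrow> nat \<Rightarrow> (nat \<times> nat) set" where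
  "merge_rel a b c p q = {(a,p),(b,p),(c,q)}"

definition pair_rel :: "nat \<Rightarrow> nat \<Rightarrow> nat \<Rightarrow> nat \<Rightarrow> (nat \<times> nat) set" where
  "pair_rel a b p q = {(a,p),(b,q)}"

lemma merge_image: "((merge_rel a b c p q)\<inverse> O E) = {(u,d). u = p \<and> ((a,d) \<in> E \<or> (b,d) \<in> E) \<or> u = q \<and> (c,d) \<in> E}"
  unfolding merge_rel_def by blast

lemma pair_image: "((pair_rel a b p q)\<inverse> O E) = {(u,d). u = p \<and> (a,d) \<in> E \<or> u = q \<and> (b,d) \<in> E}"
  unfolding pair_rel_def by blast

text \<open>As l is not c, it is 0 or lies in {a,b}, so a and b share a neighbour whenever both
  occur. Hence merging them cannot create two common neighbours d, d' of p and q: either a or b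
  would already form a square with c, or a, d, c, d', b and the common neighbour of a and b would
  form a hexagon. The image has at most two left letters, so the new label \<open>l1\<close> is
  free, while common left neighbours of right letters survive the merging.\<close>

lemma good_tree_merge:
  assumes E: "E \<subseteq> A3 \<times> A3" and A: "A3 = {a,b,c}" "distinct [a,b,c]" and pq: "p \<noteq> q" "p \<in> A3" "q \<in> A3"
    and g: "good_tree l r E" and l: "l \<noteq> c" "l \<in> {0} \<union> A3"
    and ne: "(merge_rel a b c p q)\<inverse> O E \<noteq> {}"
  shows "good_tree l1 r ((merge_rel a b c p q)\<inverse> O E)"
proof -
  let ?E = "(merge_rel a b c p q)\<inverse> O E"
  have t: "linked E" "no_C4 E" "no_C6 E" and lk: "label_ok l E" and rk: "label_ok r (E\<inverse>)"
    using g unfolding good_tree_def tree_rel_def by blast+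
  have sh: "share E a b" if "a \<in> Domain E" "b \<in> Domain E"
    using lk that l A(1) unfolding label_ok_def by blast
  have E': "?E \<subseteq> A3 \<times> A3" unfolding merge_image using E pq by blast
  have D: "Domain ?E \<subseteq> {p,q}" unfolding merge_image by blast
  have ex: "share ?E p q" if "p \<in> Domain ?E" "q \<in> Domain ?E"
  proof -
    have cd: "c \<in> Domain E" and ab: "a \<in> Domain E \<or> b \<in> Domain E"
      using that pq(1) unfolding merge_image by blast+
    have "share E c a \<or> share E c b"
    proof -
      obtain u where u: "u \<in> Domain E" "u = a \<or> u = b" using ab by blast
      have "share E c u \<or> (\<exists>w. share E c w \<and> share E w u)"
        using t(1) cd u unfolding linked_def by blast
      moreover have "w = a \<or> w = b \<or> w = c" if "share E c w" for w
        using that E A(1) unfolding share_def by blast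
      ultimately show ?thesis using u(2) by blast
    qed
    then show ?thesis unfolding share_def merge_image by blast
  qed
  have c4: "x = y \<or> d = e" if "(x,d) \<in> E" "(x,e) \<in> E" "(y,d) \<in> E" "(y,e) \<in> E" for x y d e
    using t(2) that unfolding no_C4_def by blast
  have un: "d = d'" if "(p,d) \<in> ?E" "(q,d) \<in> ?E" "(p,d') \<in> ?E" "(q,d') \<in> ?E" for d d'
  proof (rule ccontr)
    assume dd: "d \<noteq> d'"
    have c: "(c,d) \<in> E" "(c,d') \<in> E" and 1: "(a,d) \<in> E \<or> (b,d) \<in> E" "(a,d') \<in> E \<or> (b,d') \<in> E"
      using that pq(1) unfolding merge_image by blast+
    have no: "\<not> ((x,d) \<in> E \<and> (x,d') \<in> E)" if "x = a \<or> x = b" for x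
      using c4[of x d d' c] c dd that A(2) by auto
    \<comment> \<open>The hexagon runs through x, e, y, d', c, d, where e is a common neighbour of x
      and y.\<close>
    have fin: False if x: "{x,y} = {a,b}" "(x,d) \<in> E" "(y,d') \<in> E" for x y
    proof -
      have "share E x y" using sh share_sym x by (metis Domain.DomainI doubleton_eq_iff)
      then obtain e where e: "(x,e) \<in> E" "(y,e) \<in> E" unfolding share_def by blast
      have "e \<noteq> d" "e \<noteq> d'" using no[of x] no[of y] x e by auto
      moreover have "distinct [x,y,c]" using x(1) A(2) by (auto simp: doubleton_eq_iff)
      ultimately show False
        using t(3)[unfolded no_C6_def, rule_format, of x e y d' c d] x e c dd by auto
    qed
    show False using 1 no[of a] no[of b] fin[of a b] fin[of b a] by blast
  qed
  have "label_ok r (?E\<inverse>)"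
    unfolding label_ok_def
  proof (intro ballI impI)
    fix d e assume "d \<in> Domain (?E\<inverse>)" "e \<in> Domain (?E\<inverse>)" and r: "r = 0 \<or> r = d \<or> r = e"
    then have "d \<in> Domain (E\<inverse>)" "e \<in> Domain (E\<inverse>)" unfolding merge_image by blast+
    then have "share (E\<inverse>) d e" using rk r unfolding label_ok_def by blast
    then obtain x where "(x,d) \<in> E" "(x,e) \<in> E" "x \<in> A3" using E unfolding share_def by blast
    then show "share (?E\<inverse>) d e" unfolding share_def merge_image A(1) by blast
  qed
  then show ?thesis unfolding good_tree_def using tree_two[OF E' D ne ex un] by blast
qed

text \<open>Deleting c might cost two right letters d, e their common neighbour. If c were the only
  one, with d attached to one of a, b and e to the other, a common neighbour f of a and b would
  close a hexagon through f, e, c and d.\<close>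

lemma good_tree_pair:
  assumes E: "E \<subseteq> A3 \<times> A3" and A: "A3 = {a,b,c}" "distinct [a,b,c]" and pq: "p \<noteq> q" "p \<in> A3" "q \<in> A3"
    and g: "good_tree l r E" and l: "l \<noteq> c" "l \<in> {0} \<union> A3"
    and ne: "(pair_rel a b p q)\<inverse> O E \<noteq> {}"
  shows "good_tree l1 r ((pair_rel a b p q)\<inverse> O E)"
proof -
  let ?E = "(pair_rel a b p q)\<inverse> O E"
  have t: "linked E" "no_C4 E" "no_C6 E" and lk: "label_ok l E" and rk: "label_ok r (E\<inverse>)"
    using g unfolding good_tree_def tree_rel_def by blast+
  have sh: "share E a b" if "a \<in> Domain E" "b \<in> Domain E"
    using lk that l A(1) unfolding label_ok_def by blast
  have E': "?E \<subseteq> A3 \<times> A3" unfolding pair_image using E pq by blast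
  have D: "Domain ?E \<subseteq> {p,q}" unfolding pair_image by blast
  have ex: "share ?E p q" if "p \<in> Domain ?E" "q \<in> Domain ?E"
  proof -
    have "a \<in> Domain E" "b \<in> Domain E" using that pq(1) unfolding pair_image by blast+
    then show ?thesis using sh unfolding share_def pair_image by blast
  qed
  have c4: "x = y \<or> d = e" if "(x,d) \<in> E" "(x,e) \<in> E" "(y,d) \<in> E" "(y,e) \<in> E" for x y d e
    using t(2) that unfolding no_C4_def by blast
  have un: "d = d'" if "(p,d) \<in> ?E" "(q,d) \<in> ?E" "(p,d') \<in> ?E" "(q,d') \<in> ?E" for d d'
    using that c4[of a d d' b] pq(1) A(2) unfolding pair_image by auto
  have "label_ok r (?E\<inverse>)"
    unfolding label_ok_def
  proof (intro ballI impI)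
    fix d e assume 1: "d \<in> Domain (?E\<inverse>)" "e \<in> Domain (?E\<inverse>)" and r: "r = 0 \<or> r = d \<or> r = e"
    have ab: "(a,d) \<in> E \<or> (b,d) \<in> E" "(a,e) \<in> E \<or> (b,e) \<in> E"
      using 1 unfolding pair_image by blast+
    then have "share (E\<inverse>) d e" using rk r unfolding label_ok_def by blast
    then obtain x where x: "(x,d) \<in> E" "(x,e) \<in> E" "x \<in> A3" using E unfolding share_def by blast
    have "((a,d) \<in> E \<and> (a,e) \<in> E) \<or> ((b,d) \<in> E \<and> (b,e) \<in> E)"
    proof (rule ccontr)
      assume n: "\<not> ?thesis"
      have "x \<in> {a,b,c}" using x(3) A(1) by (rule subst[where P = "\<lambda>S. x \<in> S", rotated])
      then have "x = a \<or> x = b \<or> x = c" by simp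
      then have "x = c" using n x(1,2) by (elim disjE) simp_all
      then have c: "(c,d) \<in> E" "(c,e) \<in> E" using x by blast+
      have de: "d \<noteq> e" using n ab by blast
      have fin: False if y: "{y,z} = {a,b}" "(y,d) \<in> E" "(z,e) \<in> E" for y z
      proof -
        have "share E y z" using sh share_sym y by (metis Domain.DomainI doubleton_eq_iff)
        then obtain f where f: "(y,f) \<in> E" "(z,f) \<in> E" unfolding share_def by blast
        have "f \<noteq> d" "f \<noteq> e" using n y f by (auto simp: doubleton_eq_iff)
        moreover have "distinct [y,z,c]" using y(1) A(2) by (auto simp: doubleton_eq_iff)
        ultimately show False
          using t(3)[unfolded no_C6_def, rule_format, of y f z e c d] y f c de by auto
      qed
      show False using ab n fin[of a b] fin[of b a] by blast
    qed
    then show "share (?E\<inverse>) d e" unfolding share_def pair_image by blast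
  qed
  then show ?thesis unfolding good_tree_def using tree_two[OF E' D ne ex un] by blast
qed

text \<open>Merging alone forgets how a and b are linked; the restriction to {a,b} restores exactly
  this. Squares and hexagons through c become double links between p and q in the merged graph,
  every hexagon passes through c, and squares on a and b survive in the restriction.\<close>

lemma tree_of_merge_pair:
  assumes E: "E \<subseteq> A3 \<times> A3" and A: "A3 = {a,b,c}" "distinct [a,b,c]" and pq: "p \<noteq> q" "p' \<noteq> q'"
    and ne: "E \<noteq> {}"
    and m: "tree_rel ((merge_rel a b c p q)\<inverse> O E)"
    and r: "(pair_rel a b p' q')\<inverse> O E = {} \<or> tree_rel ((pair_rel a b p' q')\<inverse> O E)"
  shows "tree_rel E"
proof -
  let ?M = "(merge_rel a b c p q)\<inverse> O E" and ?P = "(pair_rel a b p' q')\<inverse> O E"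
  have m4: "u = v \<or> d = e" if "(u,d) \<in> ?M" "(u,e) \<in> ?M" "(v,d) \<in> ?M" "(v,e) \<in> ?M" for u v d e
    using m that unfolding tree_rel_def no_C4_def by blast
  have mp: "(p,d) \<in> ?M" if "(u,d) \<in> E" "u = a \<or> u = b" for u d
    using that unfolding merge_image by blast
  have mq: "(q,d) \<in> ?M" if "(c,d) \<in> E" for d
    using that unfolding merge_image by blast
  have mm: "d = e" if "(u,d) \<in> E" "(v,e) \<in> E" "(c,d) \<in> E" "(c,e) \<in> E" "u = a \<or> u = b" "v = a \<or> v = b" for u v d e
    using m4[of p d e q] mp[of u d] mp[of v e] mq that pq by blast
  have pp: "d = e" if "(a,d) \<in> E" "(a,e) \<in> E" "(b,d) \<in> E" "(b,e) \<in> E" for d e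
  proof -
    have "(p',d) \<in> ?P" "(p',e) \<in> ?P" "(q',d) \<in> ?P" "(q',e) \<in> ?P"
      using that unfolding pair_image by blast+
    with r pq(2) show ?thesis unfolding tree_rel_def no_C4_def by blast
  qed
  have ab: "share E a b" if "a \<in> Domain E" "b \<in> Domain E"
  proof -
    have "p' \<in> Domain ?P" "q' \<in> Domain ?P" using that unfolding pair_image by blast+
    then have "share ?P p' q' \<or> (\<exists>w. share ?P p' w \<and> share ?P w q')"
      using r unfolding tree_rel_def linked_def by blast
    then have "share ?P p' q'" unfolding share_def pair_image by auto
    then show ?thesis using pq(2) unfolding share_def pair_image by auto
  qed
  have mc: "share E c a \<or> share E c b" if "u \<in> Domain E" "u = a \<or> u = b" "c \<in> Domain E" for u
  proof -
    have "p \<in> Domain ?M" "q \<in> Domain ?M" using that unfolding merge_image by blast+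
    then have "share ?M p q \<or> (\<exists>w. share ?M p w \<and> share ?M w q)"
      using m unfolding tree_rel_def linked_def by blast
    then have "share ?M p q" unfolding share_def merge_image by auto
    then show ?thesis using pq(1) unfolding share_def merge_image by auto
  qed
  have E3: "x = a \<or> x = b \<or> x = c" if "(x,d) \<in> E" for x d using that E A(1) by blast
  have 4: "no_C4 E" unfolding no_C4_def
  proof (intro allI impI)
    fix u v d e assume e: "(u,d) \<in> E" "(u,e) \<in> E" "(v,d) \<in> E" "(v,e) \<in> E"
    show "u = v \<or> d = e"
      using E3[OF e(1)] E3[OF e(3)] e mm[of u d v e] mm[of u d u e] mm[of v d v e] pp[of d e] by blast
  qed
  have 6: "no_C6 E" unfolding no_C6_def
  proof (intro allI impI notI)
    fix a1 a2 a3 b1 b2 b3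
    assume e: "(a1,b1) \<in> E" "(a2,b1) \<in> E" "(a2,b2) \<in> E" "(a3,b2) \<in> E" "(a3,b3) \<in> E" "(a1,b3) \<in> E"
      and d: "distinct [a1,a2,a3] \<and> distinct [b1,b2,b3]"
    have "c = a1 \<or> c = a2 \<or> c = a3"
      using E3[OF e(1)] E3[OF e(2)] E3[OF e(4)] d by auto
    then show False
    proof (elim disjE)
      assume "c = a1" then show False
        using mm[of a2 b1 a3 b3] e d E3[OF e(2)] E3[OF e(4)] by auto
    next
      assume "c = a2" then show False
        using mm[of a1 b1 a3 b2] e d E3[OF e(1)] E3[OF e(4)] by auto
    next
      assume "c = a3" then show False
        using mm[of a2 b2 a1 b3] e d E3[OF e(2)] E3[OF e(1)] by auto
    qed
  qed
  have l: "linked E" unfolding linked_def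
  proof (intro ballI)
    fix u v assume uv: "u \<in> Domain E" "v \<in> Domain E"
    then have "u = a \<or> u = b \<or> u = c" "v = a \<or> v = b \<or> v = c" using E3 by blast+
    then show "share E u v \<or> (\<exists>w. share E u w \<and> share E w v)"
      using uv ab mc share_sym share_refl by (metis Domain.simps share_def)
  qed
  show ?thesis unfolding tree_rel_def using ne l linked_converse[OF E l] 4 6 by blast
qed

definition const_rel :: "(nat \<times> nat) set \<Rightarrow> bool" where
  "const_rel R \<longleftrightarrow> (\<exists>p. Range R \<subseteq> {p})"

text \<open>The maps induced on extensions by a marked morphism: c is the letter outside the merged pair, hence
the forbidden label, and m is the common letter of the images of the merged and of the separated pair, hence
the label of the image.\<close>
fun branching :: "(nat \<times> nat) option \<Rightarrow> (nat \<times> nat) set set \<Rightarrow> bool" where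
  "branching None F \<longleftrightarrow> Id_on A3 \<in> F \<and> (\<forall>R\<in>F. R \<subseteq> A3 \<times> A3 \<and> (R = Id_on A3 \<or> const_rel R))"
| "branching (Some (c,m)) F \<longleftrightarrow> (\<exists>a b p q p' q'. A3 = {a,b,c} \<and> distinct [a,b,c] \<and> {p,q,p',q'} \<subseteq> A3 \<and> p \<noteq> q \<and> p' \<noteq> q' \<and>
     {p,q} \<inter> {p',q'} = {m} \<and> merge_rel a b c p q \<in> F \<and> pair_rel a b p' q' \<in> F \<and>
     (\<forall>R\<in>F. R \<subseteq> A3 \<times> A3 \<and> (R = merge_rel a b c p q \<or> R = pair_rel a b p' q' \<or> const_rel R)))"

fun label_step :: "(nat \<times> nat) option \<Rightarrow> nat \<Rightarrow> nat \<Rightarrow> bool" where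
  "label_step None l l1 \<longleftrightarrow> l1 = l"
| "label_step (Some (c,m)) l l1 \<longleftrightarrow> l \<noteq> c \<and> l1 = m"

lemma branching_SomeE:
  assumes "branching (Some (c,m)) F"
  obtains a b p q p' q' where "A3 = {a,b,c}" "distinct [a,b,c]" "{p,q,p',q'} \<subseteq> A3" "p \<noteq> q" "p' \<noteq> q'"
     "{p,q} \<inter> {p',q'} = {m}" "merge_rel a b c p q \<in> F" "pair_rel a b p' q' \<in> F"
     "\<forall>R\<in>F. R \<subseteq> A3 \<times> A3 \<and> (R = merge_rel a b c p q \<or> R = pair_rel a b p' q' \<or> const_rel R)"
  using assms unfolding branching.simps by (elim exE conjE) (rule that)

lemma branching_sub: "branching k F \<Longrightarrow> R \<in> F \<Longrightarrow> R \<subseteq> A3 \<times> A3"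
proof (cases k)
  case (Some cm)
  assume "branching k F" "R \<in> F"
  then have "branching (Some (fst cm, snd cm)) F" "R \<in> F" using Some by simp_all
  then show ?thesis by (elim branching_SomeE) blast
qed simp

lemma good_tree_const:
  assumes R: "R \<subseteq> A3 \<times> A3" "const_rel R" and E: "E \<subseteq> A3 \<times> A3" and ne: "R\<inverse> O E \<noteq> {}"
  shows "good_tree l r (R\<inverse> O E)"
proof -
  obtain p where p: "Range R \<subseteq> {p}" using R unfolding const_rel_def by blast
  show ?thesis by (rule tree_one[of _ p]) (use R E p ne in blast)+
qed

lemma good_tree_branching_left:
  assumes F: "branching k F" "label_step k l l1" "R \<in> F" and E: "E \<subseteq> A3 \<times> A3" and g: "good_tree l r E" and l: "l \<in> {0} \<union> A3"
    and ne: "R\<inverse> O E \<noteq> {}"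
  shows "good_tree l1 r (R\<inverse> O E)"
proof (cases "const_rel R")
  case True
  show ?thesis using good_tree_const[OF branching_sub[OF F(1,3)] True E ne] .
next
  case nc: False
  show ?thesis
  proof (cases k)
    case None
    then have "R = Id_on A3" "l1 = l" using F nc by auto
    moreover have "(Id_on A3)\<inverse> O E = E" using E by auto
    ultimately show ?thesis using g by simp
  next
    case (Some cm)
    obtain c m where k: "k = Some (c,m)" using Some by (cases cm) auto
    obtain a b p q p' q' where *: "A3 = {a,b,c}" "distinct [a,b,c]" "{p,q,p',q'} \<subseteq> A3" "p \<noteq> q" "p' \<noteq> q'"
      "R = merge_rel a b c p q \<or> R = pair_rel a b p' q'"
      using F(1)[unfolded k] F(3) nc by (elim branching_SomeE) metis
    have pq: "p \<in> A3" "q \<in> A3" "p' \<in> A3" "q' \<in> A3" using *(3) by simp_all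
    have "l \<noteq> c" using F(2) unfolding k by simp
    from *(6) show ?thesis
    proof
      assume R: "R = merge_rel a b c p q"
      show ?thesis using good_tree_merge[OF E *(1,2,4) pq(1,2) g \<open>l \<noteq> c\<close> l] ne unfolding R by blast
    next
      assume R: "R = pair_rel a b p' q'"
      show ?thesis using good_tree_pair[OF E *(1,2,5) pq(3,4) g \<open>l \<noteq> c\<close> l] ne unfolding R by blast
    qed
  qed
qed

lemma good_tree_branching:
  assumes F: "branching k F" "label_step k l l1" "R \<in> F" and F': "branching k' F'" "label_step k' r r1" "R' \<in> F'"
    and E: "E \<subseteq> A3 \<times> A3" and g: "good_tree l r E" and l: "l \<in> {0} \<union> A3" "r \<in> {0} \<union> A3"
    and ne: "R\<inverse> O E O R' \<noteq> {}"
  shows "good_tree l1 r1 (R\<inverse> O E O R')"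
proof -
  have g1: "good_tree l1 r (R\<inverse> O E)" using good_tree_branching_left[OF F E g l(1)] ne by auto
  have E1: "(R\<inverse> O E)\<inverse> \<subseteq> A3 \<times> A3" using branching_sub[OF F(1,3)] E by blast
  \<comment> \<open>The right map acts on the transposed graph as a left map.\<close>
  have e: "R'\<inverse> O (R\<inverse> O E)\<inverse> = (R\<inverse> O E O R')\<inverse>" by blast
  have "good_tree r1 l1 (R'\<inverse> O (R\<inverse> O E)\<inverse>)"
    by (rule good_tree_branching_left[OF F' E1 _ l(2)]) (use g1 ne e in \<open>auto simp: good_tree_converse\<close>)
  then show ?thesis unfolding e good_tree_converse .
qed

lemma tree_of_branching_left:
  assumes F: "branching k F" and E: "E \<subseteq> A3 \<times> A3" "E \<noteq> {}"
    and t: "\<And>R. R \<in> F \<Longrightarrow> R\<inverse> O E \<noteq> {} \<Longrightarrow> tree_rel (R\<inverse> O E)"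
  shows "tree_rel E"
proof (cases k)
  case None
  moreover have "(Id_on A3)\<inverse> O E = E" using E by auto
  ultimately show ?thesis using t[of "Id_on A3"] F E by auto
next
  case (Some cm)
  obtain c m where k: "k = Some (c,m)" using Some by (cases cm) auto
  obtain a b p q p' q' where *: "A3 = {a,b,c}" "distinct [a,b,c]" "p \<noteq> q" "p' \<noteq> q'"
    "merge_rel a b c p q \<in> F" "pair_rel a b p' q' \<in> F"
    using F[unfolded k] by (elim branching_SomeE)
  have ne: "(merge_rel a b c p q)\<inverse> O E \<noteq> {}"
  proof -
    obtain x d where "(x,d) \<in> E" using E by auto
    moreover have "x = a \<or> x = b \<or> x = c" using E(1) *(1) calculation by auto
    ultimately show ?thesis unfolding merge_image by blast
  qed
  show ?thesis
    by (rule tree_of_merge_pair[OF E(1) *(1-4) E(2)]) (use t[OF *(5)] t[OF *(6)] ne in blast)+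
qed

lemma tree_of_branching:
  assumes F: "branching k F" and F': "branching k' F'" and E: "E \<subseteq> A3 \<times> A3" "E \<noteq> {}"
    and t: "\<And>R R'. R \<in> F \<Longrightarrow> R' \<in> F' \<Longrightarrow> R\<inverse> O E O R' \<noteq> {} \<Longrightarrow> tree_rel (R\<inverse> O E O R')"
  shows "tree_rel E"
proof (rule tree_of_branching_left[OF F E])
  fix R assume R: "R \<in> F" "R\<inverse> O E \<noteq> {}"
  let ?G = "(R\<inverse> O E)\<inverse>"
  have "tree_rel ?G"
  proof (rule tree_of_branching_left[OF F'])
    show "?G \<subseteq> A3 \<times> A3" using branching_sub[OF F R(1)] E by blast
    show "?G \<noteq> {}" using R(2) by auto
    fix R' assume R': "R' \<in> F'" "R'\<inverse> O ?G \<noteq> {}"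
    have e: "R'\<inverse> O ?G = (R\<inverse> O E O R')\<inverse>" by blast
    show "tree_rel (R'\<inverse> O ?G)" using t[OF R(1) R'(1)] R'(2) unfolding e tree_rel_converse by auto
  qed
  then show "tree_rel (R\<inverse> O E)" unfolding tree_rel_converse .
qed

section \<open>Labels as graphs on three letters\<close>

text \<open>A graph on three vertices without isolated vertex is complete or a star; the label is 0
  in the first case and the centre in the second.\<close>

definition labels :: "nat \<Rightarrow> (nat \<Rightarrow> nat \<Rightarrow> bool) \<Rightarrow> bool" where
  "labels l G \<longleftrightarrow> l \<in> {0} \<union> A3 \<and> (\<forall>a\<in>A3. \<forall>b\<in>A3. a \<noteq> b \<longrightarrow> (G a b \<longleftrightarrow> l = 0 \<or> l = a \<or> l = b))"

definition no_isolated :: "(nat \<Rightarrow> nat \<Rightarrow> bool) \<Rightarrow> bool" where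
  "no_isolated G \<longleftrightarrow> (\<forall>a\<in>A3. \<exists>b\<in>A3. b \<noteq> a \<and> G a b)"

lemma labels_iff:
  assumes s: "\<And>a b. G a b \<longleftrightarrow> G b a"
  shows "labels l G \<longleftrightarrow> (l = 0 \<or> l = 1 \<or> l = 2 \<or> l = 3) \<and> (G 1 2 \<longleftrightarrow> l \<noteq> 3) \<and> (G 1 3 \<longleftrightarrow> l \<noteq> 2) \<and> (G 2 3 \<longleftrightarrow> l \<noteq> 1)"
proof -
  have "labels l G \<longleftrightarrow> (l = 0 \<or> l = 1 \<or> l = 2 \<or> l = 3) \<and> (\<forall>a\<in>{1,2,3}. \<forall>b\<in>{1,2,3}. a \<noteq> b \<longrightarrow> (G a b \<longleftrightarrow> l = 0 \<or> l = a \<or> l = b))"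
    unfolding labels_def A3_def by (simp only: Un_iff insert_iff empty_iff simp_thms)
  also have "\<dots> \<longleftrightarrow> (l = 0 \<or> l = 1 \<or> l = 2 \<or> l = 3) \<and> (G 1 2 \<longleftrightarrow> l \<noteq> 3) \<and> (G 1 3 \<longleftrightarrow> l \<noteq> 2) \<and> (G 2 3 \<longleftrightarrow> l \<noteq> 1)"
    using s[of 2 1] s[of 3 1] s[of 3 2] by (intro conj_cong refl) (elim disjE; simp; blast)
  finally show ?thesis .
qed

lemma ex_label:
  assumes s: "\<And>a b. G a b \<longleftrightarrow> G b a" and n: "no_isolated G"
  shows "\<exists>l. labels l G"
proof -
  have "\<exists>b\<in>{1,2,3}. b \<noteq> 1 \<and> G 1 b" "\<exists>b\<in>{1,2,3}. b \<noteq> 2 \<and> G 2 b" "\<exists>b\<in>{1,2,3}. b \<noteq> 3 \<and> G 3 b"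
    using n unfolding no_isolated_def A3_def by blast+
  then have n': "G 1 2 \<or> G 1 3" "G 1 2 \<or> G 2 3" "G 1 3 \<or> G 2 3"
    using s[of 2 1] s[of 3 1] s[of 3 2] by auto
  consider "G 1 2" "G 1 3" "G 2 3" | "G 1 2" "G 1 3" "\<not> G 2 3" | "G 1 2" "\<not> G 1 3" "G 2 3" | "\<not> G 1 2" "G 1 3" "G 2 3"
    using n' by blast
  then show ?thesis
  proof cases
    case 1 then have "labels 0 G" unfolding labels_iff[of G, OF s] by simp
    then show ?thesis ..
  next
    case 2 then have "labels 1 G" unfolding labels_iff[of G, OF s] by simp
    then show ?thesis ..
  next
    case 3 then have "labels 2 G" unfolding labels_iff[of G, OF s] by simp
    then show ?thesis ..
  next
    case 4 then have "labels 3 G" unfolding labels_iff[of G, OF s] by simp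
    then show ?thesis ..
  qed
qed

lemma labels_unique: "(\<And>a b. G a b \<longleftrightarrow> G b a) \<Longrightarrow> labels l G \<Longrightarrow> labels l' G \<Longrightarrow> l = l'"
proof -
  assume s: "\<And>a b. G a b \<longleftrightarrow> G b a" and l: "labels l G" "labels l' G"
  show "l = l'" using l unfolding labels_iff[of G, OF s] by (elim conjE disjE) simp_all
qed

text \<open>Here G' belongs to a language and G to its image. In the merging case each edge of G is
  {p,q} or {p',q'}, and both contain m; as no letter is isolated, G is the star with centre m. The
  edge {p',q'} can only come from an edge of G' between a and b, and this edge says that the label
  of G' is not c. Otherwise the only map that is not constant is the identity, and G and G' have the
  same edges.\<close>

lemma step_labels:
  assumes F: "branching k F" and s: "\<And>a b. G a b \<longleftrightarrow> G b a" "\<And>a b. G' a b \<longleftrightarrow> G' b a" and n: "no_isolated G" "labels l' G'" "labels l G"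
    and GG: "\<And>a b. a \<in> A3 \<Longrightarrow> b \<in> A3 \<Longrightarrow> a \<noteq> b \<Longrightarrow> G a b \<Longrightarrow> \<exists>R\<in>F. \<exists>a' b'. (a',a) \<in> R \<and> (b',b) \<in> R \<and> G' a' b'"
    and id: "\<And>a b. k = None \<Longrightarrow> a \<in> A3 \<Longrightarrow> b \<in> A3 \<Longrightarrow> a \<noteq> b \<Longrightarrow> G' a b \<Longrightarrow> G a b"
  shows "label_step k l' l"
proof (cases k)
  case None
  have "G a b \<longleftrightarrow> G' a b" if ab: "a \<in> A3" "b \<in> A3" "a \<noteq> b" for a b
  proof
    assume "G a b"
    then obtain R a' b' where *: "R\<in>F" "(a',a) \<in> R" "(b',b) \<in> R" "G' a' b'" using GG[OF ab] by blast
    have "\<not> const_rel R" using *(2,3) ab(3) unfolding const_rel_def by blast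
    then have "R = Id_on A3" using F *(1) unfolding None by auto
    then show "G' a b" using * by auto
  qed (rule id[OF None ab])
  then have "labels l' G" using n(2) unfolding labels_def by blast
  then have "l' = l" using labels_unique[of G, OF s(1)] n(3) by blast
  then show ?thesis using None by simp
next
  case (Some cm)
  obtain c m where k: "k = Some (c,m)" using Some by (cases cm) auto
  obtain a b p q p' q' where *: "A3 = {a,b,c}" "distinct [a,b,c]" "{p,q,p',q'} \<subseteq> A3" "p \<noteq> q" "p' \<noteq> q'"
     "{p,q} \<inter> {p',q'} = {m}" "merge_rel a b c p q \<in> F" "pair_rel a b p' q' \<in> F"
     "\<forall>R\<in>F. R \<subseteq> A3 \<times> A3 \<and> (R = merge_rel a b c p q \<or> R = pair_rel a b p' q' \<or> const_rel R)"
    using F[unfolded k] by (elim branching_SomeE)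
  have e: "{x,y} = {p,q} \<or> {x,y} = {p',q'} \<and> G' a b" if xy: "x \<in> A3" "y \<in> A3" "x \<noteq> y" "G x y" for x y
  proof -
    obtain R x' y' where R: "R\<in>F" "(x',x) \<in> R" "(y',y) \<in> R" "G' x' y'" using GG[OF xy] by blast
    have "\<not> const_rel R" using R xy(3) unfolding const_rel_def by blast
    then have "R = merge_rel a b c p q \<or> R = pair_rel a b p' q'" using *(9) R(1) by blast
    then show ?thesis
    proof
      assume "R = merge_rel a b c p q"
      then have "(x = p \<and> y = q) \<or> (x = q \<and> y = p)" using R(2,3) xy(3) unfolding merge_rel_def by auto
      then show ?thesis by auto
    next
      assume "R = pair_rel a b p' q'"
      then have "(x = p' \<and> y = q' \<and> G' a b) \<or> (x = q' \<and> y = p' \<and> G' b a)" 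
        using R(2-4) xy(3) unfolding pair_rel_def by auto
      then show ?thesis using s(2)[of a b] by auto
    qed
  qed
  have mm: "m \<in> {p,q}" "m \<in> {p',q'}" "m \<in> A3" using *(3,6) by blast+
  have nn: "G x y \<Longrightarrow> x = m \<or> y = m" if xy: "x \<in> A3" "y \<in> A3" "x \<noteq> y" for x y
    using e[OF xy] mm by (metis insertE singletonD)
  note m = mm(3)
  have "\<exists>u v. A3 = {m,u,v} \<and> distinct [m,u,v]"
  proof -
    have "m = 1 \<or> m = 2 \<or> m = 3" using m A3_iff by blast
    moreover have "A3 = {1,2,3}" "A3 = {2,1,3}" "A3 = {3,1,2}" unfolding A3_def by auto
    ultimately show ?thesis
      by (elim disjE) (rule exI[of _ 2] exI[of _ 1], rule exI[of _ 3] exI[of _ 2], simp)+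
  qed
  then obtain u v where uv: "A3 = {m,u,v}" "distinct [m,u,v]" by blast
  have mu: "G m u" "G m v" 
  proof -
    have "\<exists>w\<in>A3. w \<noteq> u \<and> G u w" "\<exists>w\<in>A3. w \<noteq> v \<and> G v w" using n(1) uv unfolding no_isolated_def by auto
    then obtain w z where wz: "w \<in> A3" "w \<noteq> u" "G u w" "z \<in> A3" "z \<noteq> v" "G v z" by blast
    have "u \<noteq> m" "v \<noteq> m" using uv(2) by simp_all
    moreover have "u \<in> A3" "v \<in> A3" unfolding uv(1) by simp_all
    ultimately have "w = m" "z = m" using nn[of u w] nn[of v z] wz by auto
    then show "G m u" "G m v" using wz(3,6) s(1)[of m] by simp_all
  qed
  have ng: "\<not> G u v" using nn[of u v] uv by auto
  have "m \<noteq> 0" "u \<noteq> 0" "v \<noteq> 0" using uv(1) unfolding A3_def by auto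
  then have "labels m G" unfolding labels_def uv(1) using mu ng s(1)[of u m] s(1)[of v m] s(1)[of v u] uv(2) by auto
  then have lm: "l = m" using labels_unique[of G, OF s(1)] n(3) by blast
  \<comment> \<open>Without this edge, u and v would both have to be joined to m by the single pair
    {p,q}.\<close>
  have "G' a b"
  proof (rule ccontr)
    assume n': "\<not> G' a b"
    have "{m,u} = {p,q}" "{m,v} = {p,q}" using e[of m u] e[of m v] mu uv n' by auto
    then show False using uv(2) by (auto simp: doubleton_eq_iff)
  qed
  moreover have "a \<in> A3" "b \<in> A3" unfolding *(1) by simp_all
  moreover have "a \<noteq> b" using *(2) by simp
  ultimately have "l' = 0 \<or> l' = a \<or> l' = b" using n(2) unfolding labels_def by blast
  moreover have "c \<in> A3" unfolding *(1) by simp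
  then have "c \<noteq> 0" by (auto simp: A3_def)
  ultimately have "l' \<noteq> c" using *(2) by auto
  then show ?thesis using k lm by simp
qed

subsection \<open>Languages and marked morphisms\<close>

lemma morph_word_simps [simp]:
  "morph_word f [] = []" "morph_word f (a # u) = f a @ morph_word f u"
  "morph_word f (u @ v) = morph_word f u @ morph_word f v"
  by (simp_all add: morph_word_def)

definition exts :: "nat list set \<Rightarrow> nat list \<Rightarrow> (nat \<times> nat) set" where
  "exts L w = {(a,b). a # w @ [b] \<in> L}"

text \<open>The properties of languages of shift spaces over \<open>A3\<close> on which the
  combinatorial part relies. They pass to desubstituted languages, so no shift with that language
  has to be built.\<close>

definition bilang :: "nat list set \<Rightarrow> bool" where
  "bilang L \<longleftrightarrow> (\<forall>w\<in>L. set w \<subseteq> A3) \<and> (\<forall>v w. w \<in> L \<longrightarrow> sublist v w \<longrightarrow> v \<in> L) \<and>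
     (\<forall>w\<in>L. \<exists>a b. a # w @ [b] \<in> L) \<and> (\<forall>a\<in>A3. [a] \<in> L)"

definition image_lang :: "morph \<Rightarrow> nat list set \<Rightarrow> nat list set" where
  "image_lang f L = {w. \<exists>u\<in>L. sublist w (morph_word f u)}"

definition marked :: "nat \<Rightarrow> morph \<Rightarrow> bool" where
  "marked m f \<longleftrightarrow> inj_on f A3 \<and> (\<forall>a\<in>A3. \<exists>t. f a = m # t \<and> m \<notin> set t \<and> set (f a) \<subseteq> A3)"

lemma bilangD:
  assumes "bilang L"
  shows "w \<in> L \<Longrightarrow> set w \<subseteq> A3" "w \<in> L \<Longrightarrow> sublist v w \<Longrightarrow> v \<in> L" "w \<in> L \<Longrightarrow> \<exists>a b. a # w @ [b] \<in> L"
    "a \<in> A3 \<Longrightarrow> [a] \<in> L"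
  using assms unfolding bilang_def by blast+

lemma bilang_append: "bilang L \<Longrightarrow> u @ v @ w \<in> L \<Longrightarrow> v \<in> L"
  by (rule bilangD(2)) (auto simp: sublist_def)

lemma bilang_prefix: "bilang L \<Longrightarrow> u @ v \<in> L \<Longrightarrow> u \<in> L"
  using bilang_append[of L "[]" u v] by simp

lemma bilang_suffix: "bilang L \<Longrightarrow> u @ v \<in> L \<Longrightarrow> v \<in> L"
  using bilang_append[of L u v "[]"] by simp

lemma bilang_tl: "bilang L \<Longrightarrow> a # v \<in> L \<Longrightarrow> v \<in> L"
  using bilang_suffix[of L "[a]" v] by simp

lemma exts_subset: "bilang L \<Longrightarrow> exts L w \<subseteq> A3 \<times> A3"
  using bilangD(1) unfolding exts_def by fastforce

lemma exts_nonempty: "bilang L \<Longrightarrow> w \<in> L \<Longrightarrow> exts L w \<noteq> {}"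
  using bilangD(3) unfolding exts_def by blast

lemma exts_empty: "bilang L \<Longrightarrow> w \<notin> L \<Longrightarrow> exts L w = {}"
  using bilang_append[of L "[_]" w] unfolding exts_def by fastforce

lemma Nil_in_bilang: "bilang L \<Longrightarrow> [] \<in> L"
  using bilang_append[of L "[1]" "[]" "[]"] bilangD(4)[of L 1] by (simp add: A3_iff)

lemma extend_right: "bilang L \<Longrightarrow> w \<in> L \<Longrightarrow> \<exists>b. w @ [b] \<in> L"
  using bilangD(3) bilang_tl by blast

lemma extend_left: "bilang L \<Longrightarrow> w \<in> L \<Longrightarrow> \<exists>b. b # w \<in> L"
  using bilangD(3) bilang_prefix[of L "_ # w"] by fastforce

lemma extend_right_n: "bilang L \<Longrightarrow> w \<in> L \<Longrightarrow> \<exists>v. length v = n \<and> w @ v \<in> L"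
proof (induction n)
  case (Suc n)
  then obtain v where "length v = n" "w @ v \<in> L" by blast
  then show ?case using extend_right[OF Suc.prems(1), of "w @ v"]
    by (metis append.assoc length_append_singleton)
qed simp

lemma extend_left_n: "bilang L \<Longrightarrow> w \<in> L \<Longrightarrow> \<exists>v. length v = n \<and> v @ w \<in> L"
proof (induction n)
  case (Suc n)
  then obtain v where "length v = n" "v @ w \<in> L" by blast
  then show ?case using extend_left[OF Suc.prems(1), of "v @ w"]
    by (metis append_Cons length_Cons)
qed simp

section \<open>Parsing images of a marked morphism\<close>

lemma markedD: "marked m f \<Longrightarrow> a \<in> A3 \<Longrightarrow> \<exists>t. f a = m # t \<and> m \<notin> set t \<and> set t \<subseteq> A3"
  unfolding marked_def by fastforce

lemma split_marker:
  assumes "m \<notin> set t" "t @ v = P @ m # R"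
  shows "\<exists>P'. P = t @ P' \<and> v = P' @ m # R"
proof -
  from assms(2) obtain us where "t = P @ us \<and> us @ v = m # R \<or> t @ us = P \<and> v = us @ m # R"
    unfolding append_eq_append_conv2 by blast
  then show ?thesis using assms(1) by (cases us) auto
qed

text \<open>The marker occurs only as the first letter of a block, so each of its occurrences is a
  block boundary.\<close>

lemma parse_at_marker:
  assumes f: "marked m f"
  shows "set v \<subseteq> A3 \<Longrightarrow> morph_word f v = P @ m # R \<Longrightarrow>
    \<exists>v1 v2. v = v1 @ v2 \<and> morph_word f v1 = P \<and> morph_word f v2 = m # R"
proof (induction v arbitrary: P)
  case (Cons a v)
  obtain t where t: "f a = m # t" "m \<notin> set t" using markedD[OF f, of a] Cons.prems by auto
  show ?case
  proof (cases P)
    case Nil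
    then show ?thesis using Cons.prems(2) by (intro exI[of _ "[]"] exI[of _ "a # v"]) auto
  next
    case (Cons x P')
    then have x: "x = m" and e: "t @ morph_word f v = P' @ m # R" using Cons.prems(2) t by auto
    obtain P'' where p: "P' = t @ P''" "morph_word f v = P'' @ m # R" using split_marker[OF t(2) e] by blast
    obtain v1 v2 where v: "v = v1 @ v2" "morph_word f v1 = P''" "morph_word f v2 = m # R"
      using Cons.IH[of P''] Cons.prems(1) p by auto
    then show ?thesis using t p Cons x by (intro exI[of _ "a # v1"] exI[of _ v2]) auto
  qed
qed simp

lemma marked_morph_word: "marked m f \<Longrightarrow> set u \<subseteq> A3 \<Longrightarrow> u \<noteq> [] \<Longrightarrow> \<exists>t. morph_word f u = m # t"
  by (cases u) (auto dest!: markedD)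

text \<open>A block is the marker followed by everything up to the next marker, and f is injective
  on letters, so two parsings agree block by block. The m in front of R closes the last block of u,
  which might otherwise be a proper prefix of a block of v.\<close>

lemma parse_prefix:
  assumes f: "marked m f"
  shows "set v \<subseteq> A3 \<Longrightarrow> set u \<subseteq> A3 \<Longrightarrow> morph_word f v = morph_word f u @ m # R \<Longrightarrow>
    \<exists>v'. v = u @ v' \<and> morph_word f v' = m # R"
proof (induction u arbitrary: v)
  case (Cons a u)
  obtain t where t: "f a = m # t" "m \<notin> set t" using markedD[OF f, of a] Cons.prems by auto
  obtain b w where v: "v = b # w" using Cons.prems(3) t by (cases v) auto
  obtain s where s: "f b = m # s" "m \<notin> set s" using markedD[OF f, of b] Cons.prems v by auto
  have e: "s @ morph_word f w = t @ morph_word f u @ m # R" using Cons.prems(3) t s v by simp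
  \<comment> \<open>Cutting at the next marker recovers the tail of the first block on either side
    of \<open>e\<close>.\<close>
  have 1: "takeWhile (\<lambda>x. x \<noteq> m) (s @ morph_word f w) = s"
  proof (cases "w = []")
    case False
    then obtain y where "morph_word f w = m # y" using marked_morph_word[OF f, of w] Cons.prems v by auto
    then show ?thesis using s by (subst takeWhile_append2) auto
  qed (use s in \<open>auto simp: takeWhile_eq_all_conv\<close>)
  have 2: "takeWhile (\<lambda>x. x \<noteq> m) (t @ morph_word f u @ m # R) = t"
  proof (cases "u = []")
    case False
    then obtain y where "morph_word f u = m # y" using marked_morph_word[OF f, of u] Cons.prems by auto
    then show ?thesis using t by (subst takeWhile_append2) auto
  qed (use t in \<open>subst takeWhile_append2; auto\<close>)
  have st: "s = t" using 1 2 e by simp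
  then have "f a = f b" using s t by simp
  then have ab: "a = b" using f Cons.prems v unfolding marked_def inj_on_def by auto
  obtain v' where "w = u @ v'" "morph_word f v' = m # R"
    using Cons.IH[of w] Cons.prems v e st by auto
  then show ?case using v ab by auto
qed simp

text \<open>As z is free of the marker, the word can reach at most one letter past the block of b,
  and that letter is m.\<close>

lemma prefix_marker_block:
  assumes f: "marked m f" and b: "b \<in> A3" and z: "m \<notin> set z" and e: "f b @ m # R = (m # z @ [d]) @ Q"
  shows "prefix (m # z @ [d]) (f b @ [m])"
proof -
  obtain t where t: "f b = m # t" "m \<notin> set t" using markedD[OF f b] by blast
  have e2: "t @ m # R = (z @ [d]) @ Q" using e t by simp
  then obtain us where "t = (z @ [d]) @ us \<and> us @ m # R = Q \<or> t @ us = z @ [d] \<and> m # R = us @ Q"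
    unfolding append_eq_append_conv2 by blast
  then have "prefix (z @ [d]) (t @ [m])"
  proof
    assume "t = (z @ [d]) @ us \<and> us @ m # R = Q" then show ?thesis by auto
  next
    assume a: "t @ us = z @ [d] \<and> m # R = us @ Q"
    show ?thesis
    proof (cases us)
      case (Cons y ys)
      then have "y = m" using a by simp
      have "ys = []"
      proof (rule ccontr)
        assume "ys \<noteq> []"
        then obtain ys' y' where "ys = ys' @ [y']" by (meson rev_exhaust)
        then have "z = t @ m # ys'" using a Cons \<open>y = m\<close> by simp
        then show False using z by simp
      qed
      then show ?thesis using a Cons \<open>y = m\<close> by auto
    qed (use a in auto)
  qed
  then show ?thesis using t by auto
qed

lemma suffix_marker_block:
  assumes f: "marked m f" and a: "a \<in> A3" and x: "m \<notin> set x" and e: "V @ f a = P @ c # x"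
  shows "suffix (c # x) (f a)"
proof -
  obtain t where t: "f a = m # t" "m \<notin> set t" using markedD[OF f a] by blast
  from e obtain us where "V = P @ us \<and> us @ f a = c # x \<or> V @ us = P \<and> f a = us @ c # x"
    unfolding append_eq_append_conv2 by blast
  then show ?thesis
  proof
    assume u: "V = P @ us \<and> us @ f a = c # x"
    then have "us = []" using x t by (cases us) auto
    then show ?thesis using u by (auto simp: suffix_def)
  qed (auto simp: suffix_def)
qed

locale marked_image =
  fixes m f L' L
  assumes f: "marked m f" and L': "bilang L'" and img: "L = image_lang f L'"
begin

text \<open>The markers enclose the blocks of u, so c x is read at the end of the block before them
  and m z d at the start of the block after them. The letter d may already be the marker of the next
  block, whence the appended m.\<close>

lemma exts_parsed:
  assumes u: "set u \<subseteq> A3" and x: "m \<notin> set x" and z: "m \<notin> set z"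
  shows "exts L (x @ morph_word f u @ m # z) =
    {(c,d). \<exists>a\<in>A3. \<exists>b\<in>A3. suffix (c # x) (f a) \<and> prefix (m # z @ [d]) (f b @ [m]) \<and> a # u @ [b] \<in> L'}"
proof (intro set_eqI iffI; clarify)
  fix c d assume "(c,d) \<in> exts L (x @ morph_word f u @ m # z)"
  then obtain v0 where v0: "v0 \<in> L'" "sublist (c # x @ morph_word f u @ m # z @ [d]) (morph_word f v0)"
    unfolding exts_def img image_lang_def by auto
  \<comment> \<open>The extra letter guarantees that the block of b is followed by a marker even if
    b ends \<open>v0\<close>.\<close>
  obtain e where e: "v0 @ [e] \<in> L'" using extend_right[OF L' v0(1)] by blast
  have sv: "set v0 \<subseteq> A3" "e \<in> A3" using bilangD(1)[OF L' e] by auto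
  obtain P Q where 1: "morph_word f v0 = P @ (c # x @ morph_word f u @ m # z @ [d]) @ Q"
    using v0(2) unfolding sublist_def by blast
  have "\<exists>T. morph_word f u @ m # z @ d # Q = m # T"
    by (cases "u = []") (use marked_morph_word[OF f u] in auto)
  then obtain T where T: "morph_word f u @ m # z @ d # Q = m # T" by blast
  obtain v1 v2 where v: "v0 = v1 @ v2" "morph_word f v1 = P @ c # x" "morph_word f v2 = morph_word f u @ m # z @ d # Q"
    using parse_at_marker[OF f sv(1), of "P @ c # x" T] 1 T by auto
  obtain v3 where v3: "v2 = u @ v3" "morph_word f v3 = m # z @ d # Q"
    using parse_prefix[OF f _ u, of v2 "z @ d # Q"] v sv by auto
  obtain b v4 where b: "v3 = b # v4" using v3 by (cases v3) auto
  obtain a v5 where a: "v1 = v5 @ [a]" using v(2) by (cases v1 rule: rev_cases) auto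
  have ab: "a \<in> A3" "b \<in> A3" using sv v v3 a b by auto
  obtain R where R: "morph_word f (v4 @ [e]) = m # R"
    using marked_morph_word[OF f, of "v4 @ [e]"] sv v v3 b by auto
  have "prefix (m # z @ [d]) (f b @ [m])"
  proof (rule prefix_marker_block[OF f ab(2) z])
    have "f b @ m # R = morph_word f v3 @ f e" unfolding R[symmetric] b by simp
    then show "f b @ m # R = (m # z @ [d]) @ (Q @ f e)" unfolding v3(2) by simp
  qed
  moreover have "suffix (c # x) (f a)"
    by (rule suffix_marker_block[OF f ab(1) x, of "morph_word f v5" P]) (use v(2) a in simp)
  moreover have "a # u @ [b] \<in> L'"
    by (rule bilangD(2)[OF L' v0(1)]) (use v v3 a b in \<open>auto simp: sublist_def\<close>)
  ultimately show "\<exists>a\<in>A3. \<exists>b\<in>A3. suffix (c # x) (f a) \<and> prefix (m # z @ [d]) (f b @ [m]) \<and> a # u @ [b] \<in> L'"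
    using ab by blast
next
  fix c d a b assume ab: "a \<in> A3" "b \<in> A3" and s: "suffix (c # x) (f a)" and p: "prefix (m # z @ [d]) (f b @ [m])"
    and l: "a # u @ [b] \<in> L'"
  obtain e where e: "a # u @ [b,e] \<in> L'" using extend_right[OF L' l] by auto
  then have "e \<in> A3" using bilangD(1)[OF L' e] by auto
  then obtain t where t: "f e = m # t" using markedD[OF f] by blast
  obtain y where y: "f a = y @ c # x" using s by (auto simp: suffix_def)
  obtain q where q: "f b @ [m] = (m # z @ [d]) @ q" using p by (auto simp: prefix_def)
  have "morph_word f (a # u @ [b,e]) = y @ c # x @ morph_word f u @ (f b @ [m]) @ t"
    using t y by simp
  also have "\<dots> = y @ (c # x @ morph_word f u @ m # z @ [d]) @ (q @ t)" unfolding q by simp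
  finally have "sublist (c # x @ morph_word f u @ m # z @ [d]) (morph_word f (a # u @ [b,e]))"
    unfolding sublist_def by blast
  then show "(c,d) \<in> exts L (x @ morph_word f u @ m # z)"
    unfolding exts_def img image_lang_def 
    by (intro CollectI case_prodI bexI[OF _ e]) simp
qed

text \<open>No block boundary lies inside a word without marker. With its two neighbours it
  therefore fits into a single block followed by the marker, so its extensions depend on f only and
  can be computed from the three blocks.\<close>

lemma exts_unmarked:
  assumes w: "m \<notin> set w"
  shows "exts L w = {(c,d). \<exists>a\<in>A3. sublist (c # w @ [d]) (f a @ [m])}"
proof (intro set_eqI iffI; clarify)
  fix c d assume "(c,d) \<in> exts L w"
  then obtain v0 where v0: "v0 \<in> L'" "sublist (c # w @ [d]) (morph_word f v0)"
    unfolding exts_def img image_lang_def by auto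
  obtain e where e: "v0 @ [e] \<in> L'" using extend_right[OF L' v0(1)] by blast
  have sv: "set v0 \<subseteq> A3" "e \<in> A3" using bilangD(1)[OF L' e] by auto
  obtain P Q where 1: "morph_word f v0 = P @ c # w @ d # Q"
    using v0(2) unfolding sublist_def by auto
  have "v0 \<noteq> []" using 1 by auto
  \<comment> \<open>Go back to the last marker at or before c. It exists because the image of a
    nonempty word starts with the marker.\<close>
  have "\<exists>P1 P2 p. P @ c # w = P1 @ m # P2 \<and> m \<notin> set P2 \<and> m # P2 = p @ c # w"
  proof (cases "c = m")
    case True
    then show ?thesis using w by (intro exI[of _ P] exI[of _ w] exI[of _ "[]"]) auto
  next
    case False
    have "m \<in> set P"
    proof -
      obtain t where t: "morph_word f v0 = m # t" using marked_morph_word[OF f sv(1) \<open>v0 \<noteq> []\<close>] by blast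
      show ?thesis using 1 t False by (cases P) auto
    qed
    then obtain P1 P2 where "P = P1 @ m # P2" "m \<notin> set P2" by (meson split_list_last)
    then show ?thesis using False w by (intro exI[of _ P1] exI[of _ "P2 @ c # w"] exI[of _ "m # P2"]) auto
  qed
  then obtain P1 P2 p where P: "P @ c # w = P1 @ m # P2" "m \<notin> set P2" "m # P2 = p @ c # w" by blast
  have "morph_word f v0 = P1 @ m # P2 @ d # Q" using 1 P(1) by (metis append.assoc append_Cons)
  then obtain v1 v2 where v: "v0 = v1 @ v2" "morph_word f v2 = m # P2 @ d # Q"
    using parse_at_marker[OF f sv(1)] by blast
  obtain b v4 where b: "v2 = b # v4" using v by (cases v2) auto
  have bA: "b \<in> A3" using sv v b by auto
  obtain R where R: "morph_word f (v4 @ [e]) = m # R"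
    using marked_morph_word[OF f, of "v4 @ [e]"] sv v b by auto
  have "prefix (m # P2 @ [d]) (f b @ [m])"
  proof (rule prefix_marker_block[OF f bA P(2)])
    have "f b @ m # R = morph_word f v2 @ f e" unfolding R[symmetric] b by simp
    then show "f b @ m # R = (m # P2 @ [d]) @ (Q @ f e)" unfolding v(2) by simp
  qed
  moreover have "m # P2 @ [d] = p @ c # w @ [d]" using P(3) by simp
  ultimately have "sublist (c # w @ [d]) (f b @ [m])" unfolding prefix_def sublist_def by (metis append.assoc)
  then show "\<exists>a\<in>A3. sublist (c # w @ [d]) (f a @ [m])" using bA by blast
next
  fix c d a assume a: "a \<in> A3" and s: "sublist (c # w @ [d]) (f a @ [m])"
  obtain e where e: "[a,e] \<in> L'" using extend_right[OF L' bilangD(4)[OF L' a]] by auto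
  then have "e \<in> A3" using bilangD(1)[OF L' e] by auto
  then obtain t where t: "f e = m # t" using markedD[OF f] by blast
  have "sublist (f a @ [m]) (morph_word f [a,e])" unfolding sublist_def using t
    by (intro exI[of _ "[]"] exI[of _ t]) simp
  then have "sublist (c # w @ [d]) (morph_word f [a,e])" using s by (rule sublist_order.order_trans[rotated])
  then show "(c,d) \<in> exts L w" unfolding exts_def img image_lang_def 
    by (intro CollectI case_prodI bexI[OF _ e]) simp
qed

text \<open>x ends before the first marker and z starts after the last one; with a single marker u
  is empty.\<close>

lemma parse_word:
  assumes w: "w \<in> L" "m \<in> set w"
  shows "\<exists>x u z. w = x @ morph_word f u @ m # z \<and> m \<notin> set x \<and> m \<notin> set z \<and> set u \<subseteq> A3 \<and> u \<in> L'"
proof -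
  obtain v where v: "v \<in> L'" "sublist w (morph_word f v)" using w(1) unfolding img image_lang_def by blast
  obtain P Q where pq: "morph_word f v = P @ w @ Q" using v(2) unfolding sublist_def by blast
  have sv: "set v \<subseteq> A3" using bilangD(1)[OF L' v(1)] .
  obtain y z where y: "w = y @ m # z" "m \<notin> set z" using w(2) by (meson split_list_last)
  obtain v1 v2 where v12: "v = v1 @ v2" "morph_word f v1 = P @ y" using parse_at_marker[OF f sv, of "P @ y" "z @ Q"] pq y by auto
  show ?thesis
  proof (cases "m \<in> set y")
    case False
    then show ?thesis using y Nil_in_bilang[OF L'] by (intro exI[of _ y] exI[of _ "[]"] exI[of _ z]) auto
  next
    case True
    then obtain x y' where x: "y = x @ m # y'" "m \<notin> set x" by (meson split_list_first)
    obtain v3 v4 where v34: "v1 = v3 @ v4" "morph_word f v4 = m # y'"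
      using parse_at_marker[OF f, of v1 "P @ x" y'] sv v12 x by auto
    have "v4 \<in> L'" by (rule bilang_append[OF L', of v3 v4 v2]) (use v12 v34 v(1) in simp)
    then show ?thesis using x y v34 v12 sv by (intro exI[of _ x] exI[of _ v4] exI[of _ z]) auto
  qed
qed

end

text \<open>Right extensions are treated as left extensions of reversed words; as every block is followed by
the marker, the marker is appended before reversing.\<close>
definition suffix_rel :: "(nat \<Rightarrow> nat list) \<Rightarrow> nat list \<Rightarrow> (nat \<times> nat) set" where
  "suffix_rel g x = {(a,c). a \<in> A3 \<and> suffix (c # x) (g a)}"

definition left_rels :: "nat \<Rightarrow> morph \<Rightarrow> (nat \<times> nat) set set" where
  "left_rels m f = {suffix_rel f x | x. m \<notin> set x}"

definition right_rels :: "nat \<Rightarrow> morph \<Rightarrow> (nat \<times> nat) set set" where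
  "right_rels m f = {suffix_rel (\<lambda>b. rev (f b @ [m])) (x @ [m]) | x. m \<notin> set x}"

lemma prefix_rev_suffix: "prefix (m # z @ [d]) y \<longleftrightarrow> suffix (d # rev z @ [m]) (rev y)"
  unfolding suffix_to_prefix by simp

lemma (in marked_image) exts_suffix_rel:
  assumes u: "set u \<subseteq> A3" and x: "m \<notin> set x" and z: "m \<notin> set z"
  shows "exts L (x @ morph_word f u @ m # z) = (suffix_rel f x)\<inverse> O exts L' u O suffix_rel (\<lambda>b. rev (f b @ [m])) (rev z @ [m])"
  unfolding exts_parsed[OF assms] prefix_rev_suffix
  unfolding suffix_rel_def exts_def by (auto simp del: rev_append)

context marked_image
begin

text \<open>Each pair of extension maps with nonempty composite is realised by a word of L, so all
  the images of \<open>exts L' u\<close> required by \<open>tree_of_branching\<close> are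
  trees.\<close>

lemma dendric_preimage:
  assumes F: "branching k (left_rels m f)" "branching k' (right_rels m f)" 
    and t: "\<And>w. w \<in> L \<Longrightarrow> tree_rel (exts L w)" and L: "bilang L" and u: "u \<in> L'"
  shows "tree_rel (exts L' u)"
proof (rule tree_of_branching[OF F exts_subset[OF L'] exts_nonempty[OF L' u]])
  fix R R' assume R: "R \<in> left_rels m f" "R' \<in> right_rels m f" and ne: "R\<inverse> O exts L' u O R' \<noteq> {}"
  obtain x z where x: "m \<notin> set x" "R = suffix_rel f x" and z: "m \<notin> set z" "R' = suffix_rel (\<lambda>b. rev (f b @ [m])) (z @ [m])"
    using R unfolding left_rels_def right_rels_def by blast
  \<comment> \<open>The right maps are indexed by reversed words.\<close>
  have e: "exts L (x @ morph_word f u @ m # rev z) = R\<inverse> O exts L' u O R'"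
    using exts_suffix_rel[OF bilangD(1)[OF L' u], of x "rev z"] x z by simp
  then have "x @ morph_word f u @ m # rev z \<in> L" using ne exts_empty[OF L] by metis
  from t[OF this] show "tree_rel (R\<inverse> O exts L' u O R')" unfolding e .
qed

text \<open>Blocks are nonempty and w contains one more marker than the blocks of u, so u is
  strictly shorter than w. This is what drives the induction on length.\<close>

lemma good_tree_image:
  assumes F: "branching k (left_rels m f)" "label_step k l l1" and F': "branching k' (right_rels m f)" "label_step k' r r1"
    and lr: "l \<in> {0} \<union> A3" "r \<in> {0} \<union> A3"
    and w: "w \<in> L" "m \<in> set w" and L: "bilang L"
    and g: "\<And>u. u \<in> L' \<Longrightarrow> length u < length w \<Longrightarrow> good_tree l r (exts L' u)"
  shows "good_tree l1 r1 (exts L w)"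
proof -
  obtain x u z where w2: "w = x @ morph_word f u @ m # z" "m \<notin> set x" "m \<notin> set z" "set u \<subseteq> A3" "u \<in> L'"
    using parse_word[OF w] by blast
  have len: "length u \<le> length (morph_word f u)" if "set u \<subseteq> A3" for u
    using that by (induction u) (auto dest!: markedD[OF f])
  have "length u < length w" using len[OF w2(4)] w2(1) by simp
  note gu = g[OF w2(5) this]
  have e: "exts L w = (suffix_rel f x)\<inverse> O exts L' u O suffix_rel (\<lambda>b. rev (f b @ [m])) (rev z @ [m])"
    unfolding w2(1) by (rule exts_suffix_rel[OF w2(4,2,3)])
  have "suffix_rel f x \<in> left_rels m f" unfolding left_rels_def using w2(2) by blast
  moreover have "m \<notin> set (rev z)" using w2(3) by simp
  then have "suffix_rel (\<lambda>b. rev (f b @ [m])) (rev z @ [m]) \<in> right_rels m f" unfolding right_rels_def by blast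
  ultimately have PP: "suffix_rel f x \<in> left_rels m f" "suffix_rel (\<lambda>b. rev (f b @ [m])) (rev z @ [m]) \<in> right_rels m f" .
  from good_tree_branching[OF F PP(1) F' PP(2) exts_subset[OF L'] gu lr]
  show ?thesis unfolding e[symmetric] using exts_nonempty[OF L w(1)] by blast
qed

end

subsection \<open>The morphisms of S3\<close>

fun kind_left :: "S3 \<Rightarrow> (nat \<times> nat) option" where
  "kind_left Alpha = None"
| "kind_left Beta = Some (1,1)"
| "kind_left Gamma = None"
| "kind_left (Delta k) = Some (1,3)"
| "kind_left (Zeta k) = Some (2,3)"
| "kind_left Eta = Some (2,2)"

fun kind_right :: "S3 \<Rightarrow> (nat \<times> nat) option" where
  "kind_right Alpha = None"
| "kind_right Beta = None"
| "kind_right Gamma = Some (1,1)"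
| "kind_right (Delta k) = Some (1,1)"
| "kind_right (Zeta k) = Some (2,3)"
| "kind_right Eta = Some (1,3)"

text \<open>The image rules treat the two labels independently; this splits the edge condition into
  a left and a right half.\<close>

lemma S3_image_step:
  "S3_image s (l,r) = Some (l1,r1) \<longleftrightarrow> label_step (kind_left s) l l1 \<and> label_step (kind_right s) r r1"
  by (cases s) auto

lemma ball_A3: "(\<forall>a\<in>A3. P a) \<longleftrightarrow> P 1 \<and> P 2 \<and> P 3"
  by (simp add: A3_def)

lemma bex_A3: "(\<exists>a\<in>A3. P a) \<longleftrightarrow> P 1 \<or> P 2 \<or> P 3"
  by (simp add: A3_def)

lemma replicate_eq_singleton: "replicate k a = [b] \<longleftrightarrow> k = 1 \<and> a = b" "[b] = replicate k a \<longleftrightarrow> k = 1 \<and> a = b"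
  by (cases k; auto)+

lemma Cons_eq_replicate: "b \<noteq> y \<Longrightarrow> (b # v = replicate i y) = False" "b \<noteq> y \<Longrightarrow> (replicate i y = b # v) = False"
  by (cases i; auto)+

lemma S3_morph_marked:
  assumes "S3_valid s"
  shows "marked 1 (S3_morph s)"
  unfolding marked_def inj_on_def ball_A3
  using assms by (cases s) (auto simp: S3_valid_def A3_def replicate_eq_singleton)

lemma suffix_replicate_append:
  "suffix (c # x) (replicate k y @ u) \<longleftrightarrow> suffix (c # x) u \<or> (\<exists>i<k. x = replicate i y @ u \<and> c = y)"
  by (induction k) (auto simp: suffix_Cons less_Suc_eq)

lemma suffix_replicate:
  "suffix (c # x) (replicate k y) \<longleftrightarrow> (\<exists>i<k. x = replicate i y \<and> c = y)"
  using suffix_replicate_append[of c x k y "[]"] by simp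

lemma const_relI: "(\<And>a c a' c'. (a,c) \<in> R \<Longrightarrow> (a',c') \<in> R \<Longrightarrow> c = c') \<Longrightarrow> const_rel R"
  unfolding const_rel_def by blast

lemma branching_NoneI:
  assumes x0: "x0 \<in> S" "suffix_rel g x0 = Id_on A3"
    and o: "\<And>x. x \<in> S \<Longrightarrow> Range (suffix_rel g x) \<subseteq> A3" "\<And>x. x \<in> S \<Longrightarrow> x \<noteq> x0 \<Longrightarrow> const_rel (suffix_rel g x)"
  shows "branching None (suffix_rel g ` S)"
proof -
  have "suffix_rel g x \<subseteq> A3 \<times> A3 \<and> (suffix_rel g x = Id_on A3 \<or> const_rel (suffix_rel g x))" if "x \<in> S" for x
  proof
    show "suffix_rel g x \<subseteq> A3 \<times> A3" using o(1)[OF that] unfolding suffix_rel_def by blast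
    show "suffix_rel g x = Id_on A3 \<or> const_rel (suffix_rel g x)" using x0(2) o(2)[OF that] by (cases "x = x0") simp_all
  qed
  then show ?thesis unfolding branching.simps x0(2)[symmetric] using x0(1) by simp
qed

text \<open>At \<open>x0\<close> one block is told apart from the other two; at \<open>x1\<close>,
  the longest suffix common to those two, they are told apart from each other. All other suffixes
  determine the next letter.\<close>

lemma branching_SomeI:
  assumes A: "A3 = {a,b,c}" "distinct [a,b,c]" "{p,q,p',q'} \<subseteq> A3" "p \<noteq> q" "p' \<noteq> q'" "{p,q} \<inter> {p',q'} = {m}"
    and x0: "x0 \<in> S" "suffix_rel g x0 = merge_rel a b c p q" and x1: "x1 \<in> S" "suffix_rel g x1 = pair_rel a b p' q'"
    and o: "\<And>x. x \<in> S \<Longrightarrow> Range (suffix_rel g x) \<subseteq> A3" "\<And>x. x \<in> S \<Longrightarrow> x \<noteq> x0 \<Longrightarrow> x \<noteq> x1 \<Longrightarrow> const_rel (suffix_rel g x)"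
  shows "branching (Some (c,m)) (suffix_rel g ` S)"
proof -
  have "suffix_rel g x \<subseteq> A3 \<times> A3 \<and> (suffix_rel g x = suffix_rel g x0 \<or> suffix_rel g x = suffix_rel g x1 \<or> const_rel (suffix_rel g x))" if "x \<in> S" for x
  proof
    show "suffix_rel g x \<subseteq> A3 \<times> A3" using o(1)[OF that] unfolding suffix_rel_def by blast
    show "suffix_rel g x = suffix_rel g x0 \<or> suffix_rel g x = suffix_rel g x1 \<or> const_rel (suffix_rel g x)"
      using o(2)[OF that] by (cases "x = x0 \<or> x = x1") auto
  qed
  then have 2: "\<forall>R\<in>suffix_rel g ` S. R \<subseteq> A3 \<times> A3 \<and> (R = merge_rel a b c p q \<or> R = pair_rel a b p' q' \<or> const_rel R)"
    unfolding x0(2) x1(2) by blast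
  have 1: "merge_rel a b c p q \<in> suffix_rel g ` S" "pair_rel a b p' q' \<in> suffix_rel g ` S"
    unfolding x0(2)[symmetric] x1(2)[symmetric] using x0(1) x1(1) by simp_all
  show ?thesis unfolding branching.simps
    by (intro exI[of _ a] exI[of _ b] exI[of _ p] exI[of _ q] exI[of _ p'] exI[of _ q'] conjI) (fact A 1 2)+
qed

lemma left_rels_eq: "left_rels m f = suffix_rel f ` {x. m \<notin> set x}"
  unfolding left_rels_def by blast

lemma right_rels_eq: "right_rels m f = suffix_rel (\<lambda>b. rev (f b @ [m])) ` {x @ [m] | x. m \<notin> set x}"
  unfolding right_rels_def by blast

lemma Range_suffix_rel:
  assumes "\<And>a. a \<in> A3 \<Longrightarrow> set (g a) \<subseteq> A3"
  shows "Range (suffix_rel g x) \<subseteq> A3"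
  using assms set_mono_suffix unfolding suffix_rel_def by fastforce

lemma Range_left: "marked m f \<Longrightarrow> Range (suffix_rel f x) \<subseteq> A3"
  by (rule Range_suffix_rel) (auto simp: marked_def)

lemma Range_right: "marked m f \<Longrightarrow> Range (suffix_rel (\<lambda>b. rev (f b @ [m])) x) \<subseteq> A3"
  by (rule Range_suffix_rel) (fastforce simp: marked_def)

lemma suffix_rel_iff: "(a,c) \<in> suffix_rel g x \<longleftrightarrow> a = 1 \<and> suffix (c # x) (g 1) \<or> a = 2 \<and> suffix (c # x) (g 2) \<or> a = 3 \<and> suffix (c # x) (g 3)"
  unfolding suffix_rel_def A3_def by auto

lemma suffix_rel_set: "suffix_rel g x = {(a,c). a = 1 \<and> suffix (c # x) (g 1) \<or> a = 2 \<and> suffix (c # x) (g 2) \<or> a = 3 \<and> suffix (c # x) (g 3)}"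
  by (auto simp: suffix_rel_iff)

lemma A3_orders: "A3 = {1,2,3}" "A3 = {2,3,1}" "A3 = {1,3,2}"
  by (auto simp: A3_def)

lemma replicate_eq_iff: "replicate i (y::'a) = replicate j y \<longleftrightarrow> i = j"
  by (metis length_replicate)

text \<open>The last letters of the blocks are distinct for alpha and gamma. In the other cases two
  blocks end alike, and their longest common suffix is the witness \<open>x1\<close>: the letter 2
  for beta, 3 for eta, and the run of k letters 3 for delta and zeta.\<close>

lemma left_rels_S3:
  assumes v: "S3_valid s"
  shows "branching (kind_left s) (left_rels 1 (S3_morph s))"
proof -
  note R = Range_left[OF S3_morph_marked[OF v]]
  show ?thesis
  proof (cases s)
    case Alpha
    have "branching None (left_rels 1 (S3_morph s))" unfolding left_rels_eq
      by (rule branching_NoneI[where ?x0.0 = "[]", OF _ _ R]; (rule const_relI)?)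
        (auto simp: Alpha suffix_rel_set Id_on_def A3_def suffix_Cons)
    then show ?thesis using Alpha by simp
  next
    case Gamma
    have "branching None (left_rels 1 (S3_morph s))" unfolding left_rels_eq
      by (rule branching_NoneI[where ?x0.0 = "[]", OF _ _ R]; (rule const_relI)?)
        (auto simp: Gamma suffix_rel_set Id_on_def A3_def suffix_Cons)
    then show ?thesis using Gamma by simp
  next
    case Beta
    have "branching (Some (1,1)) (left_rels 1 (S3_morph s))" unfolding left_rels_eq
      by (rule branching_SomeI[where ?x0.0 = "[]" and ?x1.0 = "[2]" and a = 2 and b = 3 and p = 2 and q = 1 and p' = 1 and q' = 3,
            OF A3_orders(2) _ _ _ _ _ _ _ _ _ R]; (rule const_relI)?)
        (auto simp: Beta suffix_rel_set merge_rel_def pair_rel_def A3_def suffix_Cons)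
    then show ?thesis using Beta by simp
  next
    case Eta
    have "branching (Some (2,2)) (left_rels 1 (S3_morph s))" unfolding left_rels_eq
      by (rule branching_SomeI[where ?x0.0 = "[]" and ?x1.0 = "[3]" and a = 1 and b = 3 and p = 3 and q = 2 and p' = 1 and q' = 2,
            OF A3_orders(3) _ _ _ _ _ _ _ _ _ R]; (rule const_relI)?)
        (auto simp: Eta suffix_rel_set merge_rel_def pair_rel_def A3_def suffix_Cons)
    then show ?thesis using Eta by simp
  next
    case (Delta k)
    then have k: "0 < k" using v by (simp add: S3_valid_def)
    have "branching (Some (1,3)) (left_rels 1 (S3_morph s))" unfolding left_rels_eq
      by (rule branching_SomeI[where ?x0.0 = "[]" and ?x1.0 = "replicate k 3" and a = 2 and b = 3 and p = 3 and q = 1 and p' = 2 and q' = 3,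
            OF A3_orders(2) _ _ _ _ _ _ _ _ _ R]; (rule const_relI)?)
        (use k in \<open>auto simp: Delta suffix_rel_set merge_rel_def pair_rel_def A3_def suffix_Cons suffix_replicate replicate_eq_iff Cons_eq_replicate simp del: replicate_Suc\<close>)
    then show ?thesis using Delta by simp
  next
    case (Zeta k)
    then have k: "0 < k" using v by (simp add: S3_valid_def)
    have "branching (Some (2,3)) (left_rels 1 (S3_morph s))" unfolding left_rels_eq
      by (rule branching_SomeI[where ?x0.0 = "[]" and ?x1.0 = "replicate k 3" and a = 1 and b = 3 and p = 3 and q = 2 and p' = 1 and q' = 3,
            OF A3_orders(3) _ _ _ _ _ _ _ _ _ R]; (rule const_relI)?)
        (use k in \<open>auto simp: Zeta suffix_rel_set merge_rel_def pair_rel_def A3_def suffix_Cons suffix_replicate replicate_eq_iff Cons_eq_replicate simp del: replicate_Suc\<close>)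
    then show ?thesis using Zeta by simp
  qed
qed

text \<open>The marker that starts every block is the common prefix, so the comparison begins at the
  word \<open>[1]\<close>. Whenever two blocks agree longer, the shorter one is a prefix of the
  longer one and is told apart by the marker that follows it; this is the value 1 of p'.\<close>

lemma right_rels_S3:
  assumes v: "S3_valid s"
  shows "branching (kind_right s) (right_rels 1 (S3_morph s))"
proof -
  note R = Range_right[OF S3_morph_marked[OF v]]
  show ?thesis
  proof (cases s)
    case Alpha
    have "branching None (right_rels 1 (S3_morph s))" unfolding right_rels_eq
      by (rule branching_NoneI[where ?x0.0 = "[1]", OF _ _ R]; (rule const_relI)?)
        (auto simp: Alpha suffix_rel_set Id_on_def A3_def suffix_Cons)
    then show ?thesis using Alpha by simp
  next
    case Beta
    have "branching None (right_rels 1 (S3_morph s))" unfolding right_rels_eq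
      by (rule branching_NoneI[where ?x0.0 = "[1]", OF _ _ R]; (rule const_relI)?)
        (auto simp: Beta suffix_rel_set Id_on_def A3_def suffix_Cons append_eq_Cons_conv)
    then show ?thesis using Beta by simp
  next
    case Gamma
    have "branching (Some (1,1)) (right_rels 1 (S3_morph s))" unfolding right_rels_eq
      by (rule branching_SomeI[where ?x0.0 = "[1]" and ?x1.0 = "[2,1]" and a = 2 and b = 3 and p = 2 and q = 1 and p' = 1 and q' = 3,
            OF A3_orders(2) _ _ _ _ _ _ _ _ _ R]; (rule const_relI)?)
        (auto simp: Gamma suffix_rel_set merge_rel_def pair_rel_def A3_def suffix_Cons append_eq_Cons_conv)
    then show ?thesis using Gamma by simp
  next
    case Eta
    have "branching (Some (1,3)) (right_rels 1 (S3_morph s))" unfolding right_rels_eq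
      by (rule branching_SomeI[where ?x0.0 = "[1]" and ?x1.0 = "[2,1]" and a = 2 and b = 3 and p = 2 and q = 3 and p' = 1 and q' = 3,
            OF A3_orders(2) _ _ _ _ _ _ _ _ _ R]; (rule const_relI)?)
        (auto simp: Eta suffix_rel_set merge_rel_def pair_rel_def A3_def suffix_Cons append_eq_Cons_conv)
    then show ?thesis using Eta by simp
  next
    case (Delta k)
    then have k: "0 < k" using v by (simp add: S3_valid_def)
    have "branching (Some (1,1)) (right_rels 1 (S3_morph s))" unfolding right_rels_eq
      by (rule branching_SomeI[where ?x0.0 = "[1]" and ?x1.0 = "replicate k 3 @ [2,1]" and a = 2 and b = 3 and p = 2 and q = 1 and p' = 1 and q' = 3,
            OF A3_orders(2) _ _ _ _ _ _ _ _ _ R]; (rule const_relI)?)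
        (use k in \<open>auto simp: Delta suffix_rel_set merge_rel_def pair_rel_def A3_def suffix_Cons suffix_replicate_append suffix_replicate replicate_eq_iff Cons_eq_replicate append_eq_Cons_conv simp del: replicate_Suc\<close>)
    then show ?thesis using Delta by simp
  next
    case (Zeta k)
    then have k: "0 < k" using v by (simp add: S3_valid_def)
    have "branching (Some (2,3)) (right_rels 1 (S3_morph s))" unfolding right_rels_eq
      by (rule branching_SomeI[where ?x0.0 = "[1]" and ?x1.0 = "replicate k 3 @ [1]" and a = 1 and b = 3 and p = 3 and q = 2 and p' = 1 and q' = 3,
            OF A3_orders(3) _ _ _ _ _ _ _ _ _ R]; (rule const_relI)?)
        (use k in \<open>auto simp: Zeta suffix_rel_set merge_rel_def pair_rel_def A3_def suffix_Cons suffix_replicate_append suffix_replicate replicate_eq_iff Cons_eq_replicate append_eq_Cons_conv simp del: replicate_Suc\<close>)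
    then show ?thesis using Zeta by simp
  qed
qed

section \<open>Extension graphs of words without the marker\<close>

lemma sublist_Cons_snoc:
  "sublist (c # w @ [d]) (y # ys) \<longleftrightarrow> c = y \<and> prefix (w @ [d]) ys \<or> sublist (c # w @ [d]) ys"
  "\<not> sublist (c # w @ [d]) []"
  by (auto simp: sublist_Cons_right)

lemma prefix_snoc_Cons:
  "prefix (w @ [d]) (y # ys) \<longleftrightarrow> w = [] \<and> d = y \<or> (\<exists>v. w = y # v \<and> prefix (v @ [d]) ys)"
  "\<not> prefix (w @ [d]) []"
  by (cases w) auto

lemma prefix_run:
  "m \<notin> set w \<Longrightarrow> prefix (w @ [d]) (replicate k y @ [m]) \<longleftrightarrow> (\<exists>i<k. w = replicate i y \<and> d = y) \<or> w = replicate k y \<and> d = m"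
proof (induction k arbitrary: w)
  case 0
  then show ?case by (cases w) (simp_all add: prefix_snoc_Cons)
next
  case (Suc k)
  have 1: "(\<exists>i<Suc k. w = replicate i y \<and> d = y) \<longleftrightarrow> w = [] \<and> d = y \<or> (\<exists>i<k. w = y # replicate i y \<and> d = y)"
    unfolding Ex_less_Suc2 replicate.simps ..
  have 2: "prefix (w @ [d]) (replicate (Suc k) y @ [m]) \<longleftrightarrow> w = [] \<and> d = y \<or> (\<exists>v. w = y # v \<and> prefix (v @ [d]) (replicate k y @ [m]))"
    unfolding replicate_Suc append_Cons prefix_snoc_Cons ..
  have 3: "prefix (v @ [d]) (replicate k y @ [m]) \<longleftrightarrow> (\<exists>i<k. v = replicate i y \<and> d = y) \<or> v = replicate k y \<and> d = m"
    if "w = y # v" for v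
    using Suc that by simp
  show ?case unfolding 1 2 using 3 by (metis replicate_Suc)
qed

lemma sublist_run:
  "m \<notin> set w \<Longrightarrow> sublist (c # w @ [d]) (replicate k y @ [m]) \<longleftrightarrow>
     c = y \<and> ((\<exists>i. Suc i < k \<and> w = replicate i y \<and> d = y) \<or> (\<exists>i<k. w = replicate i y \<and> d = m))"
proof (induction k)
  case 0
  then show ?case by (auto simp: sublist_Cons_snoc prefix_snoc_Cons)
next
  case (Suc k)
  have 1: "sublist (c # w @ [d]) (replicate (Suc k) y @ [m]) \<longleftrightarrow>
    c = y \<and> ((\<exists>i<k. w = replicate i y \<and> d = y) \<or> w = replicate k y \<and> d = m) \<or>
    c = y \<and> ((\<exists>i. Suc i < k \<and> w = replicate i y \<and> d = y) \<or> (\<exists>i<k. w = replicate i y \<and> d = m))"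
    unfolding replicate_Suc append_Cons sublist_Cons_snoc prefix_run[OF Suc.prems] Suc.IH[OF Suc.prems] ..
  have 2: "(\<exists>i. Suc i < Suc k \<and> w = replicate i y \<and> d = y) \<longleftrightarrow> (\<exists>i<k. w = replicate i y \<and> d = y)" by simp
  have 3: "(\<exists>i<Suc k. w = replicate i y \<and> d = m) \<longleftrightarrow> (\<exists>i<k. w = replicate i y \<and> d = m) \<or> w = replicate k y \<and> d = m"
    unfolding Ex_less_Suc by blast
  have 4: "(\<exists>i. Suc i < k \<and> w = replicate i y \<and> d = y) \<Longrightarrow> (\<exists>i<k. w = replicate i y \<and> d = y)"
    using Suc_lessD by blast
  show ?case unfolding 1 2 3 using 4 by argo
qed

text \<open>With two letters on each side the only possible cycle is the full square, and the only
  pair on each side is linked, so both labels are arbitrary.\<close>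

lemma good_tree_two_two:
  assumes E: "E \<subseteq> A3 \<times> A3" "E \<noteq> {}" and D: "Domain E \<subseteq> {p,q}" "Range E \<subseteq> {u,v}"
    and c: "p \<in> Domain E \<Longrightarrow> q \<in> Domain E \<Longrightarrow> share E p q" "u \<in> Range E \<Longrightarrow> v \<in> Range E \<Longrightarrow> share (E\<inverse>) u v"
    and n: "\<not> {(p,u),(p,v),(q,u),(q,v)} \<subseteq> E"
  shows "good_tree l r E"
proof -
  have un: "d = d'" if "(p,d) \<in> E" "(q,d) \<in> E" "(p,d') \<in> E" "(q,d') \<in> E" for d d'
  proof -
    have "d = u \<or> d = v" "d' = u \<or> d' = v" using D(2) that by blast+
    then show ?thesis using n that by blast
  qed
  have un': "d = d'" if "(u,d) \<in> E\<inverse>" "(v,d) \<in> E\<inverse>" "(u,d') \<in> E\<inverse>" "(v,d') \<in> E\<inverse>" for d d'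
  proof -
    have "d = p \<or> d = q" "d' = p \<or> d' = q" using D(1) that by blast+
    then show ?thesis using n that by blast
  qed
  have "tree_rel E" "label_ok l E" by (rule tree_two[OF E(1) D(1) E(2) c(1) un]; assumption)+
  moreover have "label_ok r (E\<inverse>)"
    by (rule tree_two(2)[of _ u v, OF _ _ _ _ un']) (use E D c(2) in auto)
  ultimately show ?thesis unfolding good_tree_def by blast
qed

lemma good_tree_right_one:
  assumes E: "E \<subseteq> A3 \<times> A3" "E \<noteq> {}" and D: "Range E \<subseteq> {p}"
  shows "good_tree l r E"
proof -
  have "good_tree r l (E\<inverse>)" by (rule tree_one[of _ p]) (use assms in auto)
  then show ?thesis unfolding good_tree_converse .
qed

text \<open>E is the extension graph of a run of i letters 3 under delta (c = 2) or zeta (c = 1). Of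
  the square on {c,3} and {3,1} it lacks (c,1) for i < k and (3,3) for i = k; for i = k + 1 only
  (c,1) is left, and for larger i nothing.\<close>

lemma good_tree_run:
  assumes c: "c = 1 \<or> c = (2::nat)" and i: "0 < i"
    and E: "E = {(x,y). x = c \<and> y = 3 \<and> i \<le> k \<or> x = 3 \<and> y = 3 \<and> i < k \<or> x = 3 \<and> y = 1 \<and> i \<le> k \<or> x = c \<and> y = 1 \<and> (i = k \<or> i = Suc k)}"
    and ne: "E \<noteq> {}"
  shows "good_tree l r E"
proof (rule good_tree_two_two[OF _ ne, of c 3 3 1])
  have m: "(x,y) \<in> E \<Longrightarrow> (x = c \<or> x = 3) \<and> (y = 3 \<or> y = 1)" for x y unfolding E by blast
  have e: "(c,3) \<in> E \<longleftrightarrow> i \<le> k" "(3,3) \<in> E \<longleftrightarrow> i < k" "(3,1) \<in> E \<longleftrightarrow> i \<le> k" "(c,1) \<in> E \<longleftrightarrow> i = k \<or> i = Suc k"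
    unfolding E using c by auto
  have "c \<in> A3" "3 \<in> A3" "1 \<in> A3" using c by (auto simp: A3_def)
  then show "E \<subseteq> A3 \<times> A3" by (intro subrelI) (use m in blast)
  show "Domain E \<subseteq> {c,3}" "Range E \<subseteq> {3,1}" using m by blast+
  have "\<not> ((3,3) \<in> E \<and> (c,1) \<in> E)" unfolding e by auto
  then show "\<not> {(c,3),(c,1),(3,3),(3,1)} \<subseteq> E" by blast
  have 1: "share E c 3 \<and> share (E\<inverse>) 3 1" if "i \<le> k"
  proof (cases "i = k")
    case True
    then have "(c,1) \<in> E" "(3,1) \<in> E" "(c,3) \<in> E" using e by simp_all
    then show ?thesis unfolding share_def by blast
  next
    case False
    then have "(c,3) \<in> E" "(3,3) \<in> E" "(3,1) \<in> E" using e that by simp_all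
    then show ?thesis unfolding share_def by blast
  qed
  show "share E c 3" if d: "c \<in> Domain E" "3 \<in> Domain E"
  proof -
    have "(3,3) \<in> E \<or> (3,1) \<in> E" using d(2) m[of 3] by blast
    then have "i \<le> k" unfolding e by auto
    then show ?thesis using 1 by blast
  qed
  show "share (E\<inverse>) 3 1" if d: "3 \<in> Range E" "1 \<in> Range E"
  proof -
    have "(3,3) \<in> E \<or> (c,3) \<in> E" using d(1) m[of _ 3] by blast
    then have "i \<le> k" unfolding e by auto
    then show ?thesis using 1 by blast
  qed
qed

lemma prefix_replicate_run:
  "m \<noteq> y \<Longrightarrow> prefix (replicate i y @ [d]) (replicate k y @ [m]) \<longleftrightarrow> i < k \<and> d = y \<or> i = k \<and> d = m"
  by (subst prefix_run) (auto simp: replicate_eq_iff)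

lemma sublist_replicate_run:
  "m \<noteq> y \<Longrightarrow> sublist (c # replicate i y @ [d]) (replicate k y @ [m]) \<longleftrightarrow> c = y \<and> (Suc i < k \<and> d = y \<or> i < k \<and> d = m)"
  by (subst sublist_run) (auto simp: replicate_eq_iff)

lemma sublist_block_Delta:
  assumes "0 < i"
  shows "sublist (x # replicate i (3::nat) @ [y]) (1 # 2 # replicate n 3 @ [1]) \<longleftrightarrow>
    x = 2 \<and> (i < n \<and> y = 3 \<or> i = n \<and> y = 1) \<or> x = 3 \<and> (Suc i < n \<and> y = 3 \<or> i < n \<and> y = 1)"
proof -
  have ne: "(1::nat) \<noteq> 3" by simp
  show ?thesis unfolding sublist_Cons_snoc(1) prefix_snoc_Cons(1) prefix_replicate_run[OF ne] sublist_replicate_run[OF ne]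
    using assms by (auto simp: Cons_eq_replicate)
qed

lemma sublist_block_Zeta:
  assumes "0 < i"
  shows "sublist (x # replicate i (3::nat) @ [y]) (1 # replicate n 3 @ [1]) \<longleftrightarrow>
    x = 1 \<and> (i < n \<and> y = 3 \<or> i = n \<and> y = 1) \<or> x = 3 \<and> (Suc i < n \<and> y = 3 \<or> i < n \<and> y = 1)"
proof -
  have ne: "(1::nat) \<noteq> 3" by simp
  show ?thesis unfolding sublist_Cons_snoc(1) prefix_snoc_Cons(1) prefix_replicate_run[OF ne] sublist_replicate_run[OF ne]
    using assms by (auto simp: Cons_eq_replicate)
qed

lemma sublist_block_short:
  assumes "0 < i"
  shows "\<not> sublist (x # replicate i (3::nat) @ [y]) [1,1]" "\<not> sublist (x # replicate i (3::nat) @ [y]) [1,2,1]"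
  unfolding sublist_Cons_snoc prefix_snoc_Cons
  using assms by (simp_all add: Cons_eq_replicate)

lemma not_run:
  assumes "m \<notin> set w" "\<nexists>i. w = replicate i y"
  shows "prefix (w @ [d]) (replicate k y @ [m]) = False" "sublist (c # w @ [d]) (replicate k y @ [m]) = False"
  unfolding prefix_run[OF assms(1)] sublist_run[OF assms(1)] using assms(2) by blast+

text \<open>These six graphs consist of the two-letter words of the blocks. Here the label
  conditions have content: under beta, for instance, the left letters 2 and 3 have no common
  neighbour, and the label 1 of the image exempts exactly this pair.\<close>

lemma good_tree_initial_Nil:
  assumes v: "S3_valid s" and st: "label_step (kind_left s) l l1" "label_step (kind_right s) r r1"
    and E: "E = {(c,d). \<exists>a\<in>A3. sublist (c # [] @ [d]) (S3_morph s a @ [1])}"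
  shows "good_tree l1 r1 E"
proof -
  have 123: "distinct [1,2,3::nat]" by simp
  have T: "tree_rel F" if "F \<subseteq> A3 \<times> A3" "tree9 ((1,1)\<in>F) ((1,2)\<in>F) ((1,3)\<in>F) ((2,1)\<in>F) ((2,2)\<in>F) ((2,3)\<in>F) ((3,1)\<in>F) ((3,2)\<in>F) ((3,3)\<in>F)" for F
    using tree_rel_iff[OF A3_def 123 A3_def 123 that(1)] that(2) by blast
  note L = label_ok_def share_def
  note S = sublist_Cons_snoc sublist_Cons_snoc[where w = "[]", simplified] prefix_snoc_Cons prefix_snoc_Cons[where w = "[]", simplified]
  show ?thesis
  proof (cases s)
    case Alpha
    have "E = {(1,1),(1,2),(1,3),(2,1),(3,1)}" unfolding E Alpha bex_A3 by (auto simp: S)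
    then show ?thesis unfolding good_tree_def by (intro conjI T) (auto simp: A3_def tree9_def linked9_def L)
  next
    case Beta
    have "E = {(1,1),(1,2),(1,3),(2,1),(3,2)}" unfolding E Beta bex_A3 by (auto simp: S)
    then show ?thesis unfolding good_tree_def using st by (intro conjI T) (auto simp: A3_def tree9_def linked9_def L Beta)
  next
    case Gamma
    have "E = {(1,1),(1,2),(2,1),(2,3),(3,1)}" unfolding E Gamma bex_A3 by (auto simp: S)
    then show ?thesis unfolding good_tree_def using st by (intro conjI T) (auto simp: A3_def tree9_def linked9_def L Gamma)
  next
    case Eta
    have "E = {(1,3),(3,1),(1,2),(2,1),(2,3)}" unfolding E Eta bex_A3 by (auto simp: S)
    then show ?thesis unfolding good_tree_def using st by (intro conjI T) (auto simp: A3_def tree9_def linked9_def L Eta)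
  next
    case (Delta k)
    then obtain j where k: "k = Suc j" using v by (cases k) (auto simp: S3_valid_def)
    have "E = {(1,1),(1,2),(2,3),(3,3),(3,1)}" unfolding E Delta bex_A3 k by (auto simp: S sublist_run[where w = "[]", simplified] prefix_run[where w = "[]", simplified])
    then show ?thesis unfolding good_tree_def using st by (intro conjI T) (auto simp: A3_def tree9_def linked9_def L Delta)
  next
    case (Zeta k)
    then obtain j where k: "k = Suc j" using v by (cases k) (auto simp: S3_valid_def)
    have "E = {(1,2),(1,3),(3,3),(3,1),(2,1)}" unfolding E Zeta bex_A3 k by (auto simp: S sublist_run[where w = "[]", simplified] prefix_run[where w = "[]", simplified])
    then show ?thesis unfolding good_tree_def using st by (intro conjI T) (auto simp: A3_def tree9_def linked9_def L Zeta)
  qed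
qed

lemma good_tree_initial_Alpha:
  assumes w: "1 \<notin> set w" "w \<noteq> []" and E: "E = {(c,d). \<exists>a\<in>A3. sublist (c # w @ [d]) (S3_morph Alpha a @ [1])}"
    and EA: "E \<subseteq> A3 \<times> A3" and ne: "E \<noteq> {}"
  shows "good_tree l r E"
proof -
  have "Domain E \<subseteq> {1}" using w unfolding E bex_A3 by (auto simp: sublist_Cons_snoc prefix_snoc_Cons)
  then show ?thesis by (rule tree_one[OF EA _ ne])
qed

lemma good_tree_initial_Beta:
  assumes w: "1 \<notin> set w" "w \<noteq> []" and E: "E = {(c,d). \<exists>a\<in>A3. sublist (c # w @ [d]) (S3_morph Beta a @ [1])}"
    and EA: "E \<subseteq> A3 \<times> A3" and ne: "E \<noteq> {}"
  shows "good_tree l r E"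
proof -
  \<comment> \<open>Inside the blocks of beta, 3 is followed by 2, and every other nonempty word
    without 1 ends its block.\<close>
  have "Range E \<subseteq> {if w = [3] then 2 else 1}" using w unfolding E bex_A3 by (auto simp: sublist_Cons_snoc prefix_snoc_Cons)
  then show ?thesis by (rule good_tree_right_one[OF EA ne])
qed

lemma good_tree_initial_Gamma:
  assumes w: "1 \<notin> set w" "w \<noteq> []" and E: "E = {(c,d). \<exists>a\<in>A3. sublist (c # w @ [d]) (S3_morph Gamma a @ [1])}"
    and EA: "E \<subseteq> A3 \<times> A3" and ne: "E \<noteq> {}"
  shows "good_tree l r E"
proof -
  have "Domain E \<subseteq> {if w = [3] then 2 else 1}" using w unfolding E bex_A3 by (auto simp: sublist_Cons_snoc prefix_snoc_Cons)
  then show ?thesis by (rule tree_one[OF EA _ ne])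
qed

text \<open>The letter 3 ends both blocks in which it occurs, which fixes its right neighbour; the
  other words start with 2 and are preceded by 1.\<close>

lemma good_tree_initial_Eta:
  assumes w: "1 \<notin> set w" "w \<noteq> []" and E: "E = {(c,d). \<exists>a\<in>A3. sublist (c # w @ [d]) (S3_morph Eta a @ [1])}"
    and EA: "E \<subseteq> A3 \<times> A3" and ne: "E \<noteq> {}"
  shows "good_tree l r E"
proof (cases "w = [3]")
  case True
  have "Range E \<subseteq> {1}" unfolding E bex_A3 True
    by (auto simp: sublist_Cons_snoc[where w = "[3]", simplified] prefix_snoc_Cons[where w = "[3]", simplified] prefix_snoc_Cons[where w = "[]", simplified])
  then show ?thesis by (rule good_tree_right_one[OF EA ne])
next
  case False
  have "Domain E \<subseteq> {1}" using w False unfolding E bex_A3 by (auto simp: sublist_Cons_snoc prefix_snoc_Cons)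
  then show ?thesis by (rule tree_one[OF EA _ ne])
qed

text \<open>A nonempty word without 1 inside a block is a run of 3, or starts with 2 and is preceded
  by 1.\<close>

lemma good_tree_initial_Delta:
  assumes w: "1 \<notin> set w" "w \<noteq> []" and E: "E = {(c,d). \<exists>a\<in>A3. sublist (c # w @ [d]) (S3_morph (Delta k) a @ [1])}"
    and EA: "E \<subseteq> A3 \<times> A3" and ne: "E \<noteq> {}"
  shows "good_tree l r E"
proof -
  have m: "(x,y) \<in> E \<longleftrightarrow> sublist (x # w @ [y]) [1,1] \<or> sublist (x # w @ [y]) (1 # 2 # replicate k 3 @ [1])
      \<or> sublist (x # w @ [y]) (1 # 2 # replicate (Suc k) 3 @ [1])" for x y
    unfolding E mem_Collect_eq case_prod_conv bex_A3 by (simp del: replicate_Suc)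
  show ?thesis
  proof (cases "\<exists>i. w = replicate i 3")
    case True
    then obtain i where i: "w = replicate i 3" by blast
    then have i0: "0 < i" using w(2) by (cases i) auto
    show ?thesis
    proof (rule good_tree_run[where c = 2 and i = i and k = k, OF _ i0 _ ne])
      show "E = {(x,y). x = 2 \<and> y = 3 \<and> i \<le> k \<or> x = 3 \<and> y = 3 \<and> i < k \<or> x = 3 \<and> y = 1 \<and> i \<le> k \<or> x = 2 \<and> y = 1 \<and> (i = k \<or> i = Suc k)}"
      proof (intro set_eqI, clarify)
        fix x y
        show "(x,y) \<in> E \<longleftrightarrow> (x,y) \<in> {(x,y). x = 2 \<and> y = 3 \<and> i \<le> k \<or> x = 3 \<and> y = 3 \<and> i < k \<or> x = 3 \<and> y = 1 \<and> i \<le> k \<or> x = 2 \<and> y = 1 \<and> (i = k \<or> i = Suc k)}"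
          unfolding m i sublist_block_Delta[OF i0] mem_Collect_eq case_prod_conv using sublist_block_short[OF i0]
          by auto
      qed
    qed simp
  next
    case False
    note nr = not_run[OF w(1) False]
    have "x = 1" if "(x,y) \<in> E" for x y
      using that w unfolding m sublist_Cons_snoc prefix_snoc_Cons nr by auto
    then have "Domain E \<subseteq> {1}" by blast
    then show ?thesis by (rule tree_one[OF EA _ ne])
  qed
qed

lemma good_tree_initial_Zeta:
  assumes w: "1 \<notin> set w" "w \<noteq> []" and E: "E = {(c,d). \<exists>a\<in>A3. sublist (c # w @ [d]) (S3_morph (Zeta k) a @ [1])}"
    and EA: "E \<subseteq> A3 \<times> A3" and ne: "E \<noteq> {}"
  shows "good_tree l r E"
proof -
  have m: "(x,y) \<in> E \<longleftrightarrow> sublist (x # w @ [y]) [1,2,1] \<or> sublist (x # w @ [y]) (1 # replicate k 3 @ [1])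
      \<or> sublist (x # w @ [y]) (1 # replicate (Suc k) 3 @ [1])" for x y
    unfolding E mem_Collect_eq case_prod_conv bex_A3 by (simp del: replicate_Suc) blast
  show ?thesis
  proof (cases "\<exists>i. w = replicate i 3")
    case True
    then obtain i where i: "w = replicate i 3" by blast
    then have i0: "0 < i" using w(2) by (cases i) auto
    show ?thesis
    proof (rule good_tree_run[where c = 1 and i = i and k = k, OF _ i0 _ ne])
      show "E = {(x,y). x = 1 \<and> y = 3 \<and> i \<le> k \<or> x = 3 \<and> y = 3 \<and> i < k \<or> x = 3 \<and> y = 1 \<and> i \<le> k \<or> x = 1 \<and> y = 1 \<and> (i = k \<or> i = Suc k)}"
      proof (intro set_eqI, clarify)
        fix x y
        show "(x,y) \<in> E \<longleftrightarrow> (x,y) \<in> {(x,y). x = 1 \<and> y = 3 \<and> i \<le> k \<or> x = 3 \<and> y = 3 \<and> i < k \<or> x = 3 \<and> y = 1 \<and> i \<le> k \<or> x = 1 \<and> y = 1 \<and> (i = k \<or> i = Suc k)}"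
          unfolding m i sublist_block_Zeta[OF i0] mem_Collect_eq case_prod_conv using sublist_block_short[OF i0]
          by auto
      qed
    qed simp
  next
    case False
    note nr = not_run[OF w(1) False]
    have "x = 1" if "(x,y) \<in> E" for x y
      using that w unfolding m sublist_Cons_snoc prefix_snoc_Cons nr by auto
    then have "Domain E \<subseteq> {1}" by blast
    then show ?thesis by (rule tree_one[OF EA _ ne])
  qed
qed

lemma good_tree_initial:
  assumes v: "S3_valid s" and st: "label_step (kind_left s) l l1" "label_step (kind_right s) r r1"
    and w: "1 \<notin> set w" and E: "E = {(c,d). \<exists>a\<in>A3. sublist (c # w @ [d]) (S3_morph s a @ [1])}" and ne: "E \<noteq> {}"
  shows "good_tree l1 r1 E"
proof (cases "w = []")
  case True
  show ?thesis by (rule good_tree_initial_Nil[OF v st]) (simp add: E True)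
next
  case w0: False
  have EA: "E \<subseteq> A3 \<times> A3"
  proof
    fix x assume "x \<in> E"
    then obtain c d a where x: "x = (c,d)" "a \<in> A3" "sublist (c # w @ [d]) (S3_morph s a @ [1])" unfolding E by blast
    have "set (S3_morph s a) \<subseteq> A3" using S3_morph_marked[OF v] x(2) unfolding marked_def by blast
    moreover have "set (c # w @ [d]) \<subseteq> set (S3_morph s a @ [1])" using x(3) by (rule set_mono_sublist)
    ultimately show "x \<in> A3 \<times> A3" using x(1) A3_iff by auto
  qed
  show ?thesis
  proof (cases s)
    case Alpha
    show ?thesis by (rule good_tree_initial_Alpha[OF w w0 E[unfolded Alpha] EA ne])
  next
    case Beta
    show ?thesis by (rule good_tree_initial_Beta[OF w w0 E[unfolded Beta] EA ne])
  next
    case Gamma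
    show ?thesis by (rule good_tree_initial_Gamma[OF w w0 E[unfolded Gamma] EA ne])
  next
    case Eta
    show ?thesis by (rule good_tree_initial_Eta[OF w w0 E[unfolded Eta] EA ne])
  next
    case (Delta k)
    show ?thesis by (rule good_tree_initial_Delta[OF w w0 E[unfolded Delta] EA ne])
  next
    case (Zeta k)
    show ?thesis by (rule good_tree_initial_Zeta[OF w w0 E[unfolded Zeta] EA ne])
  qed
qed

subsection \<open>Shift spaces and their languages\<close>

text \<open>Uniform recurrence, the counterpart of minimality for languages.\<close>

definition unif_rec :: "nat list set \<Rightarrow> bool" where
  "unif_rec L \<longleftrightarrow> (\<forall>w\<in>L. \<exists>K. \<forall>v\<in>L. K \<le> length v \<longrightarrow> sublist w v)"

lemma factor_of_nth: "factor_of w x \<longleftrightarrow> (\<exists>i. \<forall>k<length w. w ! k = x (i + int k))"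
proof -
  have "w = map (\<lambda>k. x (i + int k)) [0..<length w] \<longleftrightarrow> (\<forall>k<length w. w ! k = x (i + int k))" (is "w = ?m \<longleftrightarrow> ?R") for i
  proof
    assume e: "w = ?m"
    show ?R
    proof (intro allI impI)
      fix k assume k: "k < length w"
      have "w ! k = ?m ! k" by (rule arg_cong[OF e])
      then show "w ! k = x (i + int k)" using k by simp
    qed
  next
    assume ?R then show "w = ?m" by (intro nth_equalityI) simp_all
  qed
  then show ?thesis unfolding factor_of_def by blast
qed

definition window :: "(int \<Rightarrow> nat) \<Rightarrow> int \<Rightarrow> nat \<Rightarrow> nat list" where
  "window x i n = map (\<lambda>k. x (i + int k)) [0..<n]"

lemma length_window [simp]: "length (window x i n) = n"
  by (simp add: window_def)

lemma nth_window [simp]: "k < n \<Longrightarrow> window x i n ! k = x (i + int k)"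
  by (simp add: window_def)

lemma factor_window [simp]: "factor_of (window x i n) x"
  unfolding factor_of_nth by auto

lemma factor_ofE:
  assumes "factor_of w x" obtains i where "w = window x i (length w)"
  using assms unfolding factor_of_def window_def by blast

lemma window_append: "window x i (m + n) = window x i m @ window x (i + int m) n"
  by (rule nth_equalityI) (auto simp: nth_append algebra_simps)

lemma factor_sublist:
  assumes "factor_of w x" "sublist v w"
  shows "factor_of v x"
proof -
  obtain i where i: "w = window x i (length w)" using assms(1) by (rule factor_ofE)
  obtain p s where w: "w = p @ v @ s" using assms(2) unfolding sublist_def by blast
  have "v ! k = x (i + int (length p) + int k)" if "k < length v" for k
  proof -
    have "v ! k = w ! (length p + k)" using that unfolding w by (simp add: nth_append)
    also have "\<dots> = x (i + int (length p + k))" using that by (subst i) (simp add: w)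
    finally show ?thesis by (simp add: algebra_simps)
  qed
  then show ?thesis unfolding factor_of_nth by blast
qed

lemma window_sublist_window:
  assumes "i \<le> j" "j + int m \<le> i + int n"
  shows "sublist (window x j m) (window x i n)"
proof -
  define p q where "p = nat (j - i)" and "q = nat (i + int n - j - int m)"
  have n: "n = p + (m + q)" and j: "j = i + int p" using assms unfolding p_def q_def by auto
  have "window x i n = window x i p @ window x j m @ window x (j + int m) q"
    unfolding n window_append j ..
  then show ?thesis unfolding sublist_def by blast
qed

lemma shift_space_lang:
  assumes X: "shift_space A3 X"
  shows "bilang (lang X)"
  unfolding bilang_def
proof (intro conjI ballI allI impI)
  fix w assume "w \<in> lang X"
  then obtain x where x: "x \<in> X" "factor_of w x" unfolding lang_def by blast
  obtain i where i: "w = window x i (length w)" using x(2) by (rule factor_ofE)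
  have A: "x k \<in> A3" for k using X x(1) unfolding shift_space_def by blast
  show "set w \<subseteq> A3" by (subst i) (use A in \<open>auto simp: window_def\<close>)
  have "window x (i - 1) (1 + (length w + 1)) = [x (i - 1)] @ w @ [x (i + int (length w))]"
  proof -
    have "window x (i - 1 + int 1) (length w) = w" using i by simp
    moreover have "window x j 1 = [x j]" for j by (simp add: window_def)
    ultimately show ?thesis unfolding window_append by (simp add: algebra_simps)
  qed
  then have "x (i - 1) # w @ [x (i + int (length w))] \<in> lang X"
    unfolding lang_def using x(1) factor_window[of x "i - 1" "1 + (length w + 1)"] by auto
  then show "\<exists>a b. a # w @ [b] \<in> lang X" by blast
next
  fix v w assume "w \<in> lang X" "sublist v w"
  then show "v \<in> lang X" unfolding lang_def using factor_sublist by blast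
next
  fix a assume "a \<in> A3"
  then obtain x i where "x \<in> X" "x i = a" using X unfolding shift_space_def by blast
  then show "[a] \<in> lang X" unfolding lang_def factor_of_nth by (intro CollectI bexI[of _ x] exI[of _ i]) auto
qed

section \<open>Minimality and uniform recurrence\<close>

lemma shift_invariant_translate:
  assumes "shift_invariant X" "x \<in> X"
  shows "(\<lambda>k. x (k + c)) \<in> X"
proof (induction c rule: int_induct[where k = 0])
  case base
  then show ?case using assms(2) by simp
next
  case (step1 i)
  then have "shift (\<lambda>k. x (k + i)) \<in> X" using assms(1) unfolding shift_invariant_def by blast
  then show ?case by (simp add: shift_def algebra_simps)
next
  case (step2 i)
  then obtain y where y: "y \<in> X" "(\<lambda>k. x (k + i)) = shift y" using assms(1) unfolding shift_invariant_def by blast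
  have "y k = x (k + (i - 1))" for k
    using fun_cong[OF y(2), of "k - 1"] by (simp add: shift_def algebra_simps)
  then have "y = (\<lambda>k. x (k + (i - 1)))" by (rule ext)
  then show ?case using y(1) by simp
qed

text \<open>A closed shift-invariant set is determined by its language: a basic neighbourhood of x
  restricts finitely many coordinates, these lie in a central window, and a point of X containing
  this window can be translated into the neighbourhood.\<close>

lemma closed_lang:
  assumes X: "closed X" "shift_invariant X" and x: "\<And>w. factor_of w x \<Longrightarrow> w \<in> lang X"
  shows "x \<in> X"
proof (rule ccontr)
  assume "x \<notin> X"
  moreover have "openin (product_topology (\<lambda>i::int. euclidean) UNIV) (- X)"
    using X(1) by (simp add: euclidean_product_topology open_Compl)
  ultimately obtain U where U: "x \<in> PiE UNIV U" "finite {i. U i \<noteq> UNIV}" "PiE UNIV U \<subseteq> - X"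
    using product_topology_open_contains_basis[of "\<lambda>i. euclidean" UNIV "- X" x] by auto
  obtain n where n: "\<And>i. i \<in> {i. U i \<noteq> UNIV} \<Longrightarrow> \<bar>i\<bar> \<le> int n"
  proof -
    have "finite ((\<lambda>i. nat \<bar>i\<bar>) ` {i. U i \<noteq> UNIV})" using U(2) by simp
    then obtain n where "\<forall>k\<in>(\<lambda>i. nat \<bar>i\<bar>) ` {i. U i \<noteq> UNIV}. k \<le> n"
      unfolding finite_nat_set_iff_bounded_le by blast
    then show ?thesis by (intro that[of n]) auto
  qed
  \<comment> \<open>The window covers the positions from -n to n.\<close>
  have "window x (- int n) (2 * n + 1) \<in> lang X" using x by simp
  then obtain y where y: "y \<in> X" "factor_of (window x (- int n) (2 * n + 1)) y" unfolding lang_def by blast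
  then obtain j where j: "\<And>k. k < 2 * n + 1 \<Longrightarrow> x (- int n + int k) = y (j + int k)"
    unfolding factor_of_nth by auto
  define z where "z = (\<lambda>k. y (k + (j + int n)))"
  have zX: "z \<in> X" unfolding z_def by (rule shift_invariant_translate[OF X(2) y(1)])
  have "z i \<in> U i" for i
  proof (cases "U i = UNIV")
    case False
    then have "\<bar>i\<bar> \<le> int n" using n by blast
    then have "nat (i + int n) < 2 * n + 1" "int (nat (i + int n)) = i + int n" by linarith+
    then have "x i = z i" using j[of "nat (i + int n)"] unfolding z_def
      by (simp add: algebra_simps)
    then show ?thesis using U(1) by (metis PiE_mem UNIV_I)
  qed simp
  then show False using U(3) zX by auto
qed

text \<open>A single point of Y already contains every word of the language of X, and closedness of
  Y does the rest.\<close>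

lemma minimal_of_unif_rec:
  assumes X: "shift_space A3 X" and u: "unif_rec (lang X)"
  shows "minimal_shift X"
  unfolding minimal_shift_def
proof (intro allI impI)
  fix Y assume Y: "Y \<subseteq> X \<and> closed Y \<and> shift_invariant Y"
  show "Y = {} \<or> Y = X"
  proof (cases "Y = {}")
    case False
    then obtain y where y: "y \<in> Y" by blast
    have "X \<subseteq> Y"
    proof
      fix x assume x: "x \<in> X"
      show "x \<in> Y"
      proof (rule closed_lang)
        fix w assume "factor_of w x"
        then have "w \<in> lang X" using x unfolding lang_def by blast
        then obtain K where K: "\<And>v. v \<in> lang X \<Longrightarrow> K \<le> length v \<Longrightarrow> sublist w v"
          using u unfolding unif_rec_def by blast
        have "window y 0 K \<in> lang X" using y Y factor_window unfolding lang_def by blast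
        from K[OF this] have "sublist w (window y 0 K)" by simp
        then have "factor_of w y" using factor_sublist[OF factor_window] by blast
        then show "w \<in> lang Y" using y unfolding lang_def by blast
      qed (use Y in auto)
    qed
    then show ?thesis using Y by blast
  qed simp
qed

lemma compact_full_shift: "compact {x :: int \<Rightarrow> nat. \<forall>i. x i \<in> A3}"
proof -
  have "compactin (product_topology (\<lambda>i::int. euclidean) UNIV) (PiE UNIV (\<lambda>_. A3))"
    unfolding compactin_PiE by (simp add: A3_def finite_imp_compact)
  then have "compact (PiE UNIV (\<lambda>_::int. A3))" by (simp add: euclidean_product_topology)
  moreover have "PiE UNIV (\<lambda>_::int. A3) = {x. \<forall>i. x i \<in> A3}" by auto
  ultimately show ?thesis by simp
qed

lemma closed_coordinate: "closed {x :: int \<Rightarrow> nat. x i \<noteq> a}"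
proof -
  have "closed ((\<lambda>x :: int \<Rightarrow> nat. x i) -` (- {a}))"
    by (rule closed_vimage) (auto simp: closed_def open_discrete)
  moreover have "(\<lambda>x :: int \<Rightarrow> nat. x i) -` (- {a}) = {x. x i \<noteq> a}" by auto
  ultimately show ?thesis by simp
qed

text \<open>Avoidance of w is split by position: each of these sets is closed, and their
  intersection over all positions can be handled by the finite intersection property.\<close>

definition avoids :: "nat list \<Rightarrow> int \<Rightarrow> (int \<Rightarrow> nat) set" where
  "avoids w i = (\<Union>k\<in>{..<length w}. {x. x (i + int k) \<noteq> w ! k})"

lemma closed_avoids: "closed (avoids w i)"
  unfolding avoids_def by (rule closed_UN) (simp_all add: closed_coordinate)

lemma avoids_iff: "(\<forall>i. x \<in> avoids w i) \<longleftrightarrow> \<not> factor_of w x"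
  unfolding avoids_def factor_of_nth by (simp add: Bex_def eq_commute)

text \<open>If arbitrarily long words avoid w, then by compactness so does some point of X, and the
  points avoiding w form a nonempty proper closed shift-invariant subset.\<close>

lemma unif_rec_of_minimal:
  assumes X: "shift_space A3 X" and m: "minimal_shift X"
  shows "unif_rec (lang X)"
  unfolding unif_rec_def
proof (intro ballI, rule ccontr)
  fix w assume w: "w \<in> lang X" and "\<not> (\<exists>K. \<forall>v\<in>lang X. K \<le> length v \<longrightarrow> sublist w v)"
  then have bad: "\<exists>v\<in>lang X. K \<le> length v \<and> \<not> sublist w v" for K by blast
  have XA: "X \<subseteq> {x. \<forall>i. x i \<in> A3}" and cl: "closed X" and inv: "shift_invariant X"
    using X unfolding shift_space_def by auto
  have cX: "compact X" using compact_full_shift cl XA by (metis compact_Int_closed inf.absorb2)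
  define Y where "Y = X \<inter> (\<Inter>i. avoids w i)"
  have Yeq: "Y = {x\<in>X. \<not> factor_of w x}" unfolding Y_def using avoids_iff by blast
  have "Y \<noteq> {}" unfolding Y_def
  proof (rule compact_imp_fip_image[OF cX closed_avoids])
    fix I :: "int set" assume I: "finite I"
    obtain n where n: "\<And>i. i \<in> I \<Longrightarrow> \<bar>i\<bar> \<le> int n"
    proof -
      have "finite ((\<lambda>i. nat \<bar>i\<bar>) ` I)" using I by simp
      then obtain n where "\<forall>k\<in>(\<lambda>i. nat \<bar>i\<bar>) ` I. k \<le> n"
        unfolding finite_nat_set_iff_bounded_le by blast
      then show ?thesis by (intro that[of n]) auto
    qed
    \<comment> \<open>This length leaves room for an occurrence of w at each position between -n and
      n once the middle of v is moved to the origin.\<close>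
    obtain v where v: "v \<in> lang X" "2 * n + 1 + length w \<le> length v" "\<not> sublist w v" using bad by blast
    then obtain x where x: "x \<in> X" "factor_of v x" unfolding lang_def by blast
    obtain j where j: "v = window x j (length v)" using x(2) by (rule factor_ofE)
    define z where "z = (\<lambda>k. x (k + (j + int n)))"
    have zX: "z \<in> X" unfolding z_def by (rule shift_invariant_translate[OF inv x(1)])
    have "z \<in> avoids w i" if "i \<in> I" for i
    proof (rule ccontr)
      assume "z \<notin> avoids w i"
      then have "\<And>k. k < length w \<Longrightarrow> w ! k = x (i + (j + int n) + int k)"
        unfolding avoids_def z_def by (auto simp: algebra_simps)
      then have "w = window x (i + (j + int n)) (length w)" by (intro nth_equalityI) auto
      moreover have "sublist (window x (i + (j + int n)) (length w)) (window x j (length v))"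
        by (rule window_sublist_window) (use n[OF that] v(2) in auto)
      ultimately show False using v(3) j by metis
    qed
    then show "X \<inter> (\<Inter>i\<in>I. avoids w i) \<noteq> {}" using zX by blast
  qed
  moreover have "closed Y" unfolding Y_def using cl closed_avoids by auto
  moreover have "shift_invariant Y"
  proof -
    have f: "factor_of w (\<lambda>k. x (k + c)) \<Longrightarrow> factor_of w x" for x c
      unfolding factor_of_nth by (metis add.assoc add.commute)
    have t: "(\<lambda>k. x (k + c)) \<in> Y" if "x \<in> Y" for x c
      using that f shift_invariant_translate[OF inv] unfolding Yeq by blast
    have "x \<in> shift ` Y" if "x \<in> Y" for x
    proof -
      have "x = shift (\<lambda>k. x (k + - 1))" by (auto simp: shift_def)
      then show ?thesis using t[OF that, of "- 1"] by blast
    qed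
    moreover have "shift x \<in> Y" if "x \<in> Y" for x using t[OF that, of 1] unfolding shift_def .
    ultimately show ?thesis unfolding shift_invariant_def by blast
  qed
  moreover have "Y \<noteq> X" using w unfolding Yeq lang_def by blast
  moreover have "Y \<subseteq> X" unfolding Y_def by blast
  ultimately show False using m[unfolded minimal_shift_def, rule_format, of Y] by blast
qed

section \<open>Extension graphs as trees in the sense of graph theory\<close>

definition dendric_lang :: "nat list set \<Rightarrow> bool" where
  "dendric_lang L \<longleftrightarrow> (\<forall>w\<in>L. tree_rel (exts L w))"

lemma share_trans3:
  assumes E: "E \<subseteq> A3 \<times> A3" and s: "share E a b" "share E b c" "share E c d"
  shows "share E a d \<or> (\<exists>e. share E a e \<and> share E e d)"
proof -
  have "a \<in> A3" "b \<in> A3" "c \<in> A3" "d \<in> A3" using E s unfolding share_def by blast+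
  from A3_four[OF this] show ?thesis using s share_sym by metis
qed

context
  fixes E :: "(nat \<times> nat) set" and V :: "(nat + nat) set" and adj
  assumes E: "E \<subseteq> A3 \<times> A3" and V: "V = Inl ` Domain E \<union> Inr ` Range E"
    and adj: "\<And>u v. adj u v \<longleftrightarrow> (\<exists>a b. ((u = Inl a \<and> v = Inr b) \<or> (u = Inr b \<and> v = Inl a)) \<and> (a,b) \<in> E)"
begin

lemma adj_simps: "adj (Inl a) (Inr b) \<longleftrightarrow> (a,b) \<in> E" "adj (Inr b) (Inl a) \<longleftrightarrow> (a,b) \<in> E"
  "\<not> adj (Inl a) (Inl a')" "\<not> adj (Inr b) (Inr b')"
  unfolding adj by auto

lemma connected_imp_linked:
  assumes c: "graph_connected V adj"
  shows "linked E"
  unfolding linked_def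
proof (intro ballI)
  fix a b assume ab: "a \<in> Domain E" "b \<in> Domain E"
  \<comment> \<open>Two steps through common neighbours already reach everything: a third one can be
    cut short because there are only three letters.\<close>
  define near where "near c = (share E a c \<or> (\<exists>e. share E a e \<and> share E e c))" for c
  have step: "near d" if "near c" "share E c d" for c d
  proof -
    from that(1)[unfolded near_def] show ?thesis
    proof
      assume "share E a c" then show ?thesis using that(2) unfolding near_def by blast
    next
      assume "\<exists>e. share E a e \<and> share E e c"
      then show ?thesis using share_trans3[OF E _ _ that(2)] unfolding near_def by blast
    qed
  qed
  have "(\<lambda>x y. x \<in> V \<and> y \<in> V \<and> adj x y)\<^sup>*\<^sup>* (Inl a) (Inl b)"
    using c ab unfolding graph_connected_def V by blast
  \<comment> \<open>The invariant along a walk: a left vertex is near a, and a right vertex has a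
    neighbour near a.\<close>
  then have "case Inl b of Inl c \<Rightarrow> near c | Inr d \<Rightarrow> \<exists>c. near c \<and> (c,d) \<in> E"
  proof (induction rule: rtranclp_induct)
    case base
    then show ?case using share_refl[OF ab(1)] unfolding near_def by simp
  next
    case (step y z)
    have yz: "adj y z" using step.hyps by blast
    show ?case
    proof (cases y)
      case (Inl c)
      then obtain d where z: "z = Inr d" "(c,d) \<in> E" using yz unfolding adj by blast
      then show ?thesis using step.IH Inl by auto
    next
      case (Inr d)
      then obtain c where z: "z = Inl c" "(c,d) \<in> E" using yz unfolding adj by blast
      obtain c' where c': "near c'" "(c',d) \<in> E" using step.IH Inr by auto
      have "share E c' c" using z(2) c'(2) unfolding share_def by blast
      then show ?thesis using \<open>\<And>d c. near c \<Longrightarrow> share E c d \<Longrightarrow> near d\<close> c'(1) z(1) by simp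
    qed
  qed
  then show "share E a b \<or> (\<exists>c. share E a c \<and> share E c b)" unfolding near_def by simp
qed

lemma linked_imp_connected:
  assumes l: "linked E"
  shows "graph_connected V adj"
proof -
  let ?R = "\<lambda>x y. x \<in> V \<and> y \<in> V \<and> adj x y"
  have r: "?R\<^sup>*\<^sup>* (Inl a) (Inr b)" "?R\<^sup>*\<^sup>* (Inr b) (Inl a)" if "(a,b) \<in> E" for a b
    using that adj_simps unfolding V by (intro r_into_rtranclp conjI; blast)+
  have sh: "?R\<^sup>*\<^sup>* (Inl a) (Inl b)" if "share E a b" for a b
    using that r unfolding share_def by (meson rtranclp_trans)
  have ll: "?R\<^sup>*\<^sup>* (Inl a) (Inl b)" if "a \<in> Domain E" "b \<in> Domain E" for a b
    using l that sh unfolding linked_def by (meson rtranclp_trans)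
  have ex: "\<exists>a\<in>Domain E. ?R\<^sup>*\<^sup>* u (Inl a) \<and> ?R\<^sup>*\<^sup>* (Inl a) u" if "u \<in> V" for u
  proof -
    from that consider a where "u = Inl a" "a \<in> Domain E" | b where "u = Inr b" "b \<in> Range E" unfolding V by blast
    then show ?thesis
    proof cases
      case (2 b)
      then obtain a where "(a,b) \<in> E" by blast
      then show ?thesis using r 2 by blast
    qed blast
  qed
  show ?thesis unfolding graph_connected_def
  proof (intro ballI)
    fix u v assume "u \<in> V" "v \<in> V"
    then obtain a b where "a \<in> Domain E" "?R\<^sup>*\<^sup>* u (Inl a)" "b \<in> Domain E" "?R\<^sup>*\<^sup>* (Inl b) v" using ex by meson
    then show "?R\<^sup>*\<^sup>* u v" using ll[of a b] by (meson rtranclp_trans)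
  qed
qed

lemma cycle4: 
  assumes "\<not> no_C4 E" shows "graph_has_cycle V adj"
proof -
  obtain a b c d where *: "(a,c) \<in> E" "(a,d) \<in> E" "(b,c) \<in> E" "(b,d) \<in> E" "a \<noteq> b" "c \<noteq> d"
    using assms unfolding no_C4_def by blast
  have "set [Inl a, Inr c, Inl b, Inr d] \<subseteq> V" using * unfolding V by auto
  moreover have "adj ([Inl a, Inr c, Inl b, Inr d] ! i) ([Inl a, Inr c, Inl b, Inr d] ! ((i + 1) mod 4))" if "i < 4" for i
  proof -
    have "i = 0 \<or> i = 1 \<or> i = 2 \<or> i = 3" using that by linarith
    then show ?thesis by (elim disjE) (simp_all add: * adj_simps)
  qed
  moreover have "distinct [Inl a, Inr c, Inl b, Inr d]" using * by simp
  ultimately show ?thesis unfolding graph_has_cycle_def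
    by (intro exI[of _ "[Inl a, Inr c, Inl b, Inr d]"]) simp
qed

lemma cycle6: 
  assumes "\<not> no_C6 E" shows "graph_has_cycle V adj"
proof -
  obtain a1 a2 a3 b1 b2 b3 where *: "(a1,b1) \<in> E" "(a2,b1) \<in> E" "(a2,b2) \<in> E" "(a3,b2) \<in> E" "(a3,b3) \<in> E" "(a1,b3) \<in> E"
     "distinct [a1,a2,a3]" "distinct [b1,b2,b3]"
    using assms unfolding no_C6_def by blast
  have "set [Inl a1, Inr b1, Inl a2, Inr b2, Inl a3, Inr b3] \<subseteq> V" using * unfolding V by auto
  moreover have "adj ([Inl a1, Inr b1, Inl a2, Inr b2, Inl a3, Inr b3] ! i) ([Inl a1, Inr b1, Inl a2, Inr b2, Inl a3, Inr b3] ! ((i + 1) mod 6))" if "i < 6" for i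
  proof -
    have "i = 0 \<or> i = 1 \<or> i = 2 \<or> i = 3 \<or> i = 4 \<or> i = 5" using that by linarith
    then show ?thesis by (elim disjE) (simp_all add: * adj_simps)
  qed
  moreover have "distinct [Inl a1, Inr b1, Inl a2, Inr b2, Inl a3, Inr b3]" using * by simp
  ultimately show ?thesis unfolding graph_has_cycle_def
    by (intro exI[of _ "[Inl a1, Inr b1, Inl a2, Inr b2, Inl a3, Inr b3]"]) simp
qed

lemma card_V: "card V \<le> 6" "finite V"
proof -
  have V6: "V \<subseteq> set [Inl 1, Inl 2, Inl 3, Inr 1, Inr 2, Inr 3]" using E unfolding V A3_def by auto
  show "card V \<le> 6" using card_mono[OF _ V6] card_length[of "[Inl 1, Inl 2, Inl 3, Inr 1, Inr 2, Inr 3] :: (nat + nat) list"] by simp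
  show "finite V" using finite_subset[OF V6] by simp
qed

text \<open>At most six vertices leave the lengths 3 to 6, and odd lengths are impossible because
  each edge changes sides.\<close>

lemma cycle_imp:
  assumes "graph_has_cycle V adj"
  shows "\<not> no_C4 E \<or> \<not> no_C6 E"
proof -
  obtain vs where vs: "length vs \<ge> 3" "distinct vs" "set vs \<subseteq> V" 
    and ad: "\<And>i. i < length vs \<Longrightarrow> adj (vs ! i) (vs ! ((i + 1) mod length vs))"
    using assms unfolding graph_has_cycle_def by blast
  have "length vs \<le> 6" using card_V(1) distinct_card[OF vs(2)] card_mono[OF card_V(2) vs(3)] by linarith
  then have "length vs = 3 \<or> length vs = 4 \<or> length vs = 5 \<or> length vs = 6" using vs(1) by linarith
  then show ?thesis
  proof (elim disjE)
    assume l: "length vs = 3"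
    have "adj (vs ! 0) (vs ! 1)" "adj (vs ! 1) (vs ! 2)" "adj (vs ! 2) (vs ! 0)"
      using ad[of 0] ad[of 1] ad[of 2] by (simp_all add: l flip: numeral_2_eq_2)
    then show ?thesis by (cases "vs ! 0"; cases "vs ! 1"; cases "vs ! 2") (auto simp: adj_simps)
  next
    assume l: "length vs = 5"
    have "adj (vs ! 0) (vs ! 1)" "adj (vs ! 1) (vs ! 2)" "adj (vs ! 2) (vs ! 3)" "adj (vs ! 3) (vs ! 4)" "adj (vs ! 4) (vs ! 0)"
      using ad[of 0] ad[of 1] ad[of 2] ad[of 3] ad[of 4] by (simp_all add: l flip: numeral_2_eq_2)
    then show ?thesis by (cases "vs ! 0"; cases "vs ! 1"; cases "vs ! 2"; cases "vs ! 3"; cases "vs ! 4") (auto simp: adj_simps)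
  next
    assume l: "length vs = 4"
    have a: "adj (vs ! 0) (vs ! 1)" "adj (vs ! 1) (vs ! 2)" "adj (vs ! 2) (vs ! 3)" "adj (vs ! 3) (vs ! 0)"
      using ad[of 0] ad[of 1] ad[of 2] ad[of 3] by (simp_all add: l flip: numeral_2_eq_2)
    have d: "vs ! 0 \<noteq> vs ! 2" "vs ! 1 \<noteq> vs ! 3" using vs(2) l by (simp_all add: nth_eq_iff_index_eq)
    show ?thesis unfolding no_C4_def using a d
      by (cases "vs ! 0"; cases "vs ! 1"; cases "vs ! 2"; cases "vs ! 3") (auto simp: adj_simps; metis)+
  next
    assume l: "length vs = 6"
    have a: "adj (vs ! 0) (vs ! 1)" "adj (vs ! 1) (vs ! 2)" "adj (vs ! 2) (vs ! 3)" "adj (vs ! 3) (vs ! 4)" "adj (vs ! 4) (vs ! 5)" "adj (vs ! 5) (vs ! 0)"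
      using ad[of 0] ad[of 1] ad[of 2] ad[of 3] ad[of 4] ad[of 5] by (simp_all add: l flip: numeral_2_eq_2)
    have d: "vs ! 0 \<noteq> vs ! 2" "vs ! 0 \<noteq> vs ! 4" "vs ! 2 \<noteq> vs ! 4" "vs ! 1 \<noteq> vs ! 3" "vs ! 1 \<noteq> vs ! 5" "vs ! 3 \<noteq> vs ! 5"
      using vs(2) l by (simp_all add: nth_eq_iff_index_eq)
    have key: "\<not> no_C6 E" if "(a1,b1) \<in> E" "(a2,b1) \<in> E" "(a2,b2) \<in> E" "(a3,b2) \<in> E" "(a3,b3) \<in> E" "(a1,b3) \<in> E"
      "a1 \<noteq> a2" "a1 \<noteq> a3" "a2 \<noteq> a3" "b1 \<noteq> b2" "b1 \<noteq> b3" "b2 \<noteq> b3" for a1 a2 a3 b1 b2 b3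
    proof
      assume "no_C6 E"
      then show False
        unfolding no_C6_def using that(1-6) by (elim allE[of _ a1] allE[of _ a2] allE[of _ a3] allE[of _ b1] allE[of _ b2] allE[of _ b3]) (simp add: that)
    qed
    show ?thesis
    proof (cases "vs ! 0")
      case (Inl a1)
      then obtain b1 where 1: "vs ! 1 = Inr b1" "(a1,b1) \<in> E" using a(1) unfolding adj by auto
      then obtain a2 where 2: "vs ! 2 = Inl a2" "(a2,b1) \<in> E" using a(2) unfolding adj by auto
      then obtain b2 where 3: "vs ! 3 = Inr b2" "(a2,b2) \<in> E" using a(3) unfolding adj by auto
      then obtain a3 where 4: "vs ! 4 = Inl a3" "(a3,b2) \<in> E" using a(4) unfolding adj by auto
      then obtain b3 where 5: "vs ! 5 = Inr b3" "(a3,b3) \<in> E" using a(5) unfolding adj by auto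
      have 6: "(a1,b3) \<in> E" using a(6) 5(1) Inl adj_simps by simp
      show ?thesis using key[OF 1(2) 2(2) 3(2) 4(2) 5(2) 6] d 1(1) 2(1) 3(1) 4(1) 5(1) Inl by simp
    next
      case (Inr b0)
      then obtain a1 where 1: "vs ! 1 = Inl a1" "(a1,b0) \<in> E" using a(1) unfolding adj by auto
      then obtain b1 where 2: "vs ! 2 = Inr b1" "(a1,b1) \<in> E" using a(2) unfolding adj by auto
      then obtain a2 where 3: "vs ! 3 = Inl a2" "(a2,b1) \<in> E" using a(3) unfolding adj by auto
      then obtain b2 where 4: "vs ! 4 = Inr b2" "(a2,b2) \<in> E" using a(4) unfolding adj by auto
      then obtain a3 where 5: "vs ! 5 = Inl a3" "(a3,b2) \<in> E" using a(5) unfolding adj by auto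
      have 6: "(a3,b0) \<in> E" using a(6) 5(1) Inr adj_simps by simp
      show ?thesis using key[OF 2(2) 3(2) 4(2) 5(2) 6 1(2)] d 1(1) 2(1) 3(1) 4(1) 5(1) Inr by simp
    qed
  qed
qed

lemma graph_tree_iff: "graph_tree V adj \<longleftrightarrow> tree_rel E"
proof -
  have "V \<noteq> {} \<longleftrightarrow> E \<noteq> {}" unfolding V by auto
  then show ?thesis unfolding graph_tree_def tree_rel_def
    using connected_imp_linked linked_imp_connected linked_converse[OF E] cycle4 cycle6 cycle_imp by blast
qed

end

lemma dendric_iff:
  assumes X: "shift_space A3 X"
  shows "dendric X \<longleftrightarrow> dendric_lang (lang X)"
proof -
  note L = shift_space_lang[OF X]
  have "graph_tree (ext_vertices X w) (ext_adj X w) \<longleftrightarrow> tree_rel (exts (lang X) w)" for w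
  proof (rule graph_tree_iff[OF exts_subset[OF L]])
    \<comment> \<open>One-sided extensions are the ends of edges, since every word of the language
      extends further.\<close>
    have "a # w \<in> lang X \<longleftrightarrow> a \<in> Domain (exts (lang X) w)" for a
      using extend_right[OF L, of "a # w"] bilang_prefix[OF L, of "a # w"] unfolding exts_def by auto
    moreover have "w @ [b] \<in> lang X \<longleftrightarrow> b \<in> Range (exts (lang X) w)" for b
      using extend_left[OF L, of "w @ [b]"] bilang_tl[OF L, of _ "w @ [b]"] unfolding exts_def by auto
    ultimately show "ext_vertices X w = Inl ` Domain (exts (lang X) w) \<union> Inr ` Range (exts (lang X) w)"
      unfolding ext_vertices_def by simp
    show "ext_adj X w u v \<longleftrightarrow> (\<exists>a b. ((u = Inl a \<and> v = Inr b) \<or> (u = Inr b \<and> v = Inl a)) \<and> (a,b) \<in> exts (lang X) w)" for u v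
      unfolding ext_adj_def exts_def by simp
  qed
  then show ?thesis unfolding dendric_def dendric_lang_def by blast
qed

subsection \<open>From paths to minimal dendric shifts\<close>

lemma Sigma3_A3: "p \<in> Sigma3 \<longleftrightarrow> p permutes A3"
  by (simp add: Sigma3_def A3_def)

lemma Sigma3D:
  assumes "p \<in> Sigma3"
  shows "p a \<in> A3 \<longleftrightarrow> a \<in> A3" "p 0 = 0" "inj p" "p (inv p a) = a" "inv p (p a) = a" "inv p \<in> Sigma3"
proof -
  have p: "p permutes A3" using assms Sigma3_A3 by simp
  show "p a \<in> A3 \<longleftrightarrow> a \<in> A3" using permutes_in_image[OF p] .
  show "p 0 = 0" using permutes_not_in[OF p] by (simp add: A3_def)
  show "inj p" using permutes_inj[OF p] .
  show "p (inv p a) = a" "inv p (p a) = a" using permutes_inverses[OF p] by auto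
  show "inv p \<in> Sigma3" using permutes_inv[OF p] Sigma3_A3 by simp
qed

lemma Sigma3_labels: "p \<in> Sigma3 \<Longrightarrow> p l \<in> {0} \<union> A3 \<longleftrightarrow> l \<in> {0} \<union> A3"
  using Sigma3D[of p] by (metis Un_iff insert_iff empty_iff)

lemma map_inv:
  assumes "p \<in> Sigma3"
  shows "map p (map (inv p) w) = w" "map (inv p) (map p w) = w"
  using Sigma3D(4,5)[OF assms] by (simp_all add: map_idI)

lemma sublist_map: "sublist w (map p y) \<longleftrightarrow> (\<exists>x. w = map p x \<and> sublist x y)"
proof
  assume "sublist w (map p y)"
  then obtain a b where "map p y = a @ w @ b" unfolding sublist_def by blast
  then obtain y1 vs where 1: "y = y1 @ vs" "w @ b = map p vs" using iffD1[OF map_eq_append_conv] by metis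
  obtain y2 y3 where "vs = y2 @ y3" "w = map p y2" using iffD1[OF map_eq_append_conv 1(2)[symmetric]] by metis
  then have "\<exists>y1 y2 y3. y = y1 @ y2 @ y3 \<and> w = map p y2" using 1(1) by blast
  then obtain y1 y2 y3 where "y = y1 @ y2 @ y3" "w = map p y2" by blast
  then show "\<exists>x. w = map p x \<and> sublist x y" unfolding sublist_def by blast
next
  assume "\<exists>x. w = map p x \<and> sublist x y"
  then show "sublist w (map p y)" unfolding sublist_def by (metis map_append)
qed

definition permute_lang :: "(nat \<Rightarrow> nat) \<Rightarrow> nat list set \<Rightarrow> nat list set" where
  "permute_lang p L = map p ` L"

lemma permute_inv:
  assumes "p \<in> Sigma3"
  shows "permute_lang p (permute_lang (inv p) L) = L" "permute_lang (inv p) (permute_lang p L) = L"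
  unfolding permute_lang_def image_image map_inv[OF assms] by simp_all

lemma map_in_permute: "p \<in> Sigma3 \<Longrightarrow> map p w \<in> permute_lang p L \<longleftrightarrow> w \<in> L"
  unfolding permute_lang_def using Sigma3D(3) by (metis inj_image_mem_iff inj_mapI)

lemma permute_bilang:
  assumes p: "p \<in> Sigma3" and L: "bilang L"
  shows "bilang (permute_lang p L)"
  unfolding bilang_def
proof (intro conjI ballI allI impI)
  fix w assume "w \<in> permute_lang p L"
  then obtain u where u: "w = map p u" "u \<in> L" unfolding permute_lang_def by blast
  show "set w \<subseteq> A3" using bilangD(1)[OF L u(2)] Sigma3D(1)[OF p] u(1) by auto
  obtain a b where "a # u @ [b] \<in> L" using bilangD(3)[OF L u(2)] by blast
  then have "map p (a # u @ [b]) \<in> permute_lang p L" using map_in_permute[OF p] by blast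
  then show "\<exists>a b. a # w @ [b] \<in> permute_lang p L" using u(1) by auto
next
  fix v w assume "w \<in> permute_lang p L" "sublist v w"
  then show "v \<in> permute_lang p L" unfolding permute_lang_def using sublist_map bilangD(2)[OF L] by blast
next
  fix a assume "a \<in> A3"
  then have "[inv p a] \<in> L" using bilangD(4)[OF L] Sigma3D(1)[OF Sigma3D(6)[OF p]] by blast
  then have "map p [inv p a] \<in> permute_lang p L" using map_in_permute[OF p] by blast
  then show "[a] \<in> permute_lang p L" using Sigma3D(4)[OF p] by simp
qed

lemma exts_permute:
  assumes p: "p \<in> Sigma3"
  shows "(a,b) \<in> exts (permute_lang p L) (map p w) \<longleftrightarrow> (inv p a, inv p b) \<in> exts L w"
proof -
  have "a # map p w @ [b] = map p (inv p a # w @ [inv p b])" using Sigma3D(4)[OF p] by simp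
  then have "a # map p w @ [b] \<in> permute_lang p L \<longleftrightarrow> inv p a # w @ [inv p b] \<in> L" using map_in_permute[OF p] by metis
  then show ?thesis unfolding exts_def by simp
qed

lemma share_permute:
  assumes p: "p \<in> Sigma3" and E: "\<And>a b. (a,b) \<in> E' \<longleftrightarrow> (inv p a, inv p b) \<in> E"
  shows "share E' a b \<longleftrightarrow> share E (inv p a) (inv p b)"
  unfolding share_def E using Sigma3D(5)[OF p] by metis

lemma linked_permute:
  assumes p: "p \<in> Sigma3" and E: "\<And>a b. (a,b) \<in> E' \<longleftrightarrow> (inv p a, inv p b) \<in> E" and l: "linked E"
  shows "linked E'"
  unfolding linked_def
proof (intro ballI)
  fix a b assume "a \<in> Domain E'" "b \<in> Domain E'"
  then have "inv p a \<in> Domain E" "inv p b \<in> Domain E" using E by blast+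
  then have "share E (inv p a) (inv p b) \<or> (\<exists>c. share E (inv p a) c \<and> share E c (inv p b))"
    using l unfolding linked_def by blast
  then show "share E' a b \<or> (\<exists>c. share E' a c \<and> share E' c b)"
    unfolding share_permute[OF p E] using Sigma3D(5)[OF p] by metis
qed

lemma tree_rel_permute:
  assumes p: "p \<in> Sigma3" and E: "\<And>a b. (a,b) \<in> E' \<longleftrightarrow> (inv p a, inv p b) \<in> E" and t: "tree_rel E"
  shows "tree_rel E'"
proof -
  have Ec: "(a,b) \<in> E'\<inverse> \<longleftrightarrow> (inv p a, inv p b) \<in> E\<inverse>" for a b using E by auto
  have ij: "inv p a = inv p b \<longleftrightarrow> a = b" for a b using Sigma3D(4)[OF p] by metis
  have t: "E \<noteq> {}" "linked E" "linked (E\<inverse>)" "no_C4 E" "no_C6 E"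
    using t unfolding tree_rel_def by blast+
  have 1: "E' \<noteq> {}" using t(1) E Sigma3D(5)[OF p] by (metis equals0I ex_in_conv surj_pair)
  have 2: "no_C4 E'" unfolding no_C4_def E using t(4) ij unfolding no_C4_def by blast
  have 3: "no_C6 E'" unfolding no_C6_def E
  proof (intro allI impI notI)
    fix a1 a2 a3 b1 b2 b3
    assume e: "(inv p a1, inv p b1) \<in> E" "(inv p a2, inv p b1) \<in> E" "(inv p a2, inv p b2) \<in> E"
      "(inv p a3, inv p b2) \<in> E" "(inv p a3, inv p b3) \<in> E" "(inv p a1, inv p b3) \<in> E"
      and d: "distinct [a1,a2,a3] \<and> distinct [b1,b2,b3]"
    have "distinct [inv p a1,inv p a2,inv p a3] \<and> distinct [inv p b1,inv p b2,inv p b3]"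
      using d by (simp add: ij)
    then show False using t(5) e unfolding no_C6_def by blast
  qed
  show ?thesis unfolding tree_rel_def
    using 1 2 3 linked_permute[OF p E t(2)] linked_permute[OF p Ec t(3)] by blast
qed

lemma good_tree_permute:
  assumes p: "p \<in> Sigma3" and E: "\<And>a b. (a,b) \<in> E' \<longleftrightarrow> (inv p a, inv p b) \<in> E" and g: "good_tree (inv p l) (inv p r) E"
  shows "good_tree l r E'"
proof -
  have Ec: "(a,b) \<in> E'\<inverse> \<longleftrightarrow> (inv p a, inv p b) \<in> E\<inverse>" for a b using E by auto
  \<comment> \<open>Renamings fix 0, so the label that exempts no pair is preserved.\<close>
  have z: "inv p a = 0 \<longleftrightarrow> a = 0" for a using Sigma3D(2,4)[OF p] Sigma3D(2)[OF Sigma3D(6)[OF p]] by metis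
  have lk: "label_ok l F'" if F: "\<And>a b. (a,b) \<in> F' \<longleftrightarrow> (inv p a, inv p b) \<in> F" "label_ok (inv p l) F" for F F' l
    unfolding label_ok_def
  proof (intro ballI impI)
    fix a b assume ab: "a \<in> Domain F'" "b \<in> Domain F'" "l = 0 \<or> l = a \<or> l = b"
    have "inv p a \<in> Domain F" "inv p b \<in> Domain F" using ab(1,2) F(1) by blast+
    moreover have "inv p l = 0 \<or> inv p l = inv p a \<or> inv p l = inv p b" using ab(3) z by auto
    ultimately show "share F' a b" using F(2) unfolding share_permute[OF p F(1)] label_ok_def by blast
  qed
  show ?thesis
    using g tree_rel_permute[OF p E] lk[OF E] lk[OF Ec] unfolding good_tree_def by blast
qed

lemma morph_word_perm: "morph_word (perm_morph p) w = map p w"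
  by (induction w) (auto simp: perm_morph_def)

lemma morph_word_comp: "morph_word (morph_comp f g) w = morph_word f (morph_word g w)"
  by (induction w) (auto simp: morph_comp_def)

lemma image_lang_comp: "image_lang (morph_comp (perm_morph p) (morph_comp f (perm_morph q))) L = permute_lang p (image_lang f (permute_lang q L))"
  unfolding image_lang_def morph_word_comp morph_word_perm sublist_map permute_lang_def by blast

lemma image_lang_perm:
  assumes "p \<in> Sigma3" "bilang L"
  shows "image_lang (perm_morph p) L = permute_lang p L"
proof -
  have "sublist x u \<Longrightarrow> u \<in> L \<Longrightarrow> x \<in> L" for x u using bilangD(2)[OF assms(2)] by blast
  then show ?thesis unfolding image_lang_def morph_word_perm sublist_map permute_lang_def by blast
qed

lemma Gvertices_labels: "v \<in> Gvertices \<Longrightarrow> fst v \<in> {0} \<union> A3 \<and> snd v \<in> {0} \<union> A3"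
  unfolding Gvertices_def A3_def by auto

text \<open>One step of the induction along a path. After undoing the outer renaming, a word
  containing the marker is traced back to a shorter word one level up, where the hypothesis applies;
  a word without marker is settled by the blocks alone.\<close>

lemma good_tree_edge:
  assumes e: "G_edge v f v'" and L': "bilang L'" and L: "bilang L" "L = image_lang f L'" and w: "w \<in> L"
    and g: "\<And>u. u \<in> L' \<Longrightarrow> length u < length w \<Longrightarrow> good_tree (fst v') (snd v') (exts L' u)"
  shows "good_tree (fst v) (snd v) (exts L w)"
proof -
  obtain p s p' where p: "p \<in> Sigma3" "p' \<in> Sigma3" "S3_valid s" "v' \<in> Gvertices"
    and f: "f = morph_comp (perm_morph p) (morph_comp (S3_morph s) (perm_morph p'))"
    and im: "S3_image s (p' (fst v'), p' (snd v')) = Some (inv p (fst v), inv p (snd v))"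
    using e unfolding G_edge_def by blast
  note st = im[unfolded S3_image_step]
  define M' where "M' = permute_lang p' L'"
  define M where "M = image_lang (S3_morph s) M'"
  have M': "bilang M'" unfolding M'_def by (rule permute_bilang[OF p(2) L'])
  have LM: "L = permute_lang p M" unfolding L(2) f image_lang_comp M_def M'_def ..
  have M: "bilang M" using permute_bilang[OF Sigma3D(6)[OF p(1)] L(1)] unfolding LM permute_inv[OF p(1)] .
  obtain x where x: "w = map p x" "x \<in> M" using w unfolding LM permute_lang_def by blast
  interpret marked_image 1 "S3_morph s" M' M
    by unfold_locales (use S3_morph_marked[OF p(3)] M' M_def in auto)
  have lr: "p' (fst v') \<in> {0} \<union> A3" "p' (snd v') \<in> {0} \<union> A3"
    using Gvertices_labels[OF p(4)] Sigma3_labels[OF p(2)] by blast+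
  have gx: "good_tree (inv p (fst v)) (inv p (snd v)) (exts M x)"
  proof (cases "1 \<in> set x")
    case True
    show ?thesis
    proof (rule good_tree_image[OF left_rels_S3[OF p(3)] _ right_rels_S3[OF p(3)] _ lr x(2) True M])
      show "label_step (kind_left s) (p' (fst v')) (inv p (fst v))" "label_step (kind_right s) (p' (snd v')) (inv p (snd v))"
        using st by auto
      fix u assume u: "u \<in> M'" "length u < length x"
      then obtain y where y: "u = map p' y" "y \<in> L'" unfolding M'_def permute_lang_def by blast
      have "good_tree (inv p' (p' (fst v'))) (inv p' (p' (snd v'))) (exts L' y)"
        unfolding Sigma3D(5)[OF p(2)] by (rule g[OF y(2)]) (use u(2) x(1) y(1) in simp)
      then show "good_tree (p' (fst v')) (p' (snd v')) (exts M' u)"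
        unfolding y(1) M'_def by (rule good_tree_permute[OF p(2) exts_permute[OF p(2)]])
    qed
  next
    case False
    show ?thesis
      by (rule good_tree_initial[OF p(3) conjunct1[OF st] conjunct2[OF st] False exts_unmarked[OF False] exts_nonempty[OF M x(2)]])
  qed
  show ?thesis unfolding x(1) LM by (rule good_tree_permute[OF p(1) exts_permute[OF p(1)] gx])
qed

section \<open>Composition and growth of morphisms\<close>

definition word_morph :: "morph \<Rightarrow> bool" where
  "word_morph f \<longleftrightarrow> (\<forall>a\<in>A3. f a \<noteq> [] \<and> set (f a) \<subseteq> A3)"

lemma word_morph_set: "word_morph f \<Longrightarrow> set w \<subseteq> A3 \<Longrightarrow> set (morph_word f w) \<subseteq> A3"
  unfolding word_morph_def by (induction w) auto

lemma word_morph_length: "\<forall>a\<in>A3. K \<le> length (f a) \<Longrightarrow> set w \<subseteq> A3 \<Longrightarrow> K * length w \<le> length (morph_word f w)"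
  by (induction w) (auto simp: add_mono)

lemma morph_word_nonempty: "word_morph f \<Longrightarrow> set w \<subseteq> A3 \<Longrightarrow> w \<noteq> [] \<Longrightarrow> morph_word f w \<noteq> []"
  unfolding word_morph_def by (cases w) auto

lemma word_morph_comp: "word_morph f \<Longrightarrow> word_morph g \<Longrightarrow> word_morph (morph_comp f g)"
proof -
  assume f: "word_morph f" and g: "word_morph g"
  show "word_morph (morph_comp f g)" unfolding word_morph_def morph_comp_def
  proof
    fix a assume "a \<in> A3"
    then have "g a \<noteq> []" "set (g a) \<subseteq> A3" using g unfolding word_morph_def by auto
    then show "morph_word f (g a) \<noteq> [] \<and> set (morph_word f (g a)) \<subseteq> A3"
      using word_morph_set[OF f] morph_word_nonempty[OF f] by blast
  qed
qed

lemma morph_word_id: "morph_word (\<lambda>a. [a]) w = w"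
  by (induction w) auto

lemma morph_comp_assoc: "morph_comp (morph_comp f g) h = morph_comp f (morph_comp g h)"
proof
  fix a
  have "morph_comp (morph_comp f g) h a = morph_word f (morph_word g (h a))"
    unfolding morph_comp_def[of _ h] morph_word_comp ..
  then show "morph_comp (morph_comp f g) h a = morph_comp f (morph_comp g h) a"
    unfolding morph_comp_def[of f "morph_comp g h"] unfolding morph_comp_def[of g h] .
qed

lemma morph_comp_id: "morph_comp f (\<lambda>a. [a]) = f"
  by (rule ext) (simp add: morph_comp_def)

lemma comp_seq_add: "comp_seq t n (i + j) = morph_comp (comp_seq t n i) (comp_seq t (n + i) j)"
  by (induction j) (simp_all add: morph_comp_id morph_comp_assoc add.assoc)

lemma comp_seq_Suc: "comp_seq t n (Suc k) = morph_comp (t n) (comp_seq t (Suc n) k)"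
proof -
  have "comp_seq t n 1 = t n" by (rule ext) (simp add: morph_comp_def morph_word_id)
  then show ?thesis using comp_seq_add[of t n 1 k] by simp
qed

lemma word_morph_comp_seq: "(\<And>n. word_morph (t n)) \<Longrightarrow> word_morph (comp_seq t n k)"
  by (induction k) (auto simp: word_morph_comp, simp add: word_morph_def)

text \<open>Composing with a stretch of levels that sends each letter to at least two letters at
  least doubles the minimal length. Both directions of the theorem obtain growth from this.\<close>

lemma comp_seq_growth:
  assumes t: "\<And>n. word_morph (t n)" and two: "\<And>n. \<exists>N. \<forall>c\<in>A3. 2 \<le> length (comp_seq t n N c)"
  shows "\<exists>N. \<forall>c\<in>A3. K \<le> length (comp_seq t n N c)"
proof (induction K)
  case (Suc K)
  then obtain N where N: "\<forall>c\<in>A3. K \<le> length (comp_seq t n N c)" by blast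
  obtain M where M: "\<forall>c\<in>A3. 2 \<le> length (comp_seq t (n + N) M c)" using two by blast
  have "Suc K \<le> length (comp_seq t n (N + M) c)" if c: "c \<in> A3" for c
  proof -
    let ?u = "comp_seq t (n + N) M c"
    have u: "set ?u \<subseteq> A3" using word_morph_comp_seq[of t, OF t] c unfolding word_morph_def by blast
    \<comment> \<open>The maximum with 1 makes doubling a strict gain even for K = 0.\<close>
    have N1: "\<forall>a\<in>A3. max 1 K \<le> length (comp_seq t n N a)"
      using N word_morph_comp_seq[of t n N, OF t] unfolding word_morph_def by (auto simp: Suc_le_eq)
    have "Suc K \<le> max 1 K * 2" by simp
    also have "\<dots> \<le> max 1 K * length ?u" using M c by (intro mult_le_mono2) blast
    also have "\<dots> \<le> length (morph_word (comp_seq t n N) ?u)" by (rule word_morph_length[OF N1 u])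
    finally show ?thesis unfolding comp_seq_add morph_comp_def .
  qed
  then show ?case by blast
qed simp

lemma sublist_morph_word: "sublist u v \<Longrightarrow> sublist (morph_word f u) (morph_word f v)"
  unfolding sublist_def by auto (metis morph_word_simps(3))

lemma letter_sublist: "a \<in> set w \<Longrightarrow> sublist (f a) (morph_word f w)"
proof -
  assume "a \<in> set w"
  then have "sublist [a] w" unfolding sublist_def by (auto dest: split_list)
  from sublist_morph_word[OF this, of f] show ?thesis by simp
qed

text \<open>The block cut by the left end of v accounts for at most B letters. More than B letters
  remain, and the next block fits into them.\<close>

lemma block_in_long_word:
  assumes f: "\<forall>a\<in>A3. length (f a) \<le> B"
  shows "set u \<subseteq> A3 \<Longrightarrow> morph_word f u = P @ v @ S \<Longrightarrow> 2 * B < length v \<Longrightarrow> \<exists>b\<in>A3. sublist (f b) v"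
proof (induction u arbitrary: P)
  case (Cons b u)
  have e: "f b @ morph_word f u = P @ v @ S" using Cons.prems by simp
  show ?case
  proof (cases "length (f b) \<le> length P")
    case True
    then obtain P' where "P = f b @ P'" using e by (metis append_eq_append_conv_if append_take_drop_id)
    then show ?thesis using Cons.IH[of P'] Cons.prems e by auto
  next
    case False
    then obtain y where y: "f b = P @ y" "y @ morph_word f u = v @ S"
      using e by (metis append_eq_append_conv2 append_eq_append_conv_if linear append_Nil2 append_take_drop_id)
    have "length y \<le> B" using f Cons.prems y(1) by auto
    obtain us where us: "y = v @ us \<and> us @ morph_word f u = S \<or> y @ us = v \<and> morph_word f u = us @ S"
      using y(2) unfolding append_eq_append_conv2 by blast
    have "\<not> length v \<le> length y" using \<open>length y \<le> B\<close> Cons.prems(3) by linarith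
    then obtain v' where v': "v = y @ v'" "morph_word f u = v' @ S"
      using us by auto
    have lv: "B < length v'" using v'(1) Cons.prems(3) \<open>length y \<le> B\<close> by simp
    then obtain c u' where u: "u = c # u'" using v'(2) by (cases u) auto
    have "length (f c) \<le> length v'" using f u Cons.prems(1) lv by fastforce
    moreover have "f c @ morph_word f u' = v' @ S" using v'(2) u by simp
    ultimately have "prefix (f c) v'" by (metis prefixI prefix_length_prefix)
    then have "sublist (f c) v" unfolding v'(1) by (auto simp: prefix_def sublist_def)
    then show ?thesis using u Cons.prems(1) by auto
  qed
qed simp

section \<open>The languages of a primitive directive sequence\<close>

definition seq_lang :: "(nat \<Rightarrow> morph) \<Rightarrow> nat \<Rightarrow> nat list set" where
  "seq_lang t n = {w. \<exists>N. \<exists>a\<in>A3. sublist w (comp_seq t n N a)}"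

context
  fixes t :: "nat \<Rightarrow> morph"
  assumes t: "\<And>n. word_morph (t n)" and prim: "primitive_seq A3 t"
begin

lemma comp_word_morph: "word_morph (comp_seq t n k)"
  by (rule word_morph_comp_seq[OF t])

text \<open>Primitivity provides one level. Beyond it, the image of b runs through the image of some
  letter of that level, which contains a already.\<close>

lemma late_letters:
  assumes a: "a \<in> A3"
  shows "\<exists>M>0. \<forall>j\<ge>M. \<forall>b\<in>A3. a \<in> set (comp_seq t n j b)"
proof -
  obtain N where N: "N > n" "\<forall>b\<in>A3. \<forall>a\<in>A3. a \<in> set (comp_seq t n (N - n) b)"
    using prim unfolding primitive_seq_def by blast
  have "a \<in> set (comp_seq t n j b)" if j: "N - n \<le> j" and b: "b \<in> A3" for j b
  proof -
    let ?u = "comp_seq t (n + (N - n)) (j - (N - n)) b"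
    have u: "?u \<noteq> []" "set ?u \<subseteq> A3" using comp_word_morph b unfolding word_morph_def by blast+
    then obtain c where c: "c \<in> set ?u" "c \<in> A3" by (metis hd_in_set subsetD)
    have "comp_seq t n j b = morph_word (comp_seq t n (N - n)) ?u"
      using comp_seq_add[of t n "N - n" "j - (N - n)"] j by (simp add: morph_comp_def)
    then have "sublist (comp_seq t n (N - n) c) (comp_seq t n j b)"
      using letter_sublist[OF c(1)] by simp
    then show ?thesis using N(2) c(2) a set_mono_sublist by blast
  qed
  then show ?thesis using N(1) by (intro exI[of _ "N - n"]) simp
qed

lemma primitive_growth: "\<exists>N. \<forall>a\<in>A3. K \<le> length (comp_seq t n N a)"
proof (rule comp_seq_growth[OF t])
  fix n
  obtain N where N: "\<forall>b\<in>A3. \<forall>a\<in>A3. a \<in> set (comp_seq t n (N - n) b)"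
    using prim unfolding primitive_seq_def by blast
  have "2 \<le> length (comp_seq t n (N - n) b)" if "b \<in> A3" for b
  proof -
    have "card A3 \<le> card (set (comp_seq t n (N - n) b))" using N that by (intro card_mono) auto
    also have "\<dots> \<le> length (comp_seq t n (N - n) b)" by (rule card_length)
    finally show ?thesis by (simp add: A3_def)
  qed
  then show "\<exists>N. \<forall>c\<in>A3. 2 \<le> length (comp_seq t n N c)" by blast
qed

text \<open>By primitivity the letter a occurs in all sufficiently late images, so a witness for w
  can be pushed to arbitrarily late levels.\<close>

lemma seq_lang_late:
  assumes w: "w \<in> seq_lang t n"
  shows "\<exists>N\<ge>R. \<exists>b\<in>A3. sublist w (comp_seq t n N b)"
proof -
  obtain N a where a: "a \<in> A3" "sublist w (comp_seq t n N a)" using w unfolding seq_lang_def by blast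
  obtain M where M: "\<forall>j\<ge>M. \<forall>b\<in>A3. a \<in> set (comp_seq t (n + N) j b)" using late_letters[OF a(1)] by blast
  have "sublist (comp_seq t n N a) (comp_seq t n (N + max M R) a)"
    unfolding comp_seq_add morph_comp_def by (rule letter_sublist) (use M a(1) in auto)
  then have "sublist w (comp_seq t n (N + max M R) a)" using a(2) by (meson sublist_order.order_trans)
  then show ?thesis using a(1) by (intro exI[of _ "N + max M R"]) auto
qed

lemma seq_lang_set: "w \<in> seq_lang t n \<Longrightarrow> set w \<subseteq> A3"
  using comp_word_morph set_mono_sublist unfolding seq_lang_def word_morph_def by blast

text \<open>At a late enough level the block of every letter contains w, and every word longer than
  two such blocks contains a whole one.\<close>

lemma seq_lang_unif_rec: "unif_rec (seq_lang t n)"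
  unfolding unif_rec_def
proof
  fix w assume w: "w \<in> seq_lang t n"
  obtain N a where a: "a \<in> A3" "sublist w (comp_seq t n N a)" using w unfolding seq_lang_def by blast
  obtain M where M: "\<forall>j\<ge>M. \<forall>b\<in>A3. a \<in> set (comp_seq t (n + N) j b)" using late_letters[OF a(1)] by blast
  have wb: "sublist w (comp_seq t n (N + M) b)" if "b \<in> A3" for b
  proof -
    have "sublist (comp_seq t n N a) (comp_seq t n (N + M) b)"
      unfolding comp_seq_add morph_comp_def by (rule letter_sublist) (use M that in auto)
    then show ?thesis using a(2) by (meson sublist_order.order_trans)
  qed
  define B where "B = Max ((\<lambda>b. length (comp_seq t n (N + M) b)) ` A3)"
  have B: "\<forall>b\<in>A3. length (comp_seq t n (N + M) b) \<le> B" unfolding B_def by (intro ballI Max_ge) (auto simp: A3_def)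
  have "sublist w v" if v: "v \<in> seq_lang t n" "2 * B + 1 \<le> length v" for v
  proof -
    obtain R c where R: "N + M \<le> R" "c \<in> A3" "sublist v (comp_seq t n R c)" using seq_lang_late[OF v(1)] by blast
    let ?u = "comp_seq t (n + (N + M)) (R - (N + M)) c"
    have "comp_seq t n R c = morph_word (comp_seq t n (N + M)) ?u"
      using comp_seq_add[of t n "N + M" "R - (N + M)"] R(1) by (simp add: morph_comp_def)
    then obtain P S where ps: "morph_word (comp_seq t n (N + M)) ?u = P @ v @ S" using R(3) unfolding sublist_def by auto
    have "set ?u \<subseteq> A3" using comp_word_morph R(2) unfolding word_morph_def by blast
    from block_in_long_word[OF B this ps] v(2)
    obtain b where "b \<in> A3" "sublist (comp_seq t n (N + M) b) v" by auto
    then show ?thesis using wb by (meson sublist_order.order_trans)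
  qed
  then show "\<exists>K. \<forall>v\<in>seq_lang t n. K \<le> length v \<longrightarrow> sublist w v" by blast
qed

lemma seq_lang_bilang: "bilang (seq_lang t n)"
  unfolding bilang_def
proof (intro conjI ballI allI impI)
  fix w assume w: "w \<in> seq_lang t n"
  show "set w \<subseteq> A3" by (rule seq_lang_set[OF w])
  obtain K where K: "\<And>v. v \<in> seq_lang t n \<Longrightarrow> K \<le> length v \<Longrightarrow> sublist w v"
    using seq_lang_unif_rec w unfolding unif_rec_def by blast
  \<comment> \<open>The two spare letters are the first and the last one: w is found in what lies
    between them and is therefore extended on both sides.\<close>
  obtain N where N: "\<forall>a\<in>A3. K + 2 \<le> length (comp_seq t n N a)" using primitive_growth by blast
  define v where "v = comp_seq t n N 1"
  have A1: "(1::nat) \<in> A3" by (simp add: A3_def)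
  have vl: "K + 2 \<le> length v" unfolding v_def using N A1 by blast
  obtain x v' where v1: "v = x # v'" using vl by (cases v) auto
  obtain u y where u: "v' = u @ [y]" using vl v1 by (cases v' rule: rev_cases) auto
  have "sublist u v" unfolding v1 u by (simp add: sublist_appendI sublist_def) (metis append_Cons append_Nil)
  then have "u \<in> seq_lang t n" unfolding seq_lang_def v_def using A1 by blast
  then have "sublist w u" using K vl v1 u by simp
  then obtain p s where ps: "u = p @ w @ s" unfolding sublist_def by blast
  obtain p' a where p': "x # p = p' @ [a]" by (metis append_butlast_last_id list.distinct(1))
  obtain b s' where s': "s @ [y] = b # s'" by (cases s) auto
  have "v = (x # p) @ w @ (s @ [y])" unfolding v1 u ps by simp
  then have "v = p' @ (a # w @ [b]) @ s'" unfolding p' s' by simp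
  then have "sublist (a # w @ [b]) v" unfolding sublist_def by blast
  then show "\<exists>a b. a # w @ [b] \<in> seq_lang t n" unfolding seq_lang_def v_def using A1 by blast
next
  fix v w assume "w \<in> seq_lang t n" "sublist v w"
  then show "v \<in> seq_lang t n" unfolding seq_lang_def using sublist_order.order_trans by blast
next
  fix a assume "a \<in> A3"
  then show "[a] \<in> seq_lang t n" unfolding seq_lang_def by (intro CollectI exI[of _ 0] bexI[of _ a]) auto
qed

lemma seq_lang_image: "seq_lang t n = image_lang (t n) (seq_lang t (Suc n))"
proof (intro set_eqI iffI)
  fix w assume "w \<in> seq_lang t n"
  then obtain N b where N: "1 \<le> N" "b \<in> A3" "sublist w (comp_seq t n N b)" using seq_lang_late by blast
  then obtain N' where "N = Suc N'" by (cases N) auto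
  then have "sublist w (morph_word (t n) (comp_seq t (Suc n) N' b))" using N(3) by (simp only: comp_seq_Suc morph_comp_def)
  moreover have "comp_seq t (Suc n) N' b \<in> seq_lang t (Suc n)" unfolding seq_lang_def using N(2) by blast
  ultimately show "w \<in> image_lang (t n) (seq_lang t (Suc n))" unfolding image_lang_def by blast
next
  fix w assume "w \<in> image_lang (t n) (seq_lang t (Suc n))"
  then obtain u N a where u: "sublist w (morph_word (t n) u)" "a \<in> A3" "sublist u (comp_seq t (Suc n) N a)"
    unfolding image_lang_def seq_lang_def by blast
  have "sublist w (comp_seq t n (Suc N) a)"
    unfolding comp_seq_Suc morph_comp_def using u(1) sublist_morph_word[OF u(3)] by (rule sublist_order.order_trans)
  then show "w \<in> seq_lang t n" unfolding seq_lang_def using u(2) by blast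
qed

text \<open>The definition of the generated shift only bounds the factors of its points from above.
  That all words of \<open>seq_lang t 0\<close> do occur follows from uniform recurrence once X has
  a point.\<close>

lemma lang_generated:
  assumes X: "shift_space A3 X" "X = generated_shift A3 t"
  shows "lang X = seq_lang t 0"
proof
  show "lang X \<subseteq> seq_lang t 0" unfolding lang_def X(2) generated_shift_def seq_lang_def by blast
  show "seq_lang t 0 \<subseteq> lang X"
  proof
    fix w assume "w \<in> seq_lang t 0"
    then obtain K where K: "\<And>v. v \<in> seq_lang t 0 \<Longrightarrow> K \<le> length v \<Longrightarrow> sublist w v"
      using seq_lang_unif_rec unfolding unif_rec_def by blast
    obtain x where x: "x \<in> X" using X(1) unfolding shift_space_def by (auto simp: A3_def)
    have "window x 0 K \<in> seq_lang t 0"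
      using x factor_window unfolding X(2) generated_shift_def seq_lang_def by blast
    from K[OF this] have "sublist w (window x 0 K)" by simp
    then show "w \<in> lang X" using factor_sublist[OF factor_window] x unfolding lang_def by blast
  qed
qed

end

section \<open>Dendricity along a path\<close>

lemma edge_word_morph: "G_edge v f v' \<Longrightarrow> word_morph f"
proof -
  assume "G_edge v f v'"
  then obtain p s p' where p: "p \<in> Sigma3" "p' \<in> Sigma3" "S3_valid s"
    and f: "f = morph_comp (perm_morph p) (morph_comp (S3_morph s) (perm_morph p'))"
    unfolding G_edge_def by blast
  have pm: "word_morph (perm_morph q)" if "q \<in> Sigma3" for q
    using Sigma3D(1)[OF that] unfolding word_morph_def perm_morph_def by simp
  have "word_morph (S3_morph s)" using S3_morph_marked[OF p(3)] unfolding marked_def word_morph_def by auto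
  then show ?thesis unfolding f using pm p by (intro word_morph_comp) auto
qed

lemma perm_word_morph: "p \<in> Sigma3 \<Longrightarrow> word_morph (perm_morph p)"
  using Sigma3D(1) unfolding word_morph_def perm_morph_def by simp

lemma minimal_dendric_of_path:
  assumes X: "shift_space A3 X" and p0: "p0 \<in> Sigma3"
    and path: "\<forall>n\<ge>1. v n \<in> Gvertices \<and> G_edge (v n) (\<sigma> n) (v (n + 1))"
    and t: "t = (\<lambda>n. if n = 0 then perm_morph p0 else \<sigma> n)"
    and prim: "primitive_seq A3 t" and gen: "X = generated_shift A3 t"
  shows "minimal_shift X \<and> dendric X"
proof -
  have wm: "word_morph (t n)" for n
  proof (cases "n = 0")
    case False
    then have "G_edge (v n) (t n) (v (n + 1))" using path unfolding t by simp
    then show ?thesis by (rule edge_word_morph)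
  qed (simp add: t perm_word_morph[OF p0])
  note bil = seq_lang_bilang[OF wm prim] and img = seq_lang_image[OF wm prim] and ur = seq_lang_unif_rec[OF wm prim]
  have lX: "lang X = seq_lang t 0" by (rule lang_generated[OF wm prim X gen])
  \<comment> \<open>The level n varies in the induction, because the word one level up is shorter
    but belongs to \<open>seq_lang t (Suc n)\<close>. Level 0 is only a renaming and is treated
    separately.\<close>
  have good: "good_tree (fst (v n)) (snd (v n)) (exts (seq_lang t n) w)" if "n \<ge> 1" "w \<in> seq_lang t n" for n w
    using that
  proof (induction "length w" arbitrary: n w rule: less_induct)
    case less
    have "G_edge (v n) (t n) (v (Suc n))" using path less.prems(1) unfolding t by auto
    then show ?case
      by (rule good_tree_edge[OF _ bil bil img less.prems(2)]) (use less.hyps in auto)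
  qed
  have "tree_rel (exts (seq_lang t 0) w)" if w: "w \<in> seq_lang t 0" for w
  proof -
    have e: "seq_lang t 0 = permute_lang p0 (seq_lang t 1)"
      using img[of 0] image_lang_perm[OF p0 bil] unfolding t by simp
    obtain u where u: "w = map p0 u" "u \<in> seq_lang t 1" using w unfolding e permute_lang_def by blast
    have "good_tree (inv p0 (p0 (fst (v 1)))) (inv p0 (p0 (snd (v 1)))) (exts (seq_lang t 1) u)"
      unfolding Sigma3D(5)[OF p0] using good[OF _ u(2)] by simp
    from good_tree_permute[OF p0 exts_permute[OF p0] this] show ?thesis unfolding u(1) e good_tree_def by blast
  qed
  then have "dendric_lang (lang X)" unfolding lX dendric_lang_def by blast
  moreover have "unif_rec (lang X)" unfolding lX by (rule ur)
  ultimately show ?thesis using minimal_of_unif_rec[OF X] dendric_iff[OF X] by blast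
qed

subsection \<open>Return words in dendric languages\<close>

definition perm3 :: "nat \<Rightarrow> nat \<Rightarrow> nat \<Rightarrow> nat \<Rightarrow> nat" where
  "perm3 a b c = (\<lambda>i. if i = 1 then a else if i = 2 then b else if i = 3 then c else i)"

lemma perm3_Sigma3:
  assumes "a \<in> A3" "b \<in> A3" "c \<in> A3" "distinct [a,b,c]"
  shows "perm3 a b c \<in> Sigma3"
proof -
  have "inj_on (perm3 a b c) {1,2,3}" using assms(4) by (auto simp: inj_on_def perm3_def)
  moreover have "perm3 a b c ` {1,2,3} \<subseteq> {1,2,3}" using assms(1-3) by (auto simp: perm3_def A3_def)
  ultimately have b: "bij_betw (perm3 a b c) {1,2,3} {1,2,3}"
    using endo_inj_surj[of "{1,2,3}" "perm3 a b c"] unfolding bij_betw_def by simp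
  have "perm3 a b c permutes {1,2,3}" by (rule bij_imp_permutes[OF b]) (simp add: perm3_def)
  then show ?thesis unfolding Sigma3_def by simp
qed

text \<open>The two-letter words produced by alpha, beta, gamma, delta, zeta and eta, in this order.\<close>
definition form_table :: "bool list set" where
  "form_table = {
     [True,True,True, True,False,False, True,False,False],
     [True,True,True, True,False,False, False,True,False],
     [True,True,False, True,False,True, True,False,False],
     [True,True,False, False,False,True, True,False,True],
     [False,True,True, True,False,False, True,False,True],
     [False,True,True, True,False,True, True,False,False]}"

definition pair_table :: "(nat \<Rightarrow> nat \<Rightarrow> bool) \<Rightarrow> bool list" where
  "pair_table R = [R 1 1, R 1 2, R 1 3, R 2 1, R 2 2, R 2 3, R 3 1, R 3 2, R 3 3]"

text \<open>The six disjunctions say that each nonempty proper set of letters has an outgoing edge,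
  that is, strong connectedness. The six lists are the incidence matrix with rows and columns
  permuted simultaneously in all six ways, and all 512 matrices are checked.\<close>

lemma bool_forms:
  "tree9 a b c d e f g h i \<Longrightarrow> b \<or> c \<Longrightarrow> d \<or> f \<Longrightarrow> g \<or> h \<Longrightarrow> c \<or> f \<Longrightarrow> b \<or> h \<Longrightarrow> d \<or> g \<Longrightarrow>
   [a,b,c,d,e,f,g,h,i] \<in> form_table \<or> [a,c,b,g,i,h,d,f,e] \<in> form_table \<or> [e,d,f,b,a,c,h,g,i] \<in> form_table \<or>
   [e,f,d,h,i,g,b,c,a] \<in> form_table \<or> [i,g,h,c,a,b,f,d,e] \<in> form_table \<or> [i,h,g,f,e,d,c,b,a] \<in> form_table"
  unfolding form_table_def tree9_def linked9_def Let_def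
  by (cases a; cases b; cases c; cases d; cases e; cases f; cases g; cases h; cases i; simp)

lemma tree_forms:
  assumes E: "E \<subseteq> A3 \<times> A3" "tree_rel E"
    and out: "\<And>S a b. S \<subseteq> A3 \<Longrightarrow> a \<in> S \<Longrightarrow> b \<in> A3 \<Longrightarrow> b \<notin> S \<Longrightarrow> \<exists>x\<in>S. \<exists>y\<in>A3 - S. (x,y) \<in> E"
  shows "\<exists>p\<in>Sigma3. pair_table (\<lambda>i j. (p i, p j) \<in> E) \<in> form_table"
proof -
  have 123: "distinct [1,2,3::nat]" by simp
  have T: "tree9 ((1,1)\<in>E) ((1,2)\<in>E) ((1,3)\<in>E) ((2,1)\<in>E) ((2,2)\<in>E) ((2,3)\<in>E) ((3,1)\<in>E) ((3,2)\<in>E) ((3,3)\<in>E)"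
    using tree_rel_iff[OF A3_def 123 A3_def 123 E(1)] E(2) by blast
  have o: "(1,2) \<in> E \<or> (1,3) \<in> E" "(2,1) \<in> E \<or> (2,3) \<in> E" "(3,1) \<in> E \<or> (3,2) \<in> E"
    "(1,3) \<in> E \<or> (2,3) \<in> E" "(1,2) \<in> E \<or> (3,2) \<in> E" "(2,1) \<in> E \<or> (3,1) \<in> E"
    using out[of "{1}" 1 2] out[of "{2}" 2 1] out[of "{3}" 3 1] out[of "{1,2}" 1 3] out[of "{1,3}" 1 2] out[of "{2,3}" 2 1]
    by (auto simp: A3_def)
  have s: "perm3 1 2 3 \<in> Sigma3" "perm3 1 3 2 \<in> Sigma3" "perm3 2 1 3 \<in> Sigma3" "perm3 2 3 1 \<in> Sigma3" "perm3 3 1 2 \<in> Sigma3" "perm3 3 2 1 \<in> Sigma3"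
    by (rule perm3_Sigma3; simp add: A3_def)+
  have t: "pair_table (\<lambda>i j. (perm3 a b c i, perm3 a b c j) \<in> E)
     = [(a,a)\<in>E, (a,b)\<in>E, (a,c)\<in>E, (b,a)\<in>E, (b,b)\<in>E, (b,c)\<in>E, (c,a)\<in>E, (c,b)\<in>E, (c,c)\<in>E]" for a b c
    unfolding pair_table_def perm3_def by simp
  have "\<exists>p\<in>{perm3 1 2 3, perm3 1 3 2, perm3 2 1 3, perm3 2 3 1, perm3 3 1 2, perm3 3 2 1}.
     pair_table (\<lambda>i j. (p i, p j) \<in> E) \<in> form_table"
    unfolding bex_simps t using bool_forms[OF T o] by blast
  then show ?thesis using s by blast
qed

lemma consecutive_exit:
  assumes "x \<in> S" "y \<in> set w" "y \<notin> S"
  shows "\<exists>p a b s. x # w = p @ [a,b] @ s \<and> a \<in> S \<and> b \<notin> S"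
proof -
  have "\<exists>b\<in>set (x # w). b \<notin> S" using assms by auto
  then obtain q b s where q: "x # w = q @ b # s" "b \<notin> S" "\<forall>a\<in>set q. \<not> a \<notin> S"
    using split_list_first_prop[of "x # w" "\<lambda>b. b \<notin> S"] by blast
  have "q \<noteq> []" using q assms(1) by auto
  then obtain p a where "q = p @ [a]" by (meson rev_exhaust)
  then show ?thesis using q by (intro exI[of _ p] exI[of _ a] exI[of _ b] exI[of _ s]) auto
qed

lemma unif_recD: "unif_rec L \<Longrightarrow> w \<in> L \<Longrightarrow> \<exists>K. \<forall>v\<in>L. K \<le> length v \<longrightarrow> sublist w v"
  unfolding unif_rec_def by blast

lemma sublist_singleton: "sublist [a] v \<longleftrightarrow> a \<in> set v"
  unfolding sublist_def by (auto dest: split_list)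

text \<open>A long word starting in S contains a letter outside S, so it leaves S at some two-letter
  word. Uniform recurrence thus makes the graph of two-letter words strongly connected.\<close>

lemma exit_pair:
  assumes L: "bilang L" "unif_rec L" and ab: "S \<subseteq> A3" "a \<in> S" "b \<in> A3" "b \<notin> S"
  shows "\<exists>x\<in>S. \<exists>y\<in>A3 - S. (x,y) \<in> exts L []"
proof -
  obtain K where K: "\<forall>v\<in>L. K \<le> length v \<longrightarrow> sublist [b] v" using unif_recD[OF L(2) bilangD(4)[OF L(1) ab(3)]] by blast
  obtain v where v: "length v = K" "[a] @ v \<in> L" using extend_right_n[OF L(1) bilangD(4)[OF L(1)], of a K] ab(1,2) by blast
  have "sublist [b] (a # v)" using K[rule_format, of "a # v"] v by simp
  then have "b \<in> set v" using ab unfolding sublist_singleton by auto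
  then obtain p x y s where *: "a # v = p @ [x,y] @ s" "x \<in> S" "y \<notin> S" using consecutive_exit[OF ab(2) _ ab(4)] by blast
  then have "[x,y] \<in> L" using bilang_append[OF L(1), of p "[x,y]" s] v(2) by simp
  then have "y \<in> A3" "(x,y) \<in> exts L []" using bilangD(1)[OF L(1)] unfolding exts_def by force+
  then show ?thesis using * by blast
qed

lemma mem_pair: "bilang L \<Longrightarrow> u @ x # y # v \<in> L \<Longrightarrow> [x,y] \<in> L"
  using bilang_append[of L u "[x,y]" v] by simp

lemma unique_successor:
  assumes L: "bilang L" and w: "w @ [b] \<in> L" and u: "\<And>c. [b,c] \<in> L \<Longrightarrow> c = d"
  shows "w @ [b,d] \<in> L"
proof -
  obtain c where c: "w @ [b,c] \<in> L" using extend_right[OF L w] by auto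
  then have "[b,c] \<in> L" using mem_pair[OF L, of w b c "[]"] by simp
  then show ?thesis using c u by blast
qed

lemma unique_predecessor:
  assumes L: "bilang L" and w: "b # w \<in> L" and u: "\<And>c. [c,b] \<in> L \<Longrightarrow> c = d"
  shows "d # b # w \<in> L"
proof -
  obtain c where c: "c # b # w \<in> L" using extend_left[OF L w] by auto
  then have "[c,b] \<in> L" using mem_pair[OF L, of "[]" c b w] by simp
  then show ?thesis using c u by blast
qed

text \<open>For f marked by 1 this says that the blocks of f are exactly the return words to 1 in
  L.\<close>

definition return_blocks :: "morph \<Rightarrow> nat list set \<Rightarrow> bool" where
  "return_blocks f L \<longleftrightarrow> (\<forall>t. 1 \<notin> set t \<longrightarrow> 1 # t @ [1] \<in> L \<longrightarrow> (\<exists>a\<in>A3. f a = 1 # t)) \<and> (\<forall>a\<in>A3. f a @ [1] \<in> L)"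

lemma replicate_in_mono: "bilang L \<Longrightarrow> replicate j x \<in> L \<Longrightarrow> i \<le> j \<Longrightarrow> replicate i x \<in> L"
  using bilang_prefix[of L "replicate i x" "replicate (j - i) x"] by (simp flip: replicate_add)

text \<open>Let k be the shortest length of a maximal run of 3. If it were the only length, the run
  of k - 1 letters would have the two edges (c,3) and (3,1) only, which are not connected. So a
  longer run exists, and then the run of k letters has the edges (c,1), (c,3), (3,1); the edge (3,3)
  would complete a square, hence no run is longer than k + 1.\<close>

lemma runs_of_three:
  assumes L: "bilang L" "unif_rec L" "dendric_lang L" and c: "c = 1 \<or> c = (2::nat)"
    and pr: "\<And>x. [x,3] \<in> L \<longleftrightarrow> x = c \<or> x = 3" and su: "\<And>y. [3,y] \<in> L \<longleftrightarrow> y = 1 \<or> y = 3"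
  shows "\<exists>k\<ge>1. \<forall>j\<ge>1. c # replicate j 3 @ [1] \<in> L \<longleftrightarrow> j = k \<or> j = Suc k"
proof -
  define J where "J = {j. 1 \<le> j \<and> c # replicate j 3 @ [1] \<in> L}"
  obtain K where K: "\<forall>v\<in>L. K \<le> length v \<longrightarrow> sublist [1] v"
    using unif_recD[OF L(2) bilangD(4)[OF L(1)], of 1] by (auto simp: A3_def)
  have bd: "i < K" if "replicate i 3 \<in> L" for i
  proof (rule ccontr)
    assume "\<not> i < K"
    then have "sublist [1] (replicate i (3::nat))" using K that by simp
    then show False unfolding sublist_singleton by simp
  qed
  \<comment> \<open>Powers of 3 are bounded by uniform recurrence; the longest one is a maximal run,
    so its neighbours are c and 1.\<close>
  have ext: "\<exists>j\<ge>i. j \<in> J" if i: "1 \<le> i" "replicate i 3 \<in> L" for i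
  proof -
    define j where "j = (GREATEST j. replicate j 3 \<in> L)"
    have b: "\<forall>y. replicate y 3 \<in> L \<longrightarrow> y \<le> K" using bd less_imp_le by blast
    have j: "replicate j 3 \<in> L" unfolding j_def by (rule GreatestI_nat[of _ i K]) (use i b in auto)
    have jmax: "\<And>y. replicate y 3 \<in> L \<Longrightarrow> y \<le> j" unfolding j_def by (rule Greatest_le_nat[of _ _ K]) (use b in auto)
    have ij: "i \<le> j" using jmax i by blast
    then obtain j' where j': "j = Suc j'" using i(1) by (cases j) auto
    obtain a b where ab: "a # replicate j 3 @ [b] \<in> L" using bilangD(3)[OF L(1) j] by blast
    have "[a,3] \<in> L" using mem_pair[OF L(1), of "[]" a 3 "replicate j' 3 @ [b]"] ab j' by simp
    moreover have "a \<noteq> 3"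
    proof
      assume "a = 3"
      then have "replicate (Suc j) 3 @ [b] \<in> L" using ab by simp
      then have "replicate (Suc j) 3 \<in> L" by (rule bilang_prefix[OF L(1)])
      then show False using jmax by fastforce
    qed
    ultimately have a: "a = c" using pr by blast
    have r: "replicate j 3 = replicate j' 3 @ [3::nat]" unfolding j' by (simp add: replicate_append_same)
    have "[3,b] \<in> L" using mem_pair[OF L(1), of "a # replicate j' 3" 3 b "[]"] ab r by simp
    moreover have "b \<noteq> 3"
    proof
      assume "b = 3"
      then have "a # replicate (Suc j) 3 \<in> L" using ab by (simp add: replicate_append_same)
      then have "replicate (Suc j) 3 \<in> L" by (rule bilang_tl[OF L(1)])
      then show False using jmax by fastforce
    qed
    ultimately have "b = 1" using su by blast
    then show ?thesis using ab a ij i(1) unfolding J_def by auto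
  qed
  have J3: "replicate j 3 \<in> L" if "j \<in> J" for j
    using that bilang_append[OF L(1), of "[c]" "replicate j 3" "[1]"] unfolding J_def by simp
  have J31: "replicate i 3 @ [1] \<in> L" if "j \<in> J" "i \<le> j" for i j
    using that bilang_suffix[OF L(1), of "c # replicate (j - i) 3" "replicate i 3 @ [1]"] unfolding J_def
    by (simp add: append_assoc[symmetric] del: append_assoc flip: replicate_add)
  have Jc3: "c # replicate i 3 \<in> L" if "j \<in> J" "i \<le> j" for i j
    using that bilang_prefix[OF L(1), of "c # replicate i 3" "replicate (j - i) 3 @ [1]"] unfolding J_def
    by (simp add: append_assoc[symmetric] del: append_assoc flip: replicate_add)
  have c3: "c \<noteq> 3" using c by auto
  define k where "k = (LEAST j. j \<in> J)"
  have "[3] \<in> L" using bilangD(4)[OF L(1)] by (simp add: A3_def)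
  then have "\<exists>j. j \<in> J" using ext[of 1] by auto
  then have k: "k \<in> J" unfolding k_def by (rule LeastI_ex)
  have kmin: "k \<le> j" if "j \<in> J" for j unfolding k_def using that by (rule Least_le)
  have k1: "1 \<le> k" using k unfolding J_def by simp
  have "[3,3] \<in> L" using pr by simp
  then obtain j2 where j2: "2 \<le> j2" "j2 \<in> J" using ext[of 2] by (auto simp: numeral_2_eq_2)
  have ex_word: "(a,b) \<in> exts L (replicate n 3) \<longleftrightarrow> a # replicate n 3 @ [b] \<in> L" for a b n unfolding exts_def by simp
  have rS: "replicate n 3 @ [3] = replicate (Suc n) (3::nat)" for n by (simp add: replicate_append_same)
  have "\<exists>j\<in>J. k < j"
  proof (rule ccontr)
    assume "\<not> ?thesis"
    then have only: "j = k" if "j \<in> J" for j using kmin[OF that] that by fastforce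
    then have "2 \<le> k" using j2 by blast
    \<comment> \<open>The word 3 3 lies in L, so a single run length is at least 2 and k - 1 is
      still positive.\<close>
    then obtain n where n: "k = Suc n" "1 \<le> n" by (cases k) auto
    let ?E = "exts L (replicate n 3)"
    have rn: "replicate n 3 \<in> L" by (rule replicate_in_mono[OF L(1) J3[OF k]]) (simp add: n)
    then have l: "linked ?E" using L(3) unfolding dendric_lang_def tree_rel_def by blast
    have e1: "(c,3) \<in> ?E" unfolding ex_word rS using Jc3[OF k, of k] n by simp
    have e2: "(3,1) \<in> ?E" unfolding ex_word using J31[OF k, of k] n by simp
    have e3: "(c,1) \<notin> ?E"
    proof
      assume "(c,1) \<in> ?E"
      then have "n \<in> J" unfolding ex_word J_def using n by simp
      then show False using kmin n by fastforce
    qed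
    have e4: "(3,3) \<notin> ?E"
    proof
      assume "(3,3) \<in> ?E"
      then have "replicate (Suc k) 3 \<in> L" unfolding ex_word rS n by simp
      then obtain j where "j \<in> J" "Suc k \<le> j" using ext[of "Suc k"] by auto
      then show False using only by fastforce
    qed
    obtain n' where n': "n = Suc n'" using n(2) by (cases n) auto
    have dom: "a = c \<or> a = 3" if "(a,b) \<in> ?E" for a b
      using that mem_pair[OF L(1), of "[]" a 3 "replicate n' 3 @ [b]"] pr unfolding ex_word n' by simp
    have ran: "b = 1 \<or> b = 3" if "(a,b) \<in> ?E" for a b
    proof -
      have "a # replicate n 3 @ [b] = (a # replicate n' 3) @ 3 # b # []" unfolding n' by (simp add: replicate_append_same[symmetric])
      then show ?thesis using that mem_pair[OF L(1), of "a # replicate n' 3" 3 b "[]"] su unfolding ex_word by auto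
    qed
    have ns: "\<not> share ?E c 3" unfolding share_def using ran e3 e4 by blast
    have "share ?E c 3 \<or> (\<exists>e. share ?E c e \<and> share ?E e 3)" using l e1 e2 unfolding linked_def by blast
    then obtain e where "share ?E c e" "share ?E e 3" using ns by blast
    moreover then have "e = c \<or> e = 3" using dom unfolding share_def by blast
    ultimately show False using ns by blast
  qed
  then obtain j' where j': "j' \<in> J" "k < j'" by blast
  let ?E = "exts L (replicate k 3)"
  have "no_C4 ?E" using L(3) J3[OF k] unfolding dendric_lang_def tree_rel_def by blast
  moreover have "(c,1) \<in> ?E" unfolding ex_word using k unfolding J_def by simp
  moreover have "(c,3) \<in> ?E" unfolding ex_word rS using Jc3[OF j'(1), of "Suc k"] j'(2) by simp
  moreover have "(3,1) \<in> ?E" unfolding ex_word using J31[OF j'(1), of "Suc k"] j'(2) by simp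
  ultimately have "(3,3) \<notin> ?E" using c3 unfolding no_C4_def by (metis numeral_eq_one_iff semiring_norm(86))
  then have no: "replicate (Suc (Suc k)) 3 \<notin> L" unfolding ex_word rS by simp
  have up: "j \<le> Suc k" if "j \<in> J" for j
  proof (rule ccontr)
    assume "\<not> j \<le> Suc k"
    then have "replicate (Suc (Suc k)) 3 \<in> L" by (intro replicate_in_mono[OF L(1) J3[OF that]]) simp
    then show False using no by blast
  qed
  have "j' = Suc k" using up[OF j'(1)] j'(2) by simp
  then have "j \<in> J \<longleftrightarrow> j = k \<or> j = Suc k" for j using up[of j] kmin[of j] k j'(1) by auto
  then show ?thesis using k1 unfolding J_def by (intro exI[of _ k]) auto
qed

lemma run_letters:
  assumes L: "bilang L" and 2: "\<And>y. [2,y] \<in> L \<Longrightarrow> y = 1 \<or> y = 3" and 3: "\<And>y. [3,y] \<in> L \<Longrightarrow> y = 1 \<or> y = 3"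
  shows "c = 2 \<or> c = 3 \<Longrightarrow> c # t @ s \<in> L \<Longrightarrow> 1 \<notin> set t \<Longrightarrow> t = replicate (length t) 3"
proof (induction t arbitrary: c)
  case (Cons x t)
  have "[c,x] \<in> L" using mem_pair[OF L, of "[]" c x "t @ s"] Cons.prems by simp
  then have x: "x = 3" using Cons.prems(1,3) 2 3 by auto
  have "x # t @ s \<in> L" using bilang_tl[OF L] Cons.prems(2) by simp
  then show ?case using Cons.IH[of x] x Cons.prems(3) by simp
qed simp

text \<open>If 3 3 does not occur, the letters other than 1 allow no long walk, so return words have
  at most three letters and follow from the two-letter words; that they do occur follows where a
  successor or predecessor is unique. If 3 3 occurs, the remaining freedom is the length of the runs
  of 3, governed by \<open>runs_of_three\<close>.\<close>

lemma return_blocks_of_form: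
  assumes L: "bilang L" "unif_rec L" "dendric_lang L" and F: "pair_table (\<lambda>i j. [i,j] \<in> L) \<in> form_table"
  shows "\<exists>s. S3_valid s \<and> return_blocks (S3_morph s) L"
proof -
  have pA: "x = 1 \<or> x = 2 \<or> x = 3" "y = 1 \<or> y = 2 \<or> y = 3" if "[x,y] \<in> L" for x y
    using bilangD(1)[OF L(1) that] A3_iff by auto
  have let3: "[x] \<in> L" if "x = 1 \<or> x = 2 \<or> x = 3" for x using bilangD(4)[OF L(1)] A3_iff that by blast
  have first: "[1,x] \<in> L" if "1 # x # w \<in> L" for x w using mem_pair[OF L(1), of "[]" 1 x w] that by simp
  have second: "[x,y] \<in> L" if "1 # x # y # w \<in> L" for x y w using mem_pair[OF L(1), of "[1]" x y w] that by simp
  have third: "[y,z] \<in> L" if "1 # x # y # z # w \<in> L" for x y z w using mem_pair[OF L(1), of "[1,x]" y z w] that by simp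
  have sc: "w @ [b,d] \<in> L" if "w @ [b] \<in> L" "\<And>c. [b,c] \<in> L \<Longrightarrow> c = d" for w b d
    by (rule unique_successor[OF L(1) that])
  have pd: "d # b # w \<in> L" if "b # w \<in> L" "\<And>c. [c,b] \<in> L \<Longrightarrow> c = d" for w b d
    by (rule unique_predecessor[OF L(1) that])
  have cs: "pair_table (\<lambda>i j. [i,j] \<in> L) = [True,True,True, True,False,False, True,False,False] \<or>
     pair_table (\<lambda>i j. [i,j] \<in> L) = [True,True,True, True,False,False, False,True,False] \<or>
     pair_table (\<lambda>i j. [i,j] \<in> L) = [True,True,False, True,False,True, True,False,False] \<or>
     pair_table (\<lambda>i j. [i,j] \<in> L) = [True,True,False, False,False,True, True,False,True] \<or>
     pair_table (\<lambda>i j. [i,j] \<in> L) = [False,True,True, True,False,False, True,False,True] \<or>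
     pair_table (\<lambda>i j. [i,j] \<in> L) = [False,True,True, True,False,True, True,False,False]"
    using F unfolding form_table_def by blast
  \<comment> \<open>Return words are treated by length; the fourth premise excludes three
    consecutive letters different from 1.\<close>
  have short: "(\<exists>a\<in>A3. f a = 1 # t)" if
      "t = [] \<Longrightarrow> f 1 = [1] \<or> [1,1] \<notin> L" 
      "\<And>x. t = [x] \<Longrightarrow> [1,x] \<in> L \<Longrightarrow> [x,1] \<in> L \<Longrightarrow> x \<noteq> 1 \<Longrightarrow> \<exists>a\<in>A3. f a = [1,x]"
      "\<And>x y. t = [x,y] \<Longrightarrow> [1,x] \<in> L \<Longrightarrow> [x,y] \<in> L \<Longrightarrow> [y,1] \<in> L \<Longrightarrow> x \<noteq> 1 \<Longrightarrow> y \<noteq> 1 \<Longrightarrow> \<exists>a\<in>A3. f a = [1,x,y]"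
      "\<And>x y z t'. t = x # y # z # t' \<Longrightarrow> [1,x] \<in> L \<Longrightarrow> [x,y] \<in> L \<Longrightarrow> [y,z] \<in> L \<Longrightarrow> x \<noteq> 1 \<Longrightarrow> y \<noteq> 1 \<Longrightarrow> z \<noteq> 1 \<Longrightarrow> False"
      "1 \<notin> set t" "1 # t @ [1] \<in> L" for f t
  proof -
    consider "t = []" | x where "t = [x]" | x y where "t = [x,y]" | x y z t' where "t = x # y # z # t'"
      by (metis neq_Nil_conv)
    then show ?thesis
    proof cases
      case 1
      then show ?thesis using that(1,6) by (intro bexI[of _ 1]) (auto simp: A3_def)
    next
      case (2 x)
      show ?thesis using that(2)[OF 2] that(5,6) first[of x "[1]"] second[of x 1 "[]"] unfolding 2 by auto
    next
      case (3 x y)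
      show ?thesis using that(3)[OF 3] that(5,6) first[of x "[y,1]"] second[of x y "[1]"] third[of x y 1 "[]"] unfolding 3 by auto
    next
      case (4 x y z t')
      show ?thesis using that(4)[OF 4] that(5,6) first[of x "y # z # t' @ [1]"] second[of x y "z # t' @ [1]"] third[of x y z "t' @ [1]"] unfolding 4 by auto
    qed
  qed
  show ?thesis using cs
  proof (elim disjE)
    assume "pair_table (\<lambda>i j. [i,j] \<in> L) = [True,True,True, True,False,False, True,False,False]"
    then have P: "[1,1] \<in> L" "[1,2] \<in> L" "[1,3] \<in> L" "[2,1] \<in> L" "[2,2] \<notin> L" "[2,3] \<notin> L" "[3,1] \<in> L" "[3,2] \<notin> L" "[3,3] \<notin> L"
      unfolding pair_table_def by simp_all
    have "return_blocks (S3_morph Alpha) L" unfolding return_blocks_def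
    proof (intro conjI allI impI)
      fix t assume t: "1 \<notin> set t" "1 # t @ [1] \<in> L"
      have n: "x = 1 \<or> y = 1" if "[x,y] \<in> L" for x y using P pA[OF that] that by auto
      show "\<exists>a\<in>A3. S3_morph Alpha a = 1 # t"
      proof (rule short[OF _ _ _ _ t])
        show "\<exists>a\<in>A3. S3_morph Alpha a = [1,x]" if "[1,x] \<in> L" "x \<noteq> 1" for x
          using pA(2)[OF that(1)] that(2) by (auto simp: bex_A3)
      qed (use n in auto)
    next
      have "[1] @ [2,1] \<in> L" "[1] @ [3,1] \<in> L" by (rule sc; use P pA in force)+
      then show "\<forall>a\<in>A3. S3_morph Alpha a @ [1] \<in> L" using P unfolding ball_A3 by simp
    qed
    then show ?thesis by (intro exI[of _ Alpha]) (simp add: S3_valid_def)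
  next
    assume "pair_table (\<lambda>i j. [i,j] \<in> L) = [True,True,True, True,False,False, False,True,False]"
    then have P: "[1,1] \<in> L" "[1,2] \<in> L" "[1,3] \<in> L" "[2,1] \<in> L" "[2,2] \<notin> L" "[2,3] \<notin> L" "[3,1] \<notin> L" "[3,2] \<in> L" "[3,3] \<notin> L"
      unfolding pair_table_def by simp_all
    have "return_blocks (S3_morph Beta) L" unfolding return_blocks_def
    proof (intro conjI allI impI)
      fix t assume t: "1 \<notin> set t" "1 # t @ [1] \<in> L"
      have n: "x = 3 \<and> y = 2" if "[x,y] \<in> L" "x \<noteq> 1" "y \<noteq> 1" for x y using P pA[OF that(1)] that by auto
      show "\<exists>a\<in>A3. S3_morph Beta a = 1 # t"
      proof (rule short[OF _ _ _ _ t])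
        show "\<exists>a\<in>A3. S3_morph Beta a = [1,x]" if "[1,x] \<in> L" "[x,1] \<in> L" "x \<noteq> 1" for x
          using pA(2)[OF that(1)] that P by (auto simp: bex_A3)
        show "\<exists>a\<in>A3. S3_morph Beta a = [1,x,y]" if "[x,y] \<in> L" "x \<noteq> 1" "y \<noteq> 1" for x y
          using n[OF that] by (simp add: bex_A3)
        show False if "[x,y] \<in> L" "[y,z] \<in> L" "x \<noteq> 1" "y \<noteq> 1" "z \<noteq> 1" for x y z
          using n[of x y] n[of y z] that by auto
        show "S3_morph Beta 1 = [1] \<or> [1,1] \<notin> L" using P by simp
      qed
    next
      have 1: "[1] @ [2,1] \<in> L" "[1] @ [3,2] \<in> L" by (rule sc; use P pA in force)+
      have "[1,3] @ [2,1] \<in> L" by (rule sc; use 1 P pA in force)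
      then show "\<forall>a\<in>A3. S3_morph Beta a @ [1] \<in> L" using P 1 unfolding ball_A3 by simp
    qed
    then show ?thesis by (intro exI[of _ Beta]) (simp add: S3_valid_def)
  next
    assume "pair_table (\<lambda>i j. [i,j] \<in> L) = [True,True,False, True,False,True, True,False,False]"
    then have P: "[1,1] \<in> L" "[1,2] \<in> L" "[1,3] \<notin> L" "[2,1] \<in> L" "[2,2] \<notin> L" "[2,3] \<in> L" "[3,1] \<in> L" "[3,2] \<notin> L" "[3,3] \<notin> L"
      unfolding pair_table_def by simp_all
    have "return_blocks (S3_morph Gamma) L" unfolding return_blocks_def
    proof (intro conjI allI impI)
      fix t assume t: "1 \<notin> set t" "1 # t @ [1] \<in> L"
      have n: "x = 2 \<and> y = 3" if "[x,y] \<in> L" "x \<noteq> 1" "y \<noteq> 1" for x y using P pA[OF that(1)] that by auto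
      show "\<exists>a\<in>A3. S3_morph Gamma a = 1 # t"
      proof (rule short[OF _ _ _ _ t])
        show "\<exists>a\<in>A3. S3_morph Gamma a = [1,x]" if "[1,x] \<in> L" "[x,1] \<in> L" "x \<noteq> 1" for x
          using pA(2)[OF that(1)] that P by (auto simp: bex_A3)
        show "\<exists>a\<in>A3. S3_morph Gamma a = [1,x,y]" if "[x,y] \<in> L" "x \<noteq> 1" "y \<noteq> 1" for x y
          using n[OF that] by (simp add: bex_A3)
        show False if "[x,y] \<in> L" "[y,z] \<in> L" "x \<noteq> 1" "y \<noteq> 1" "z \<noteq> 1" for x y z
          using n[of x y] n[of y z] that by auto
        show "S3_morph Gamma 1 = [1] \<or> [1,1] \<notin> L" using P by simp
      qed
    next
      have 1: "1 # 2 # [1] \<in> L" "1 # 2 # [3] \<in> L" by (rule pd; use P pA in force)+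
      have "[1,2] @ [3,1] \<in> L" by (rule sc; use 1 P pA in force)
      then show "\<forall>a\<in>A3. S3_morph Gamma a @ [1] \<in> L" using P 1 unfolding ball_A3 by simp
    qed
    then show ?thesis by (intro exI[of _ Gamma]) (simp add: S3_valid_def)
  next
    assume "pair_table (\<lambda>i j. [i,j] \<in> L) = [False,True,True, True,False,True, True,False,False]"
    then have P: "[1,1] \<notin> L" "[1,2] \<in> L" "[1,3] \<in> L" "[2,1] \<in> L" "[2,2] \<notin> L" "[2,3] \<in> L" "[3,1] \<in> L" "[3,2] \<notin> L" "[3,3] \<notin> L"
      unfolding pair_table_def by simp_all
    have "return_blocks (S3_morph Eta) L" unfolding return_blocks_def
    proof (intro conjI allI impI)
      fix t assume t: "1 \<notin> set t" "1 # t @ [1] \<in> L"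
      have n: "x = 2 \<and> y = 3" if "[x,y] \<in> L" "x \<noteq> 1" "y \<noteq> 1" for x y using P pA[OF that(1)] that by auto
      show "\<exists>a\<in>A3. S3_morph Eta a = 1 # t"
      proof (rule short[OF _ _ _ _ t])
        show "\<exists>a\<in>A3. S3_morph Eta a = [1,x]" if "[1,x] \<in> L" "[x,1] \<in> L" "x \<noteq> 1" for x
          using pA(2)[OF that(1)] that P by (auto simp: bex_A3)
        show "\<exists>a\<in>A3. S3_morph Eta a = [1,x,y]" if "[x,y] \<in> L" "x \<noteq> 1" "y \<noteq> 1" for x y
          using n[OF that] by (simp add: bex_A3)
        show False if "[x,y] \<in> L" "[y,z] \<in> L" "x \<noteq> 1" "y \<noteq> 1" "z \<noteq> 1" for x y z
          using n[of x y] n[of y z] that by auto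
        show "S3_morph Eta 1 = [1] \<or> [1,1] \<notin> L" using P by simp
      qed
    next
      have 1: "1 # 2 # [1] \<in> L" "1 # 2 # [3] \<in> L" by (rule pd; use P pA in force)+
      have 2: "[1,2] @ [3,1] \<in> L" by (rule sc; use 1 P pA in force)
      have "[1] @ [3,1] \<in> L" by (rule sc; use P pA in force)
      then show "\<forall>a\<in>A3. S3_morph Eta a @ [1] \<in> L" using P 1 2 unfolding ball_A3 by simp
    qed
    then show ?thesis by (intro exI[of _ Eta]) (simp add: S3_valid_def)
  next
    assume "pair_table (\<lambda>i j. [i,j] \<in> L) = [True,True,False, False,False,True, True,False,True]"
    then have P: "[1,1] \<in> L" "[1,2] \<in> L" "[1,3] \<notin> L" "[2,1] \<notin> L" "[2,2] \<notin> L" "[2,3] \<in> L" "[3,1] \<in> L" "[3,2] \<notin> L" "[3,3] \<in> L"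
      unfolding pair_table_def by simp_all
    have "[x,3] \<in> L \<longleftrightarrow> x = 2 \<or> x = 3" for x using P pA(1)[of x 3] by auto
    moreover have s3: "[3,y] \<in> L \<longleftrightarrow> y = 1 \<or> y = 3" for y using P pA(2)[of 3 y] by auto
    ultimately obtain k where k: "1 \<le> k" "\<And>j. 1 \<le> j \<Longrightarrow> 2 # replicate j 3 @ [1] \<in> L \<longleftrightarrow> j = k \<or> j = Suc k"
      using runs_of_three[OF L, of 2] by blast
    have "return_blocks (S3_morph (Delta k)) L" unfolding return_blocks_def
    proof (intro conjI allI impI)
      fix t assume t: "1 \<notin> set t" "1 # t @ [1] \<in> L"
      show "\<exists>a\<in>A3. S3_morph (Delta k) a = 1 # t"
      proof (cases t)
        case Nil
        then show ?thesis by (simp add: bex_A3)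
      next
        case (Cons x t')
        have "[1,x] \<in> L" using first[of x "t' @ [1]"] t(2) Cons by simp
        then have x: "x = 2" using P pA(2)[of 1 x] t(1) Cons by auto
        have l: "2 # t' @ [1] \<in> L" using bilang_tl[OF L(1), of 1] t(2) Cons x by simp
        have r: "t' = replicate (length t') 3"
          by (rule run_letters[OF L(1) _ _ _ l]) (use P pA s3 t Cons in \<open>auto dest: pA(2)\<close>)
        have "1 \<le> length t'" using l P by (cases t') auto
        then have "length t' = k \<or> length t' = Suc k" using k(2) l r by metis
        then show ?thesis using r unfolding Cons x bex_A3 by (elim disjE) (simp_all del: replicate_Suc)
      qed
    next
      have 1: "1 # 2 # (replicate j 3 @ [1]) \<in> L" if "j = k \<or> j = Suc k" for j
        by (rule pd) (use k(2)[of j] k(1) that P pA(1) in auto)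
      then show "\<forall>a\<in>A3. S3_morph (Delta k) a @ [1] \<in> L" using P 1[of k] 1[of "Suc k"] unfolding ball_A3 by simp
    qed
    then show ?thesis using k(1) by (intro exI[of _ "Delta k"]) (simp add: S3_valid_def)
  next
    assume "pair_table (\<lambda>i j. [i,j] \<in> L) = [False,True,True, True,False,False, True,False,True]"
    then have P: "[1,1] \<notin> L" "[1,2] \<in> L" "[1,3] \<in> L" "[2,1] \<in> L" "[2,2] \<notin> L" "[2,3] \<notin> L" "[3,1] \<in> L" "[3,2] \<notin> L" "[3,3] \<in> L"
      unfolding pair_table_def by simp_all
    have "[x,3] \<in> L \<longleftrightarrow> x = 1 \<or> x = 3" for x using P pA(1)[of x 3] by auto
    moreover have s3: "[3,y] \<in> L \<longleftrightarrow> y = 1 \<or> y = 3" for y using P pA(2)[of 3 y] by auto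
    ultimately obtain k where k: "1 \<le> k" "\<And>j. 1 \<le> j \<Longrightarrow> 1 # replicate j 3 @ [1] \<in> L \<longleftrightarrow> j = k \<or> j = Suc k"
      using runs_of_three[OF L, of 1] by blast
    have "return_blocks (S3_morph (Zeta k)) L" unfolding return_blocks_def
    proof (intro conjI allI impI)
      fix t assume t: "1 \<notin> set t" "1 # t @ [1] \<in> L"
      show "\<exists>a\<in>A3. S3_morph (Zeta k) a = 1 # t"
      proof (cases t)
        case Nil
        then show ?thesis using P t by simp
      next
        case (Cons x t')
        have "[1,x] \<in> L" using first[of x "t' @ [1]"] t(2) Cons by simp
        then have "x = 2 \<or> x = 3" using P pA(2)[of 1 x] t(1) Cons by auto
        then show ?thesis
        proof
          assume x: "x = 2"
          have "t' = []"
          proof (rule ccontr)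
            assume "t' \<noteq> []"
            then obtain y t'' where y: "t' = y # t''" by (cases t') auto
            then have "[2,y] \<in> L" "y \<noteq> 1" using second[of 2 y "t'' @ [1]"] t Cons x by auto
            then show False using P pA(2)[of 2 y] by auto
          qed
          then show ?thesis using Cons x by (simp add: bex_A3)
        next
          assume x: "x = 3"
          have l: "3 # t' @ [1] \<in> L" using bilang_tl[OF L(1), of 1] t(2) Cons x by simp
          have r: "t' = replicate (length t') 3"
            by (rule run_letters[OF L(1) _ _ _ l]) (use P pA s3 t Cons in \<open>auto dest: pA(2)\<close>)
          then have tr: "t = replicate (Suc (length t')) 3" using Cons x by simp
          then have "Suc (length t') = k \<or> Suc (length t') = Suc k" using k(2)[of "Suc (length t')"] t(2) by (metis le_add1 plus_1_eq_Suc)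
          then show ?thesis unfolding bex_A3 using tr by (elim disjE) (simp_all del: replicate_Suc)
        qed
      qed
    next
      have 1: "[1] @ [2,1] \<in> L" by (rule sc; use P pA in force)
      show "\<forall>a\<in>A3. S3_morph (Zeta k) a @ [1] \<in> L" using k(2)[of k] k(2)[of "Suc k"] k(1) 1 unfolding ball_A3 by simp
    qed
    then show ?thesis using k(1) by (intro exI[of _ "Zeta k"]) (simp add: S3_valid_def)
  qed
qed

section \<open>Desubstitution\<close>

lemma left_marker:
  assumes L: "bilang L" "unif_rec L" "m \<in> A3" and w: "w \<in> L"
  shows "\<exists>P. m \<notin> set P \<and> m # P @ w \<in> L"
proof -
  obtain K where K: "\<forall>v\<in>L. K \<le> length v \<longrightarrow> sublist [m] v" using unif_recD[OF L(2) bilangD(4)[OF L(1,3)]] by blast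
  obtain v where v: "length v = K" "v @ w \<in> L" using extend_left_n[OF L(1) w] by blast
  have "m \<in> set v" using K[rule_format, of v] bilang_prefix[OF L(1) v(2)] v(1) unfolding sublist_singleton by simp
  then obtain v1 P where "v = v1 @ m # P" "m \<notin> set P" by (meson split_list_last)
  then show ?thesis using bilang_suffix[OF L(1), of v1 "m # P @ w"] v(2) by auto
qed

lemma right_marker:
  assumes L: "bilang L" "unif_rec L" "m \<in> A3" and w: "w \<in> L"
  shows "\<exists>Q. m \<notin> set Q \<and> w @ Q @ [m] \<in> L"
proof -
  obtain K where K: "\<forall>v\<in>L. K \<le> length v \<longrightarrow> sublist [m] v" using unif_recD[OF L(2) bilangD(4)[OF L(1,3)]] by blast
  obtain v where v: "length v = K" "w @ v \<in> L" using extend_right_n[OF L(1) w] by blast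
  have "m \<in> set v" using K[rule_format, of v] bilang_suffix[OF L(1) v(2)] v(1) unfolding sublist_singleton by simp
  then obtain Q v1 where "v = Q @ m # v1" "m \<notin> set Q" by (meson split_list_first)
  then show ?thesis using bilang_prefix[OF L(1), of "w @ Q @ [m]" v1] v(2) by auto
qed

text \<open>The closing 1 in the definition of L' makes the last block complete: a block such as 12
  may be a proper prefix of another block such as 123. Extending a word of L to the previous and to
  the next 1 adds whole return words, hence letters of L'; this gives both extendability and the
  equality with the image.\<close>

lemma desubstitute:
  assumes L: "bilang L" "unif_rec L" and f: "marked 1 f" and rb: "return_blocks f L"
  defines "L' \<equiv> {u. set u \<subseteq> A3 \<and> morph_word f u @ [1] \<in> L}"
  shows "bilang L'" "unif_rec L'" "L = image_lang f L'"
proof -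
  have A1: "(1::nat) \<in> A3" by (simp add: A3_def)
  have blocks: "\<exists>a\<in>A3. f a = 1 # t" if "1 \<notin> set t" "1 # t @ [1] \<in> L" for t
    using rb that unfolding return_blocks_def by blast
  \<comment> \<open>The word is cut in front of each 1; every piece is a return word and thus a
    block.\<close>
  have decode: "\<exists>u. set u \<subseteq> A3 \<and> morph_word f u = 1 # R" if "1 # R @ [1] \<in> L" for R
    using that
  proof (induction "length R" arbitrary: R rule: less_induct)
    case less
    show ?case
    proof (cases "1 \<in> set R")
      case False
      then obtain a where "a \<in> A3" "f a = 1 # R" using blocks less.prems by blast
      then show ?thesis by (intro exI[of _ "[a]"]) simp
    next
      case True
      then obtain R1 R2 where R: "R = R1 @ 1 # R2" "1 \<notin> set R1" by (meson split_list_first)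
      have "1 # R1 @ [1] \<in> L" using bilang_prefix[OF L(1), of "1 # R1 @ [1]" "R2 @ [1]"] less.prems R by simp
      then obtain a where a: "a \<in> A3" "f a = 1 # R1" using blocks R(2) by blast
      have "1 # R2 @ [1] \<in> L" using bilang_suffix[OF L(1), of "1 # R1" "1 # R2 @ [1]"] less.prems R by simp
      then obtain u where "set u \<subseteq> A3" "morph_word f u = 1 # R2" using less.hyps[of R2] R by auto
      then show ?thesis using a R by (intro exI[of _ "a # u"]) simp
    qed
  qed
  have start: "\<exists>T. morph_word f u @ [1] = 1 # T" if "set u \<subseteq> A3" for u
    using marked_morph_word[OF f that] by (cases "u = []") auto
  show bil: "bilang L'"
    unfolding bilang_def
  proof (intro conjI ballI allI impI)
    fix u assume u: "u \<in> L'"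
    then show "set u \<subseteq> A3" unfolding L'_def by blast
    have ul: "set u \<subseteq> A3" "morph_word f u @ [1] \<in> L" using u unfolding L'_def by auto
    obtain P where P: "1 \<notin> set P" "1 # P @ morph_word f u @ [1] \<in> L" using left_marker[OF L A1 ul(2)] by blast
    obtain T where T: "morph_word f u @ [1] = 1 # T" using start[OF ul(1)] by blast
    have "1 # P @ [1] \<in> L" using bilang_prefix[OF L(1), of "1 # P @ [1]" T] P(2) T by simp
    then obtain a where a: "a \<in> A3" "f a = 1 # P" using blocks P(1) by blast
    obtain Q where Q: "1 \<notin> set Q" "(1 # P @ morph_word f u @ [1]) @ Q @ [1] \<in> L" using right_marker[OF L A1 P(2)] by blast
    have "1 # Q @ [1] \<in> L" using bilang_suffix[OF L(1), of "1 # P @ morph_word f u" "1 # Q @ [1]"] Q(2) by simp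
    then obtain b where b: "b \<in> A3" "f b = 1 # Q" using blocks Q(1) by blast
    have "a # u @ [b] \<in> L'" unfolding L'_def using a b ul(1) Q(2) by simp
    then show "\<exists>a b. a # u @ [b] \<in> L'" by blast
  next
    fix v w assume w: "w \<in> L'" and "sublist v w"
    then obtain p s where ps: "w = p @ v @ s" unfolding sublist_def by blast
    have wl: "set w \<subseteq> A3" "morph_word f w @ [1] \<in> L" using w unfolding L'_def by auto
    obtain T where T: "morph_word f s @ [1] = 1 # T" using start[of s] wl(1) ps by auto
    have "morph_word f w @ [1] = morph_word f p @ (morph_word f v @ [1]) @ T" unfolding ps using T by simp
    then have "morph_word f v @ [1] \<in> L" using bilang_append[OF L(1)] wl(2) by metis
    then show "v \<in> L'" unfolding L'_def using wl(1) ps by simp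
  next
    fix a assume "a \<in> A3"
    then show "[a] \<in> L'" using rb unfolding L'_def return_blocks_def by simp
  qed
  show "L = image_lang f L'"
  proof (intro set_eqI iffI)
    fix w assume w: "w \<in> L"
    obtain P where P: "1 # P @ w \<in> L" using left_marker[OF L A1 w] by blast
    obtain Q where Q: "(1 # P @ w) @ Q @ [1] \<in> L" using right_marker[OF L A1 P] by blast
    then obtain u where u: "set u \<subseteq> A3" "morph_word f u = 1 # P @ w @ Q" using decode[of "P @ w @ Q"] by auto
    then have "u \<in> L'" unfolding L'_def using Q by simp
    moreover have "sublist w (morph_word f u)" unfolding u(2) sublist_def by (metis append_Cons)
    ultimately show "w \<in> image_lang f L'" unfolding image_lang_def by blast
  next
    fix w assume "w \<in> image_lang f L'"
    then obtain u where u: "u \<in> L'" "sublist w (morph_word f u)" unfolding image_lang_def by blast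
    have "morph_word f u \<in> L" using u(1) bilang_prefix[OF L(1)] unfolding L'_def by blast
    then show "w \<in> L" using bilangD(2)[OF L(1)] u(2) by blast
  qed
  show "unif_rec L'"
    unfolding unif_rec_def
  proof
    fix u assume "u \<in> L'"
    then have u: "set u \<subseteq> A3" "morph_word f u @ [1] \<in> L" unfolding L'_def by auto
    obtain K where K: "\<forall>v\<in>L. K \<le> length v \<longrightarrow> sublist (morph_word f u @ [1]) v" using unif_recD[OF L(2) u(2)] by blast
    have "sublist u v" if v: "v \<in> L'" "K \<le> length v" for v
    proof -
      \<comment> \<open>One more letter supplies the marker after v; the occurrence of the blocks of
        u followed by 1 keeps its decoding within v.\<close>
      obtain e where e: "v @ [e] \<in> L'" using extend_right[OF bil v(1)] by blast
      then have sv: "set (v @ [e]) \<subseteq> A3" unfolding L'_def by blast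
      have vl: "morph_word f v @ [1] \<in> L" using v(1) unfolding L'_def by blast
      have "\<forall>a\<in>A3. 1 \<le> length (f a)" using f unfolding marked_def by (metis length_Cons le_add1 plus_1_eq_Suc)
      then have "1 * length v \<le> length (morph_word f v)" by (rule word_morph_length) (use sv in auto)
      then have "sublist (morph_word f u @ [1]) (morph_word f v @ [1])" using K vl v(2) by simp
      then obtain P Q where pq: "morph_word f v @ [1] = P @ (morph_word f u @ [1]) @ Q" unfolding sublist_def by blast
      have "e \<in> A3" using sv by simp
      then obtain t where t: "f e = 1 # t" using markedD[OF f] by blast
      have "morph_word f (v @ [e]) = (morph_word f v @ [1]) @ t" using t by simp
      then have m: "morph_word f (v @ [e]) = P @ morph_word f u @ 1 # (Q @ t)" unfolding pq by simp
      obtain T where T: "morph_word f u @ [1] = 1 # T" using start[OF u(1)] by blast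
      have m2: "morph_word f u @ 1 # (Q @ t) = 1 # T @ Q @ t"
      proof -
        have "morph_word f u @ 1 # (Q @ t) = (morph_word f u @ [1]) @ Q @ t" by simp
        then show ?thesis unfolding T by simp
      qed
      obtain v1 v2 where v12: "v @ [e] = v1 @ v2" "morph_word f v2 = morph_word f u @ 1 # (Q @ t)"
        using parse_at_marker[OF f sv, of P "T @ Q @ t"] m m2 by auto
      obtain v3 where v3: "v2 = u @ v3" "morph_word f v3 = 1 # (Q @ t)"
        using parse_prefix[OF f _ u(1), of v2 "Q @ t"] v12 sv by (metis Un_subset_iff set_append)
      obtain v4 y where "v3 = v4 @ [y]" using v3(2) by (cases v3 rule: rev_cases) auto
      then have "v = v1 @ u @ v4" using v12(1) v3(1) by simp
      then show ?thesis unfolding sublist_def by blast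
    qed
    then show "\<exists>K. \<forall>v\<in>L'. K \<le> length v \<longrightarrow> sublist u v" by blast
  qed
qed

subsection \<open>Labels of dendric languages\<close>

text \<open>By Koenig's lemma, applied to the prefix-closed set of common right contexts, a and b
  are adjacent when both can precede the same one-sided infinite word. The finite formulation avoids
  infinite words.\<close>

definition left_graph :: "nat list set \<Rightarrow> nat \<Rightarrow> nat \<Rightarrow> bool" where
  "left_graph L a b \<longleftrightarrow> (\<forall>m. \<exists>u. m \<le> length u \<and> a # u \<in> L \<and> b # u \<in> L)"

definition right_graph :: "nat list set \<Rightarrow> nat \<Rightarrow> nat \<Rightarrow> bool" where
  "right_graph L a b \<longleftrightarrow> (\<forall>m. \<exists>u. m \<le> length u \<and> u @ [a] \<in> L \<and> u @ [b] \<in> L)"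

lemma left_graph_sym: "left_graph L a b \<longleftrightarrow> left_graph L b a"
  unfolding left_graph_def by blast

lemma right_graph_sym: "right_graph L a b \<longleftrightarrow> right_graph L b a"
  unfolding right_graph_def by blast

lemma left_graph_rev: "left_graph (rev ` L) a b \<longleftrightarrow> right_graph L a b"
proof -
  have r: "w \<in> rev ` L \<longleftrightarrow> rev w \<in> L" for w by force
  have "(\<exists>u. m \<le> length u \<and> a # u \<in> rev ` L \<and> b # u \<in> rev ` L) \<longleftrightarrow> (\<exists>u. m \<le> length u \<and> u @ [a] \<in> L \<and> u @ [b] \<in> L)" for m
    unfolding r by (metis length_rev rev.simps(2) rev_rev_ident)
  then show ?thesis unfolding left_graph_def right_graph_def by simp
qed

lemma bilang_rev:
  assumes L: "bilang L"
  shows "bilang (rev ` L)"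
  unfolding bilang_def
proof (intro conjI ballI allI impI)
  fix w assume "w \<in> rev ` L"
  then obtain u where u: "w = rev u" "u \<in> L" by blast
  show "set w \<subseteq> A3" using bilangD(1)[OF L u(2)] u(1) by simp
  obtain a b where "a # u @ [b] \<in> L" using bilangD(3)[OF L u(2)] by blast
  then have "rev (a # u @ [b]) \<in> rev ` L" by blast
  then show "\<exists>a b. a # w @ [b] \<in> rev ` L" using u(1) by auto
next
  fix v w assume "w \<in> rev ` L" "sublist v w"
  then obtain u where u: "w = rev u" "u \<in> L" by blast
  have "sublist (rev v) u" using \<open>sublist v w\<close> u(1) by (metis rev_rev_ident sublist_rev)
  then have "rev v \<in> L" using bilangD(2)[OF L u(2)] by blast
  then show "v \<in> rev ` L" by (metis image_eqI rev_rev_ident)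
next
  fix a assume "a \<in> A3"
  then have "[a] \<in> L" using bilangD(4)[OF L] by blast
  then show "[a] \<in> rev ` L" by (metis image_eqI rev_singleton_conv)
qed

lemma dendric_rev:
  assumes "dendric_lang L"
  shows "dendric_lang (rev ` L)"
  unfolding dendric_lang_def
proof
  fix w assume "w \<in> rev ` L"
  then obtain u where u: "w = rev u" "u \<in> L" by blast
  have r: "w \<in> rev ` L \<longleftrightarrow> rev w \<in> L" for w by force
  have "exts (rev ` L) w = (exts L u)\<inverse>" unfolding exts_def r u(1) by auto
  then show "tree_rel (exts (rev ` L) w)" using assms u(2) tree_rel_converse unfolding dendric_lang_def by simp
qed

text \<open>If a has a partner before u, then connectedness of the extension graph of u gives a
  partner before some extension of u by one letter. The partner may change with the length, but only
  finitely many letters are available, so one of them serves for arbitrarily long words.\<close>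

lemma left_graph_no_isolated:
  assumes L: "bilang L" and d: "dendric_lang L"
  shows "no_isolated (left_graph L)"
  unfolding no_isolated_def
proof
  fix a assume a: "a \<in> A3"
  have lev: "\<exists>b\<in>A3. b \<noteq> a \<and> (\<exists>u. length u = m \<and> a # u \<in> L \<and> b # u \<in> L)" for m
  proof (induction m)
    case 0
    obtain b where "b \<in> A3" "b \<noteq> a" unfolding A3_def by (metis insertCI numeral_eq_iff semiring_norm(88))
    then show ?case using a bilangD(4)[OF L] by auto
  next
    case (Suc m)
    then obtain b u where b: "b \<in> A3" "b \<noteq> a" "length u = m" "a # u \<in> L" "b # u \<in> L" by blast
    have dom: "x # u \<in> L \<Longrightarrow> x \<in> Domain (exts L u)" for x
      using extend_right[OF L, of "x # u"] unfolding exts_def by auto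
    have "u \<in> L" using bilang_tl[OF L b(4)] .
    then have "linked (exts L u)" using d unfolding dendric_lang_def tree_rel_def by blast
    then have "share (exts L u) a b \<or> (\<exists>c. share (exts L u) a c \<and> share (exts L u) c b)"
      using dom b(4,5) unfolding linked_def by blast
    then obtain c where c: "c \<noteq> a" "share (exts L u) a c" using b(2) by metis
    then obtain e where "a # u @ [e] \<in> L" "c # u @ [e] \<in> L" unfolding share_def exts_def by blast
    moreover from this have "c \<in> A3" using bilangD(1)[OF L] by fastforce
    ultimately show ?case using c(1) b(3) by (intro bexI[of _ c] conjI exI[of _ "u @ [e]"]) auto
  qed
  show "\<exists>b\<in>A3. b \<noteq> a \<and> left_graph L a b"
  proof (rule ccontr)
    assume "\<not> ?thesis"
    then have "\<forall>b\<in>A3. \<exists>m. b \<noteq> a \<longrightarrow> (\<forall>u. m \<le> length u \<longrightarrow> \<not> (a # u \<in> L \<and> b # u \<in> L))"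
      unfolding left_graph_def by blast
    then obtain M where M: "\<And>b u. b \<in> A3 \<Longrightarrow> b \<noteq> a \<Longrightarrow> M b \<le> length u \<Longrightarrow> \<not> (a # u \<in> L \<and> b # u \<in> L)"
      by metis
    \<comment> \<open>The sum exceeds the bound of each letter, whichever partner appears at this
      length.\<close>
    obtain b u where b: "b \<in> A3" "b \<noteq> a" "length u = M 1 + M 2 + M 3" "a # u \<in> L" "b # u \<in> L" using lev by blast
    have "M b \<le> M 1 + M 2 + M 3" using b(1) A3_iff by auto
    then show False using M b by metis
  qed
qed

lemma right_graph_no_isolated:
  assumes L: "bilang L" and d: "dendric_lang L"
  shows "no_isolated (right_graph L)"
  using left_graph_no_isolated[OF bilang_rev[OF L] dendric_rev[OF d]] unfolding no_isolated_def left_graph_rev .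

context marked_image
begin

text \<open>The outer parts x and z contain no marker, so uniform recurrence bounds their lengths; a
  long word therefore has a long desubstituted core.\<close>

lemma long_core:
  assumes L: "bilang L" "unif_rec L" and m: "m \<in> A3"
  shows "\<exists>N. \<forall>x u z. N \<le> length (x @ morph_word f u @ m # z) \<longrightarrow> x @ morph_word f u @ m # z \<in> L \<longrightarrow>
     m \<notin> set x \<longrightarrow> m \<notin> set z \<longrightarrow> set u \<subseteq> A3 \<longrightarrow> n \<le> length u"
proof -
  obtain K where K: "\<forall>v\<in>L. K \<le> length v \<longrightarrow> sublist [m] v" using unif_recD[OF L(2) bilangD(4)[OF L(1) m]] by blast
  define B where "B = Max ((\<lambda>a. length (f a)) ` A3)"
  have B: "length (f a) \<le> B" if "a \<in> A3" for a unfolding B_def by (rule Max_ge) (use that in \<open>auto simp: A3_def\<close>)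
  have len: "length (morph_word f u) \<le> B * length u" if "set u \<subseteq> A3" for u
    using that by (induction u) (auto dest!: B)
  have "n \<le> length u" if l: "2 * K + 1 + B * n \<le> length (x @ morph_word f u @ m # z)" and w: "x @ morph_word f u @ m # z \<in> L"
    and x: "m \<notin> set x" "m \<notin> set z" and u: "set u \<subseteq> A3" for x u z
  proof (rule ccontr)
    assume "\<not> n \<le> length u"
    then have "B * length u \<le> B * n" by simp
    then have a: "length (morph_word f u) \<le> B * n" using len[OF u] by linarith
    have "x \<in> L" using bilang_prefix[OF L(1) w] .
    then have b: "length x < K" using K x(1) unfolding sublist_singleton by (meson not_le)
    have "z \<in> L" using bilang_suffix[OF L(1), of "x @ morph_word f u @ [m]" z] w by simp
    then have c: "length z < K" using K x(2) unfolding sublist_singleton by (meson not_le)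
    show False using l a b c by simp
  qed
  then show ?thesis by blast
qed

lemma pair_bound:
  assumes "\<And>a b. a \<in> A3 \<Longrightarrow> b \<in> A3 \<Longrightarrow> P a b \<Longrightarrow> \<exists>m. \<forall>u. m \<le> length u \<longrightarrow> \<not> Q a b u"
  shows "\<exists>m. \<forall>a\<in>A3. \<forall>b\<in>A3. P a b \<longrightarrow> (\<forall>u. m \<le> length u \<longrightarrow> \<not> Q a b u)"
proof -
  have "\<forall>a b. \<exists>m. a \<in> A3 \<longrightarrow> b \<in> A3 \<longrightarrow> P a b \<longrightarrow> (\<forall>u. m \<le> length u \<longrightarrow> \<not> Q a b u)" using assms by blast
  then obtain M where M: "\<And>a b u. a \<in> A3 \<Longrightarrow> b \<in> A3 \<Longrightarrow> P a b \<Longrightarrow> M a b \<le> length u \<Longrightarrow> \<not> Q a b u" by metis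
  define m where "m = Max ((\<lambda>(a,b). M a b) ` (A3 \<times> A3))"
  have "M a b \<le> m" if "a \<in> A3" "b \<in> A3" for a b
    unfolding m_def by (rule Max_ge) (use that in \<open>auto simp: A3_def\<close>)
  then show ?thesis using M by (metis le_trans)
qed

text \<open>A common long right context of a and b is parsed, and its core is a common context of
  two letters a', b' carried to a, b by one extension map. The letters and the map depend on the
  context, but if every possible pair failed, a uniform bound on the cores would exist and
  \<open>long_core\<close> would contradict it.\<close>

lemma left_graph_descends:
  assumes L: "bilang L" "unif_rec L" and m: "m \<in> A3" and g: "left_graph L a b"
  shows "\<exists>R\<in>left_rels m f. \<exists>a' b'. (a',a) \<in> R \<and> (b',b) \<in> R \<and> left_graph L' a' b'"
proof (rule ccontr)
  assume no: "\<not> ?thesis"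
  define P where "P a' b' = (\<exists>R\<in>left_rels m f. (a',a) \<in> R \<and> (b',b) \<in> R)" for a' b'
  define Q where "Q a' b' u = (a' # u \<in> L' \<and> b' # u \<in> L')" for a' b' u
  have "\<exists>n. \<forall>u. n \<le> length u \<longrightarrow> \<not> Q a' b' u" if "a' \<in> A3" "b' \<in> A3" "P a' b'" for a' b'
  proof -
    have "\<not> left_graph L' a' b'" using no that(3) unfolding P_def by blast
    then show ?thesis unfolding left_graph_def Q_def by blast
  qed
  from pair_bound[of P Q, OF this]
  obtain n where n: "\<And>a' b' u. a' \<in> A3 \<Longrightarrow> b' \<in> A3 \<Longrightarrow> P a' b' \<Longrightarrow> n \<le> length u \<Longrightarrow> \<not> Q a' b' u" by blast
  obtain N where N: "\<And>x u z. N \<le> length (x @ morph_word f u @ m # z) \<Longrightarrow> x @ morph_word f u @ m # z \<in> L \<Longrightarrow>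
     m \<notin> set x \<Longrightarrow> m \<notin> set z \<Longrightarrow> set u \<subseteq> A3 \<Longrightarrow> n \<le> length u" using long_core[OF L m] by blast
  obtain K where K: "\<forall>v\<in>L. K \<le> length v \<longrightarrow> sublist [m] v" using unif_recD[OF L(2) bilangD(4)[OF L(1) m]] by blast
  obtain w where w: "N + K \<le> length w" "a # w \<in> L" "b # w \<in> L" using g unfolding left_graph_def by blast
  have wL: "w \<in> L" using bilang_tl[OF L(1) w(2)] .
  have "m \<in> set w" using K wL w(1) unfolding sublist_singleton by simp
  then obtain x u z where p: "w = x @ morph_word f u @ m # z" "m \<notin> set x" "m \<notin> set z" "set u \<subseteq> A3"
    using parse_word[OF wL] by blast
  have nu: "n \<le> length u" using N[of x u z] p w(1) wL by simp
  have left: "\<exists>c'. (c',c) \<in> suffix_rel f x \<and> c' # u \<in> L'" if c: "c # w \<in> L" for c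
  proof -
    obtain d where "c # w @ [d] \<in> L" using extend_right[OF L(1) c] by auto
    then have "(c,d) \<in> exts L (x @ morph_word f u @ m # z)" unfolding exts_def p(1) by simp
    then obtain a' b' where "a' \<in> A3" "suffix (c # x) (f a')" "a' # u @ [b'] \<in> L'" unfolding exts_parsed[OF p(4,2,3)] by blast
    then show ?thesis using bilang_prefix[OF L', of "a' # u" "[b']"] unfolding suffix_rel_def by auto
  qed
  obtain a' b' where ab: "(a',a) \<in> suffix_rel f x" "a' # u \<in> L'" "(b',b) \<in> suffix_rel f x" "b' # u \<in> L'" using left[OF w(2)] left[OF w(3)] by blast
  have "suffix_rel f x \<in> left_rels m f" unfolding left_rels_def using p(2) by blast
  then have "P a' b'" unfolding P_def using ab by blast
  moreover have "a' \<in> A3" "b' \<in> A3" using ab unfolding suffix_rel_def by auto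
  ultimately show False using n nu ab(2,4) unfolding Q_def by blast
qed

lemma right_graph_descends:
  assumes L: "bilang L" "unif_rec L" and m: "m \<in> A3" and g: "right_graph L a b"
  shows "\<exists>R\<in>right_rels m f. \<exists>a' b'. (a',a) \<in> R \<and> (b',b) \<in> R \<and> right_graph L' a' b'"
proof (rule ccontr)
  assume no: "\<not> ?thesis"
  define P where "P a' b' = (\<exists>R\<in>right_rels m f. (a',a) \<in> R \<and> (b',b) \<in> R)" for a' b'
  define Q where "Q a' b' u = (u @ [a'] \<in> L' \<and> u @ [b'] \<in> L')" for a' b' u
  have "\<exists>n. \<forall>u. n \<le> length u \<longrightarrow> \<not> Q a' b' u" if "a' \<in> A3" "b' \<in> A3" "P a' b'" for a' b'
  proof -
    have "\<not> right_graph L' a' b'" using no that(3) unfolding P_def by blast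
    then show ?thesis unfolding right_graph_def Q_def by blast
  qed
  from pair_bound[of P Q, OF this]
  obtain n where n: "\<And>a' b' u. a' \<in> A3 \<Longrightarrow> b' \<in> A3 \<Longrightarrow> P a' b' \<Longrightarrow> n \<le> length u \<Longrightarrow> \<not> Q a' b' u" by blast
  obtain N where N: "\<And>x u z. N \<le> length (x @ morph_word f u @ m # z) \<Longrightarrow> x @ morph_word f u @ m # z \<in> L \<Longrightarrow>
     m \<notin> set x \<Longrightarrow> m \<notin> set z \<Longrightarrow> set u \<subseteq> A3 \<Longrightarrow> n \<le> length u" using long_core[OF L m] by blast
  obtain K where K: "\<forall>v\<in>L. K \<le> length v \<longrightarrow> sublist [m] v" using unif_recD[OF L(2) bilangD(4)[OF L(1) m]] by blast
  obtain w where w: "N + K \<le> length w" "w @ [a] \<in> L" "w @ [b] \<in> L" using g unfolding right_graph_def by blast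
  have wL: "w \<in> L" using bilang_prefix[OF L(1) w(2)] .
  have "m \<in> set w" using K wL w(1) unfolding sublist_singleton by simp
  then obtain x u z where p: "w = x @ morph_word f u @ m # z" "m \<notin> set x" "m \<notin> set z" "set u \<subseteq> A3"
    using parse_word[OF wL] by blast
  have nu: "n \<le> length u" using N[of x u z] p w(1) wL by simp
  let ?R = "suffix_rel (\<lambda>b. rev (f b @ [m])) (rev z @ [m])"
  have right: "\<exists>c'. (c',c) \<in> ?R \<and> u @ [c'] \<in> L'" if c: "w @ [c] \<in> L" for c
  proof -
    obtain d where "d # w @ [c] \<in> L" using extend_left[OF L(1) c] by auto
    then have "(d,c) \<in> exts L (x @ morph_word f u @ m # z)" unfolding exts_def p(1) by simp
    then obtain a' b' where "b' \<in> A3" "prefix (m # z @ [c]) (f b' @ [m])" "a' # u @ [b'] \<in> L'" unfolding exts_parsed[OF p(4,2,3)] by blast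
    then show ?thesis using bilang_tl[OF L', of a' "u @ [b']"] unfolding suffix_rel_def prefix_rev_suffix by (auto simp del: rev_append)
  qed
  obtain a' b' where ab: "(a',a) \<in> ?R" "u @ [a'] \<in> L'" "(b',b) \<in> ?R" "u @ [b'] \<in> L'" using right[OF w(2)] right[OF w(3)] by blast
  have "m \<notin> set (rev z)" using p(3) by simp
  then have "?R \<in> right_rels m f" unfolding right_rels_def by blast
  then have "P a' b'" unfolding P_def using ab by blast
  moreover have "a' \<in> A3" "b' \<in> A3" using ab unfolding suffix_rel_def by auto
  ultimately show False using n nu ab(2,4) unfolding Q_def by blast
qed

lemma image_word: "u \<in> L' \<Longrightarrow> sublist w (morph_word f u) \<Longrightarrow> w \<in> L"
  unfolding img image_lang_def by blast

lemma length_image: "set u \<subseteq> A3 \<Longrightarrow> length u \<le> length (morph_word f u)"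
  by (induction u) (auto dest!: markedD[OF f])

text \<open>When the identity is among the extension maps, a fixed suffix x leads each letter back
  to itself, so common contexts in L' lift to common contexts in L. This supplies the reverse
  inclusion that \<open>step_labels\<close> asks for in the unlabelled case.\<close>

lemma left_graph_ascends:
  assumes F: "Id_on A3 \<in> left_rels m f" and ab: "a \<in> A3" "b \<in> A3" and g: "left_graph L' a b"
  shows "left_graph L a b"
  unfolding left_graph_def
proof
  fix n
  obtain x where x: "suffix_rel f x = Id_on A3" using F unfolding left_rels_def by force
  have suf: "suffix (c # x) (f c)" if "c \<in> A3" for c
  proof -
    have "(c,c) \<in> suffix_rel f x" unfolding x using that by blast
    then show ?thesis unfolding suffix_rel_def by blast
  qed
  obtain u where u: "n \<le> length u" "a # u \<in> L'" "b # u \<in> L'" using g unfolding left_graph_def by blast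
  have in_L: "c # x @ morph_word f u \<in> L" if c: "c \<in> A3" "c # u \<in> L'" for c
  proof (rule image_word[OF c(2)])
    obtain y where "f c = y @ c # x" using suf[OF c(1)] unfolding suffix_def by blast
    then have "morph_word f (c # u) = y @ (c # x @ morph_word f u) @ []" by simp
    then show "sublist (c # x @ morph_word f u) (morph_word f (c # u))" unfolding sublist_def by blast
  qed
  have "set u \<subseteq> A3" using bilangD(1)[OF L' u(2)] by simp
  then have "n \<le> length (x @ morph_word f u)" using length_image u(1) by fastforce
  then show "\<exists>v. n \<le> length v \<and> a # v \<in> L \<and> b # v \<in> L" using in_L[OF ab(1) u(2)] in_L[OF ab(2) u(3)] by blast
qed

lemma right_graph_ascends:
  assumes F: "Id_on A3 \<in> right_rels m f" and ab: "a \<in> A3" "b \<in> A3" and g: "right_graph L' a b"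
  shows "right_graph L a b"
  unfolding right_graph_def
proof
  fix n
  obtain x where x: "suffix_rel (\<lambda>b. rev (f b @ [m])) (x @ [m]) = Id_on A3" using F unfolding right_rels_def by force
  have pre: "prefix (m # rev x @ [c]) (f c @ [m])" if "c \<in> A3" for c
  proof -
    have "(c,c) \<in> suffix_rel (\<lambda>b. rev (f b @ [m])) (x @ [m])" unfolding x using that by blast
    then have "suffix (c # x @ [m]) (rev (f c @ [m]))" unfolding suffix_rel_def by (simp del: rev_append)
    then show ?thesis unfolding prefix_rev_suffix by (simp del: rev_append)
  qed
  obtain u where u: "n \<le> length u" "u @ [a] \<in> L'" "u @ [b] \<in> L'" using g unfolding right_graph_def by blast
  have in_L: "morph_word f u @ m # rev x @ [c] \<in> L" if c: "c \<in> A3" "u @ [c] \<in> L'" for c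
  proof -
    obtain e where e: "u @ [c,e] \<in> L'" using extend_right[OF L' c(2)] by auto
    then have "e \<in> A3" using bilangD(1)[OF L' e] by simp
    then obtain t where t: "f e = m # t" using markedD[OF f] by blast
    obtain y where y: "f c @ [m] = (m # rev x @ [c]) @ y" using pre[OF c(1)] unfolding prefix_def by blast
    have "morph_word f (u @ [c,e]) = morph_word f u @ (f c @ [m]) @ t" using t by simp
    also have "\<dots> = [] @ (morph_word f u @ m # rev x @ [c]) @ (y @ t)" unfolding y by simp
    finally have "sublist (morph_word f u @ m # rev x @ [c]) (morph_word f (u @ [c,e]))" unfolding sublist_def by blast
    then show ?thesis by (rule image_word[OF e])
  qed
  have "set u \<subseteq> A3" using bilangD(1)[OF L' u(2)] by simp
  then have "n \<le> length (morph_word f u @ m # rev x)" using length_image u(1) by fastforce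
  then show "\<exists>v. n \<le> length v \<and> v @ [a] \<in> L \<and> v @ [b] \<in> L" using in_L[OF ab(1) u(2)] in_L[OF ab(2) u(3)] by (intro exI[of _ "morph_word f u @ m # rev x"]) simp
qed

end

section \<open>Constructing one edge of the path\<close>

definition labelled :: "nat list set \<Rightarrow> nat \<times> nat \<Rightarrow> bool" where
  "labelled L v \<longleftrightarrow> bilang L \<and> unif_rec L \<and> dendric_lang L \<and> labels (fst v) (left_graph L) \<and> labels (snd v) (right_graph L)"

lemma ex_labelled:
  assumes "bilang L" "unif_rec L" "dendric_lang L"
  shows "\<exists>v. labelled L v"
proof -
  obtain l where "labels l (left_graph L)"
    using ex_label[of "left_graph L", OF left_graph_sym left_graph_no_isolated[OF assms(1,3)]] by blast
  moreover obtain r where "labels r (right_graph L)"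
    using ex_label[of "right_graph L", OF right_graph_sym right_graph_no_isolated[OF assms(1,3)]] by blast
  ultimately have "labelled L (l,r)" using assms unfolding labelled_def by simp
  then show ?thesis by blast
qed

lemma permute_unif_rec:
  assumes p: "p \<in> Sigma3" and u: "unif_rec L"
  shows "unif_rec (permute_lang p L)"
  unfolding unif_rec_def
proof
  fix w assume "w \<in> permute_lang p L"
  then obtain x where x: "w = map p x" "x \<in> L" unfolding permute_lang_def by blast
  obtain K where K: "\<forall>v\<in>L. K \<le> length v \<longrightarrow> sublist x v" using unif_recD[OF u x(2)] by blast
  have "sublist w v" if v: "v \<in> permute_lang p L" "K \<le> length v" for v
  proof -
    obtain y where y: "v = map p y" "y \<in> L" using v(1) unfolding permute_lang_def by blast
    then have "sublist x y" using K v(2) by simp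
    then show ?thesis unfolding x(1) y(1) sublist_map by blast
  qed
  then show "\<exists>K. \<forall>v\<in>permute_lang p L. K \<le> length v \<longrightarrow> sublist w v" by blast
qed

lemma permute_dendric:
  assumes p: "p \<in> Sigma3" and d: "dendric_lang L"
  shows "dendric_lang (permute_lang p L)"
  unfolding dendric_lang_def
proof
  fix w assume "w \<in> permute_lang p L"
  then obtain x where x: "w = map p x" "x \<in> L" unfolding permute_lang_def by blast
  have "tree_rel (exts L x)" using d x(2) unfolding dendric_lang_def by blast
  then show "tree_rel (exts (permute_lang p L) w)" unfolding x(1) by (rule tree_rel_permute[OF p exts_permute[OF p]])
qed

lemma labels_permute:
  assumes p: "p \<in> Sigma3" and G: "\<And>a b. G' (p a) (p b) \<longleftrightarrow> G a b" and l: "labels l G"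
  shows "labels (p l) G'"
  unfolding labels_def
proof (intro conjI ballI impI)
  have "l \<in> {0} \<union> A3" using l unfolding labels_def by (rule conjunct1)
  then show "p l \<in> {0} \<union> A3" unfolding Sigma3_labels[OF p] .
  fix a b assume ab: "a \<in> A3" "b \<in> A3" "a \<noteq> b"
  have 1: "G' a b \<longleftrightarrow> G (inv p a) (inv p b)" using G[of "inv p a" "inv p b"] unfolding Sigma3D(4)[OF p] .
  have "inv p a \<in> A3" "inv p b \<in> A3" using Sigma3D(1)[OF Sigma3D(6)[OF p]] ab by blast+
  moreover have "inv p a \<noteq> inv p b" using ab(3) Sigma3D(4)[OF p] by metis
  ultimately have 2: "G (inv p a) (inv p b) \<longleftrightarrow> l = 0 \<or> l = inv p a \<or> l = inv p b" using l unfolding labels_def by blast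
  have "p l = 0 \<longleftrightarrow> l = 0" "p l = a \<longleftrightarrow> l = inv p a" "p l = b \<longleftrightarrow> l = inv p b"
    using Sigma3D(2,4,5)[OF p] by metis+
  then show "G' a b \<longleftrightarrow> p l = 0 \<or> p l = a \<or> p l = b" using 1 2 by blast
qed

lemma left_graph_permute:
  assumes p: "p \<in> Sigma3"
  shows "left_graph (permute_lang p L) (p a) (p b) \<longleftrightarrow> left_graph L a b"
proof -
  have "(\<exists>u. n \<le> length u \<and> p a # u \<in> permute_lang p L \<and> p b # u \<in> permute_lang p L) \<longleftrightarrow> (\<exists>u. n \<le> length u \<and> a # u \<in> L \<and> b # u \<in> L)" for n
  proof
    assume "\<exists>u. n \<le> length u \<and> p a # u \<in> permute_lang p L \<and> p b # u \<in> permute_lang p L"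
    then obtain u where u: "n \<le> length u" "p a # u \<in> permute_lang p L" "p b # u \<in> permute_lang p L" by blast
    have "map p (a # map (inv p) u) \<in> permute_lang p L" "map p (b # map (inv p) u) \<in> permute_lang p L"
      using u map_inv(1)[OF p] by simp_all
    then have "a # map (inv p) u \<in> L" "b # map (inv p) u \<in> L" unfolding map_in_permute[OF p] .
    then show "\<exists>u. n \<le> length u \<and> a # u \<in> L \<and> b # u \<in> L" using u(1) by (intro exI[of _ "map (inv p) u"]) simp
  next
    assume "\<exists>u. n \<le> length u \<and> a # u \<in> L \<and> b # u \<in> L"
    then obtain u where u: "n \<le> length u" "a # u \<in> L" "b # u \<in> L" by blast
    then have "map p (a # u) \<in> permute_lang p L" "map p (b # u) \<in> permute_lang p L" unfolding map_in_permute[OF p] by auto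
    then show "\<exists>u. n \<le> length u \<and> p a # u \<in> permute_lang p L \<and> p b # u \<in> permute_lang p L"
      using u(1) by (intro exI[of _ "map p u"]) simp
  qed
  then show ?thesis unfolding left_graph_def by simp
qed

lemma permute_rev: "rev ` permute_lang p L = permute_lang p (rev ` L)"
  unfolding permute_lang_def by (simp add: image_image rev_map)

lemma right_graph_permute:
  assumes p: "p \<in> Sigma3"
  shows "right_graph (permute_lang p L) (p a) (p b) \<longleftrightarrow> right_graph L a b"
  unfolding left_graph_rev[symmetric] permute_rev by (rule left_graph_permute[OF p])

lemma labelled_permute:
  assumes p: "p \<in> Sigma3" and l: "labelled L v"
  shows "labelled (permute_lang p L) (p (fst v), p (snd v))"
  using l permute_bilang[OF p] permute_unif_rec[OF p] permute_dendric[OF p]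
    labels_permute[where G' = "left_graph (permute_lang p L)", OF p left_graph_permute[OF p]]
    labels_permute[where G' = "right_graph (permute_lang p L)", OF p right_graph_permute[OF p]]
  unfolding labelled_def fst_conv snd_conv by blast

lemma ex_perm_two:
  assumes "a \<in> A3" "b \<in> A3" "a \<noteq> b"
  shows "\<exists>p\<in>Sigma3. p 3 = a \<and> p 2 = b"
proof -
  obtain c where c: "c \<in> A3" "distinct [c,b,a]"
  proof -
    have "\<exists>c\<in>{1,2,3}. c \<noteq> a \<and> c \<noteq> b" by (cases "a = 1 \<or> b = 1"; cases "a = 2 \<or> b = 2") auto
    then show ?thesis using that assms(3) unfolding A3_def by auto
  qed
  then have "perm3 c b a \<in> Sigma3" using perm3_Sigma3 assms by blast
  then show ?thesis by (intro bexI[of _ "perm3 c b a"]) (simp add: perm3_def)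
qed

text \<open>Renaming acts simultaneously on both labels, and the sixteen pairs fall into five
  orbits: both labels 0, only the left one 0, only the right one 0, equal letters, different
  letters. \<open>Gvertices\<close> contains one pair from each.\<close>

lemma ex_Gvertex:
  assumes "l \<in> {0} \<union> A3" "r \<in> {0} \<union> A3"
  shows "\<exists>p\<in>Sigma3. \<exists>v\<in>Gvertices. p (fst v) = l \<and> p (snd v) = r"
proof -
  have one: "\<exists>p\<in>Sigma3. p 3 = a" if "a \<in> A3" for a
  proof -
    obtain b where "b \<in> A3" "b \<noteq> a" unfolding A3_def by (metis insertCI numeral_eq_iff semiring_norm(88))
    then show ?thesis using ex_perm_two[OF that] by blast
  qed
  have G: "(0,0) \<in> Gvertices" "(0,3) \<in> Gvertices" "(3,0) \<in> Gvertices" "(3,2) \<in> Gvertices" "(3,3) \<in> Gvertices"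
    unfolding Gvertices_def by auto
  consider "l = 0" "r = 0" | "l = 0" "r \<in> A3" | "l \<in> A3" "r = 0" | "l \<in> A3" "r = l" | "l \<in> A3" "r \<in> A3" "l \<noteq> r"
    using assms by blast
  then show ?thesis
  proof cases
    case 1
    obtain p where "p \<in> Sigma3" using one[of 1] by (auto simp: A3_def)
    then show ?thesis using 1 G(1) Sigma3D(2) by (metis fst_conv snd_conv)
  next
    case 2
    obtain p where "p \<in> Sigma3" "p 3 = r" using one[OF 2(2)] by blast
    then show ?thesis using 2 G(2) Sigma3D(2) by (metis fst_conv snd_conv)
  next
    case 3
    obtain p where "p \<in> Sigma3" "p 3 = l" using one[OF 3(1)] by blast
    then show ?thesis using 3 G(3) Sigma3D(2) by (metis fst_conv snd_conv)
  next
    case 4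
    obtain p where "p \<in> Sigma3" "p 3 = l" using one[OF 4(1)] by blast
    then show ?thesis using 4 G(5) by (metis fst_conv snd_conv)
  next
    case 5
    obtain p where "p \<in> Sigma3" "p 3 = l" "p 2 = r" using ex_perm_two[OF 5] by blast
    then show ?thesis using G(4) by (metis fst_conv snd_conv)
  qed
qed

lemma normalize_labels:
  assumes "labelled L v"
  shows "\<exists>p\<in>Sigma3. \<exists>v'\<in>Gvertices. v = (p (fst v'), p (snd v')) \<and> labelled (permute_lang (inv p) L) v'"
proof -
  have "fst v \<in> {0} \<union> A3" "snd v \<in> {0} \<union> A3" using assms unfolding labelled_def labels_def by blast+
  from ex_Gvertex[OF this] obtain p v' where p: "p \<in> Sigma3" "v' \<in> Gvertices" "p (fst v') = fst v" "p (snd v') = snd v" by blast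
  have "labelled (permute_lang (inv p) L) (inv p (fst v), inv p (snd v))"
    by (rule labelled_permute[OF Sigma3D(6)[OF p(1)] assms])
  moreover have "(inv p (fst v), inv p (snd v)) = v'" using p(3,4) Sigma3D(5)[OF p(1)] by (metis prod.collapse)
  ultimately have "labelled (permute_lang (inv p) L) v'" by simp
  moreover have "v = (p (fst v'), p (snd v'))" using p(3,4) by simp
  ultimately show ?thesis using p(1,2) by blast
qed

lemma ex_normal_form:
  assumes L: "bilang L" "unif_rec L" "dendric_lang L"
  shows "\<exists>p\<in>Sigma3. \<exists>s. S3_valid s \<and> return_blocks (S3_morph s) (permute_lang (inv p) L)"
proof -
  have t: "tree_rel (exts L [])" using L(3) Nil_in_bilang[OF L(1)] unfolding dendric_lang_def by blast
  have "\<exists>p\<in>Sigma3. pair_table (\<lambda>i j. (p i, p j) \<in> exts L []) \<in> form_table"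
    by (rule tree_forms[OF exts_subset[OF L(1)] t]) (rule exit_pair[OF L(1,2)])
  then obtain p where p: "p \<in> Sigma3" "pair_table (\<lambda>i j. (p i, p j) \<in> exts L []) \<in> form_table" by blast
  note q = Sigma3D(6)[OF p(1)]
  have "[i,j] \<in> permute_lang (inv p) L \<longleftrightarrow> (p i, p j) \<in> exts L []" for i j
    using map_in_permute[OF q, of "[p i, p j]" L] Sigma3D(5)[OF p(1)] unfolding exts_def by simp
  then have "pair_table (\<lambda>i j. [i,j] \<in> permute_lang (inv p) L) \<in> form_table" using p(2) by simp
  from return_blocks_of_form[OF permute_bilang[OF q L(1)] permute_unif_rec[OF q L(2)] permute_dendric[OF q L(3)] this]
  show ?thesis using p(1) by blast
qed

text \<open>Two renamings arise for different reasons: p brings the two-letter words of L into one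
  of the six forms, and p' brings the labels of the preimage to a vertex. The labels on both ends
  are intrinsic to the languages, so the edge condition is not arranged but forced by
  \<open>step_labels\<close>.\<close>

lemma labelled_step:
  assumes l: "labelled L v" and v: "v \<in> Gvertices"
  shows "\<exists>f L' v'. G_edge v f v' \<and> L = image_lang f L' \<and> labelled L' v'"
proof -
  have L: "bilang L" "unif_rec L" "dendric_lang L" using l unfolding labelled_def by blast+
  obtain p s where p: "p \<in> Sigma3" and s: "S3_valid s" and rb: "return_blocks (S3_morph s) (permute_lang (inv p) L)"
    using ex_normal_form[OF L] by blast
  note q = Sigma3D(6)[OF p]
  define M where "M = permute_lang (inv p) L"
  have lM: "labelled M (inv p (fst v), inv p (snd v))" unfolding M_def by (rule labelled_permute[OF q l])
  have M: "bilang M" "unif_rec M" "dendric_lang M" using lM unfolding labelled_def by blast+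
  have LM: "L = permute_lang p M" unfolding M_def permute_inv(1)[OF p] ..
  note mk = S3_morph_marked[OF s]
  obtain M' where M': "bilang M'" "unif_rec M'" "M = image_lang (S3_morph s) M'"
    using desubstitute[OF M(1,2) mk rb[folded M_def]] by blast
  interpret marked_image 1 "S3_morph s" M' M by unfold_locales (use mk M' in auto)
  have A1: "(1::nat) \<in> A3" by (simp add: A3_def)
  note F = left_rels_S3[OF s] and F' = right_rels_S3[OF s]
  have d: "dendric_lang M'"
    unfolding dendric_lang_def using dendric_preimage[OF F F' _ M(1)] M(3) unfolding dendric_lang_def by blast
  obtain v1 where v1: "labelled M' v1" using ex_labelled[OF M'(1,2) d] by blast
  have "label_step (kind_left s) (fst v1) (inv p (fst v))"
  proof (rule step_labels[OF F left_graph_sym left_graph_sym left_graph_no_isolated[OF M(1,3)]])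
    show "labels (fst v1) (left_graph M')" using v1 unfolding labelled_def by blast
    show "labels (inv p (fst v)) (left_graph M)" using lM unfolding labelled_def by simp
    show "left_graph M a b \<Longrightarrow> \<exists>R\<in>left_rels 1 (S3_morph s). \<exists>a' b'. (a',a) \<in> R \<and> (b',b) \<in> R \<and> left_graph M' a' b'" for a b
      by (rule left_graph_descends[OF M(1,2) A1])
    show "left_graph M a b" if "kind_left s = None" "a \<in> A3" "b \<in> A3" "left_graph M' a b" for a b
      using left_graph_ascends[OF _ that(2-4)] F that(1) by simp
  qed
  moreover have "label_step (kind_right s) (snd v1) (inv p (snd v))"
  proof (rule step_labels[OF F' right_graph_sym right_graph_sym right_graph_no_isolated[OF M(1,3)]])
    show "labels (snd v1) (right_graph M')" using v1 unfolding labelled_def by blast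
    show "labels (inv p (snd v)) (right_graph M)" using lM unfolding labelled_def by simp
    show "right_graph M a b \<Longrightarrow> \<exists>R\<in>right_rels 1 (S3_morph s). \<exists>a' b'. (a',a) \<in> R \<and> (b',b) \<in> R \<and> right_graph M' a' b'" for a b
      by (rule right_graph_descends[OF M(1,2) A1])
    show "right_graph M a b" if "kind_right s = None" "a \<in> A3" "b \<in> A3" "right_graph M' a b" for a b
      using right_graph_ascends[OF _ that(2-4)] F' that(1) by simp
  qed
  ultimately have im: "S3_image s v1 = Some (inv p (fst v), inv p (snd v))" using S3_image_step by (metis prod.collapse)
  obtain p' v' where p': "p' \<in> Sigma3" "v' \<in> Gvertices" "v1 = (p' (fst v'), p' (snd v'))" "labelled (permute_lang (inv p') M') v'"
    using normalize_labels[OF v1] by blast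
  define f where "f = morph_comp (perm_morph p) (morph_comp (S3_morph s) (perm_morph p'))"
  have "L = image_lang f (permute_lang (inv p') M')"
    unfolding f_def image_lang_comp permute_inv(1)[OF p'(1)] M'(3)[symmetric] by (rule LM)
  moreover have "G_edge v f v'" unfolding G_edge_def f_def using v p'(1,2) p s im unfolding p'(3) by blast
  ultimately show ?thesis using p'(4) by blast
qed

lemma edge_marked:
  assumes "G_edge v f v'"
  shows "\<exists>k. marked k f"
proof -
  obtain p s p' where p: "p \<in> Sigma3" "p' \<in> Sigma3" "S3_valid s"
    and f: "f = morph_comp (perm_morph p) (morph_comp (S3_morph s) (perm_morph p'))"
    using assms unfolding G_edge_def by blast
  note mk = S3_morph_marked[OF p(3)]
  have fa: "f a = map p (S3_morph s (p' a))" for a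
    unfolding f morph_comp_def morph_word_perm by (simp add: perm_morph_def)
  have "inj_on f A3"
  proof (rule inj_onI)
    fix a b assume ab: "a \<in> A3" "b \<in> A3" "f a = f b"
    then have "S3_morph s (p' a) = S3_morph s (p' b)" unfolding fa using Sigma3D(3)[OF p(1)] by simp
    moreover have "p' a \<in> A3" "p' b \<in> A3" using ab Sigma3D(1)[OF p(2)] by blast+
    ultimately have "p' a = p' b" using mk unfolding marked_def inj_on_def by blast
    then show "a = b" using Sigma3D(3)[OF p(2)] by (simp add: inj_eq)
  qed
  moreover have "\<exists>t. f a = p 1 # t \<and> p 1 \<notin> set t \<and> set (f a) \<subseteq> A3" if a: "a \<in> A3" for a
  proof -
    have "p' a \<in> A3" using a Sigma3D(1)[OF p(2)] by blast
    then obtain t where t: "S3_morph s (p' a) = 1 # t" "1 \<notin> set t" "set (S3_morph s (p' a)) \<subseteq> A3" using mk unfolding marked_def by blast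
    have "p 1 \<notin> set (map p t)" using t(2) Sigma3D(3)[OF p(1)] by (auto simp: inj_eq)
    moreover have "set (f a) \<subseteq> A3" unfolding fa using t(3) Sigma3D(1)[OF p(1)] by auto
    ultimately show ?thesis unfolding fa t(1) by (intro exI[of _ "map p t"]) simp
  qed
  ultimately have "marked (p 1) f" unfolding marked_def by blast
  then show ?thesis by blast
qed

subsection \<open>From minimal dendric shifts to paths\<close>

text \<open>Only the levels from 1 on form such a tower, since the initial renaming is not marked:
  its blocks begin with different letters.\<close>

locale marked_tower =
  fixes t :: "nat \<Rightarrow> morph" and L :: "nat \<Rightarrow> nat list set" and k :: "nat \<Rightarrow> nat"
  assumes bil: "bilang (L n)" and ur: "unif_rec (L n)" and img: "L n = image_lang (t n) (L (Suc n))"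
    and mk: "marked (k n) (t n)"
begin

lemma marked_words: "word_morph (t n)"
  using mk[of n] unfolding marked_def word_morph_def by fastforce

lemma comp_words: "word_morph (comp_seq t n N)"
  by (rule word_morph_comp_seq[OF marked_words])

lemma comp_in_L: "u \<in> L (n + N) \<Longrightarrow> morph_word (comp_seq t n N) u \<in> L n"
proof (induction N arbitrary: u)
  case 0
  then show ?case by (simp add: morph_word_id)
next
  case (Suc N)
  have "morph_word (t (n + N)) u \<in> L (n + N)"
    unfolding img[of "n + N"] image_lang_def using Suc.prems by auto
  then show ?case using Suc.IH by (simp add: morph_word_comp)
qed

lemma comp_letter_in_L: "a \<in> A3 \<Longrightarrow> comp_seq t n N a \<in> L n"
  using comp_in_L[of "[a]" n N] bilangD(4)[OF bil] by simp

text \<open>Suppose that at every level some letter keeps an image of length one. Its block is then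
  the bare marker, which again has an image of length one, so the markers are the letters that never
  grow. A block of any other letter continues after the marker with a letter different from it, and
  iterating this piles up copies of the marker of level n, against uniform recurrence.\<close>

lemma ex_length_two: "\<exists>N. \<forall>c\<in>A3. 2 \<le> length (comp_seq t n N c)"
proof (rule ccontr)
  assume no: "\<not> ?thesis"
  have pos: "1 \<le> length (comp_seq t n N c)" if "c \<in> A3" for N c
    using comp_words that unfolding word_morph_def by (simp add: Suc_le_eq)
  have wl: "length w \<le> length (morph_word (comp_seq t n N) w)" if "set w \<subseteq> A3" for N w
    using word_morph_length[of 1 "comp_seq t n N" w] pos that by simp
  have split: "length (comp_seq t n N (k (n + N))) = 1 \<and> k (n + N) \<in> A3 \<and> t (n + N) c = [k (n + N)]"
    if c: "c \<in> A3" "length (comp_seq t n (Suc N) c) = 1" for N c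
  proof -
    obtain s where s: "t (n + N) c = k (n + N) # s" "set (t (n + N) c) \<subseteq> A3" using mk[of "n + N"] c(1) unfolding marked_def by blast
    have kA: "k (n + N) \<in> A3" "set s \<subseteq> A3" using s by auto
    have "comp_seq t n (Suc N) c = comp_seq t n N (k (n + N)) @ morph_word (comp_seq t n N) s"
      by (simp add: morph_comp_def s(1))
    then have e: "length (comp_seq t n N (k (n + N))) + length (morph_word (comp_seq t n N) s) = 1" using c(2) by simp
    have "1 \<le> length (comp_seq t n N (k (n + N)))" using pos[OF kA(1)] .
    then have "length (comp_seq t n N (k (n + N))) = 1" "length (morph_word (comp_seq t n N) s) = 0" using e by linarith+
    then show ?thesis using kA s(1) wl[OF kA(2), of N] by simp
  qed
  have ones: "length (comp_seq t n N (k (n + N))) = 1" "k (n + N) \<in> A3" for N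
  proof -
    obtain c where "c \<in> A3" "\<not> 2 \<le> length (comp_seq t n (Suc N) c)" using no by blast
    then have "c \<in> A3" "length (comp_seq t n (Suc N) c) = 1" using pos[of c "Suc N"] by auto
    then show "length (comp_seq t n N (k (n + N))) = 1" "k (n + N) \<in> A3" using split by blast+
  qed
  \<comment> \<open>Letters that never grow are the markers of all levels, so any other letter produces a high power of k n.\<close>
  have tk: "t (n + N) (k (n + Suc N)) = [k (n + N)]" for N
    using split[OF ones(2)[of "Suc N"] ones(1)[of "Suc N"]] by blast
  have base: "comp_seq t n N (k (n + N)) = [k n]" for N
  proof (induction N)
    case (Suc N)
    have "comp_seq t n (Suc N) (k (n + Suc N)) = morph_word (comp_seq t n N) (t (n + N) (k (n + Suc N)))" by (simp add: morph_comp_def)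
    then show ?case using Suc.IH unfolding tk by simp
  qed simp
  have pow: "\<exists>z. comp_seq t n N c = replicate N (k n) @ z" if "c \<in> A3" "c \<noteq> k (n + N)" for N c
    using that
  proof (induction N arbitrary: c)
    case (Suc N)
    obtain s where s: "t (n + N) c = k (n + N) # s" "k (n + N) \<notin> set s" "set (t (n + N) c) \<subseteq> A3"
      using mk[of "n + N"] Suc.prems(1) unfolding marked_def by blast
    \<comment> \<open>By injectivity only the marker of the next level has the bare marker as its
      block.\<close>
    have "s \<noteq> []"
    proof
      assume "s = []"
      then have "t (n + N) c = t (n + N) (k (n + Suc N))" using s(1) tk by simp
      then have "c = k (n + Suc N)" using mk[of "n + N"] Suc.prems(1) ones(2)[of "Suc N"] unfolding marked_def inj_on_def by blast
      then show False using Suc.prems(2) by simp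
    qed
    then obtain e s' where e: "s = e # s'" by (cases s) auto
    have "e \<in> A3" "e \<noteq> k (n + N)" using s e by auto
    then obtain z where z: "comp_seq t n N e = replicate N (k n) @ z" using Suc.IH by blast
    have "comp_seq t n (Suc N) c = morph_word (comp_seq t n N) (k (n + N) # e # s')" by (simp add: morph_comp_def s(1) e)
    also have "\<dots> = replicate (Suc N) (k n) @ z @ morph_word (comp_seq t n N) s'" using base[of N] z by simp
    finally show ?case by blast
  qed simp
  have rep: "replicate N (k n) \<in> L n" for N
  proof -
    obtain c where c: "c \<in> A3" "c \<noteq> k (n + N)" unfolding A3_def by (metis insertCI numeral_eq_iff semiring_norm(88))
    then obtain z where "comp_seq t n N c = replicate N (k n) @ z" using pow by blast
    then show ?thesis using comp_letter_in_L[OF c(1), of n N] bilang_prefix[OF bil] by metis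
  qed
  obtain b where b: "b \<in> A3" "b \<noteq> k n" unfolding A3_def by (metis insertCI numeral_eq_iff semiring_norm(88))
  obtain K where K: "\<forall>v\<in>L n. K \<le> length v \<longrightarrow> sublist [b] v" using unif_recD[OF ur bilangD(4)[OF bil b(1)]] by blast
  have "sublist [b] (replicate K (k n))" using K rep[of K] by simp
  then show False using b(2) unfolding sublist_singleton by simp
qed

lemma growth: "\<exists>N. \<forall>c\<in>A3. K \<le> length (comp_seq t n N c)"
  by (rule comp_seq_growth[OF marked_words ex_length_two])

end

text \<open>Images of letters under long compositions are words of the language and become
  arbitrarily long, so uniform recurrence makes them contain every letter, and indeed every given
  word of the language.\<close>

lemma primitive_of_tower:
  assumes bil: "\<And>n. bilang (L n)" and ur: "\<And>n. unif_rec (L n)" and img: "\<And>n. L n = image_lang (t n) (L (Suc n))"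
    and t0: "word_morph (t 0)" and mk: "\<And>n. marked (k (Suc n)) (t (Suc n))"
  shows "primitive_seq A3 t" and "w \<in> L 0 \<longleftrightarrow> (\<exists>N. \<exists>a\<in>A3. sublist w (comp_seq t 0 N a))"
proof -
  \<comment> \<open>The tower starts at level 1; level 0 is added by hand through the image under
    \<open>t 0\<close>.\<close>
  interpret T: marked_tower "\<lambda>n. t (Suc n)" "\<lambda>n. L (Suc n)" "\<lambda>n. k (Suc n)"
    by unfold_locales (rule bil ur img mk)+
  have sh: "comp_seq (\<lambda>n. t (Suc n)) n N = comp_seq t (Suc n) N" for n N
    by (induction N) simp_all
  have words: "word_morph (t n)" for n using t0 T.marked_words by (cases n) auto
  have A: "set (comp_seq t n N a) \<subseteq> A3" if "a \<in> A3" for n N a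
    using word_morph_comp_seq[of t, OF words] that unfolding word_morph_def by blast
  have inL: "comp_seq t n N a \<in> L n" if a: "a \<in> A3" for n N a
  proof (cases n)
    case (Suc n')
    then show ?thesis using T.comp_letter_in_L[OF a, of n' N] unfolding sh by simp
  next
    case 0
    show ?thesis
    proof (cases N)
      case 0
      then show ?thesis using bilangD(4)[OF bil a] by simp
    next
      case (Suc N')
      have "comp_seq t 1 N' a \<in> L 1" using T.comp_letter_in_L[OF a, of 0 N'] unfolding sh by simp
      then have "morph_word (t 0) (comp_seq t 1 N' a) \<in> L 0" unfolding img[of 0] image_lang_def by auto
      then show ?thesis unfolding \<open>n = 0\<close> Suc comp_seq_Suc morph_comp_def by simp
    qed
  qed
  have grow: "\<exists>N. \<forall>c\<in>A3. K \<le> length (comp_seq t n N c)" for n K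
  proof (cases n)
    case (Suc n')
    then show ?thesis using T.growth[of K n'] unfolding sh by simp
  next
    case 0
    obtain N where N: "\<forall>c\<in>A3. K \<le> length (comp_seq t 1 N c)" using T.growth[of K 0] unfolding sh by auto
    have "\<forall>a\<in>A3. 1 \<le> length (t 0 a)" using t0 unfolding word_morph_def by (simp add: Suc_le_eq)
    then have "K \<le> length (comp_seq t 0 (Suc N) c)" if "c \<in> A3" for c
      using word_morph_length[of 1 "t 0" "comp_seq t 1 N c"] A[OF that, of 1 N] N that
      unfolding comp_seq_Suc morph_comp_def by fastforce
    then show ?thesis using 0 by blast
  qed
  show "primitive_seq A3 t" unfolding primitive_seq_def
  proof
    fix n
    have "\<forall>a\<in>A3. \<exists>K. \<forall>v\<in>L n. K \<le> length v \<longrightarrow> sublist [a] v" using unif_recD[OF ur bilangD(4)[OF bil]] by blast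
    then obtain K where K: "\<And>a v. a \<in> A3 \<Longrightarrow> v \<in> L n \<Longrightarrow> K a \<le> length v \<Longrightarrow> a \<in> set v" unfolding sublist_singleton by metis
    \<comment> \<open>The sum bounds the three constants, and the summand 2 excludes N = 0, where
      the images have length one.\<close>
    obtain N where N: "\<forall>c\<in>A3. K 1 + K 2 + K 3 + 2 \<le> length (comp_seq t n N c)" using grow by blast
    have "0 < N"
    proof (rule ccontr)
      assume "\<not> 0 < N"
      then show False using N[rule_format, of 1] by (simp add: A3_def)
    qed
    moreover have "a \<in> set (comp_seq t n N b)" if "a \<in> A3" "b \<in> A3" for a b
    proof (rule K[OF that(1) inL[OF that(2)]])
      have "K a \<le> K 1 + K 2 + K 3" using that(1) A3_iff by auto
      moreover have "K 1 + K 2 + K 3 + 2 \<le> length (comp_seq t n N b)" using N that(2) by blast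
      ultimately show "K a \<le> length (comp_seq t n N b)" by linarith
    qed
    ultimately show "\<exists>N>n. \<forall>b\<in>A3. \<forall>a\<in>A3. a \<in> set (comp_seq t n (N - n) b)"
      by (intro exI[of _ "n + N"]) simp
  qed
  show "w \<in> L 0 \<longleftrightarrow> (\<exists>N. \<exists>a\<in>A3. sublist w (comp_seq t 0 N a))"
  proof
    assume "w \<in> L 0"
    then obtain K where K: "\<forall>v\<in>L 0. K \<le> length v \<longrightarrow> sublist w v" using unif_recD[OF ur] by blast
    obtain N where N: "\<forall>c\<in>A3. K \<le> length (comp_seq t 0 N c)" using grow by blast
    have "(1::nat) \<in> A3" by (simp add: A3_def)
    then show "\<exists>N. \<exists>a\<in>A3. sublist w (comp_seq t 0 N a)" using K N inL[of 1 0 N] by blast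
  next
    assume "\<exists>N. \<exists>a\<in>A3. sublist w (comp_seq t 0 N a)"
    then show "w \<in> L 0" using inL bilangD(2)[OF bil] by blast
  qed
qed

lemma path_of_minimal_dendric:
  assumes X: "shift_space A3 X" and m: "minimal_shift X" and d: "dendric X"
  shows "\<exists>p0 \<sigma> v. p0 \<in> Sigma3 \<and> (\<forall>n\<ge>1. v n \<in> Gvertices \<and> G_edge (v n) (\<sigma> n) (v (n + 1))) \<and>
       (let t = (\<lambda>n. if n = 0 then perm_morph p0 else \<sigma> n) in
          primitive_seq A3 t \<and> X = generated_shift A3 t)"
proof -
  note L0 = shift_space_lang[OF X] unif_rec_of_minimal[OF X m] d[unfolded dendric_iff[OF X]]
  obtain v0 where v0: "labelled (lang X) v0" using ex_labelled[OF L0] by blast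
  obtain p0 v1 where p0: "p0 \<in> Sigma3" "v1 \<in> Gvertices" "labelled (permute_lang (inv p0) (lang X)) v1"
    using normalize_labels[OF v0] by blast
  \<comment> \<open>The state is a language with its vertex; the clause for n = 0 ties the first one
    to X.\<close>
  define P where "P n s \<longleftrightarrow> labelled (fst s) (snd s) \<and> snd s \<in> Gvertices \<and>
     (n = (0::nat) \<longrightarrow> s = (permute_lang (inv p0) (lang X), v1))" for n and s :: "nat list set \<times> nat \<times> nat"
  define Q where "Q s s' \<longleftrightarrow> (\<exists>f. G_edge (snd s) f (snd s') \<and> fst s = image_lang f (fst s'))" for s s' :: "nat list set \<times> nat \<times> nat"
  have "\<exists>g. \<forall>n. P n (g n) \<and> Q (g n) (g (Suc n))"
  proof (rule dependent_nat_choice)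
    show "\<exists>s. P 0 s" unfolding P_def using p0 by (intro exI[of _ "(permute_lang (inv p0) (lang X), v1)"]) simp
    fix s n assume "P n s"
    then obtain f L' v' where "G_edge (snd s) f v'" "fst s = image_lang f L'" "labelled L' v'" 
      unfolding P_def using labelled_step by blast
    then have "P (Suc n) (L',v') \<and> Q s (L',v')" unfolding P_def Q_def G_edge_def by auto
    then show "\<exists>s'. P (Suc n) s' \<and> Q s s'" by blast
  qed
  then obtain g where g: "\<And>n. P n (g n)" "\<And>n. Q (g n) (g (Suc n))" by blast
  obtain F where F: "\<And>n. G_edge (snd (g n)) (F n) (snd (g (Suc n)))" "\<And>n. fst (g n) = image_lang (F n) (fst (g (Suc n)))"
    using g(2) unfolding Q_def by metis
  \<comment> \<open>\<open>g n\<close> describes level n + 1, since level 0 is occupied by the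
    renaming \<open>p0\<close>; hence the shifts of the index by one below.\<close>
  define t where "t = (\<lambda>n. if n = 0 then perm_morph p0 else F (n - 1))"
  define L where "L n = (case n of 0 \<Rightarrow> lang X | Suc n \<Rightarrow> fst (g n))" for n
  obtain k where k: "\<And>n. marked (k n) (F n)" using edge_marked[OF F(1)] by metis
  have lab: "labelled (fst (g n)) (snd (g n))" for n using g(1) unfolding P_def by blast
  have bil: "bilang (L n)" for n using lab L0(1) unfolding L_def labelled_def by (cases n) auto
  have ur: "unif_rec (L n)" for n using lab L0(2) unfolding L_def labelled_def by (cases n) auto
  have g0: "fst (g 0) = permute_lang (inv p0) (lang X)" using g(1)[of 0] unfolding P_def by simp
  have img: "L n = image_lang (t n) (L (Suc n))" for n
  proof (cases n)
    case 0
    have "bilang (fst (g 0))" using lab unfolding labelled_def by blast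
    then have "image_lang (perm_morph p0) (fst (g 0)) = permute_lang p0 (fst (g 0))" by (rule image_lang_perm[OF p0(1)])
    also have "\<dots> = lang X" unfolding g0 permute_inv(1)[OF p0(1)] ..
    finally show ?thesis unfolding L_def t_def 0 by simp
  next
    case (Suc n')
    then show ?thesis using F(2)[of n'] unfolding L_def t_def by simp
  qed
  have t0: "word_morph (t 0)" unfolding t_def using perm_word_morph[OF p0(1)] by simp
  have mk: "marked (k (Suc n - 1)) (t (Suc n))" for n unfolding t_def using k by simp
  note tower = primitive_of_tower[of L t "\<lambda>n. k (n - 1)", OF bil ur img t0 mk]
  \<comment> \<open>Both shifts are compared through \<open>L 0\<close>; that its words suffice for
    membership in X is closedness of X.\<close>
  have gen: "X = generated_shift A3 t"
  proof
    show "X \<subseteq> generated_shift A3 t"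
    proof
      fix x assume x: "x \<in> X"
      then have "\<forall>i. x i \<in> A3" using X unfolding shift_space_def by blast
      moreover have "w \<in> L 0" if "factor_of w x" for w using x that unfolding L_def lang_def by auto
      ultimately show "x \<in> generated_shift A3 t" unfolding generated_shift_def using tower(2) by blast
    qed
    show "generated_shift A3 t \<subseteq> X"
    proof
      fix x assume x: "x \<in> generated_shift A3 t"
      show "x \<in> X"
      proof (rule closed_lang)
        fix w assume "factor_of w x"
        then have "w \<in> L 0" using x tower(2) unfolding generated_shift_def by blast
        then show "w \<in> lang X" unfolding L_def by simp
      qed (use X in \<open>auto simp: shift_space_def\<close>)
    qed
  qed
  have path: "\<forall>n\<ge>1. snd (g (n - 1)) \<in> Gvertices \<and> G_edge (snd (g (n - 1))) (F (n - 1)) (snd (g (n + 1 - 1)))"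
  proof (intro allI impI conjI)
    fix n :: nat assume "1 \<le> n"
    then obtain n' where "n = Suc n'" by (cases n) auto
    then show "G_edge (snd (g (n - 1))) (F (n - 1)) (snd (g (n + 1 - 1)))" using F(1)[of n'] by simp
    show "snd (g (n - 1)) \<in> Gvertices" using g(1) unfolding P_def by blast
  qed
  show ?thesis
    by (rule exI[of _ p0], rule exI[of _ "\<lambda>n. F (n - 1)"], rule exI[of _ "\<lambda>n. snd (g (n - 1))"])
      (use p0(1) path tower(1) gen in \<open>simp add: t_def[symmetric] Let_def\<close>)
qed

theorem theorem5p13:
  assumes "shift_space A3 X"
  shows "(minimal_shift X \<and> dendric X) \<longleftrightarrow>
    (\<exists>p0 \<sigma> v. p0 \<in> Sigma3 \<and> (\<forall>n\<ge>1. v n \<in> Gvertices \<and> G_edge (v n) (\<sigma> n) (v (n + 1))) \<and>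
       (let t = (\<lambda>n. if n = 0 then perm_morph p0 else \<sigma> n) in
          primitive_seq A3 t \<and> X = generated_shift A3 t))"
proof
  assume "minimal_shift X \<and> dendric X"
  then show "\<exists>p0 \<sigma> v. p0 \<in> Sigma3 \<and> (\<forall>n\<ge>1. v n \<in> Gvertices \<and> G_edge (v n) (\<sigma> n) (v (n + 1))) \<and>
       (let t = (\<lambda>n. if n = 0 then perm_morph p0 else \<sigma> n) in
          primitive_seq A3 t \<and> X = generated_shift A3 t)"
    using path_of_minimal_dendric[OF assms] by blast
next
  assume "\<exists>p0 \<sigma> v. p0 \<in> Sigma3 \<and> (\<forall>n\<ge>1. v n \<in> Gvertices \<and> G_edge (v n) (\<sigma> n) (v (n + 1))) \<and>
       (let t = (\<lambda>n. if n = 0 then perm_morph p0 else \<sigma> n) in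
          primitive_seq A3 t \<and> X = generated_shift A3 t)"
  then obtain p0 \<sigma> v where *: "p0 \<in> Sigma3" "\<forall>n\<ge>1. v n \<in> Gvertices \<and> G_edge (v n) (\<sigma> n) (v (n + 1))"
      "primitive_seq A3 (\<lambda>n. if n = 0 then perm_morph p0 else \<sigma> n)"
      "X = generated_shift A3 (\<lambda>n. if n = 0 then perm_morph p0 else \<sigma> n)"
    unfolding Let_def by blast
  show "minimal_shift X \<and> dendric X"
    by (rule minimal_dendric_of_path[OF assms *(1,2) refl *(3,4)])
qed

end
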